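(* The complement $\mathbb{C}^*\smallsetminus\partial\mathcal{M}_3(\theta)$ is exactly the set of parameters $c\in\mathbb{C}^*$ for which the corresponding cubic $P_c$ is $J$-stable in the family $\mathcal{P}_3^{cm}(\theta)=\{P_c\}_{c\in\mathbb{C}^*}$.
   Context: Fix an irrational number $0<\theta<1$ of Brjuno type, i.e. $\sum_{n\ge1}(\log q_{n+1})/q_n<\infty$, where $p_n/q_n$ are the continued fraction convergents of $\theta$; let $\lambda=e^{2\pi i\theta}$. For $c\in\mathbb{C}^*=\mathbb{C}\smallsetminus\{0\}$ let $$P_c(z)=\lambda z\left(1-\tfrac12\left(1+\tfrac1c\right)z+\tfrac{1}{3c}z^2\right),$$ a cubic polynomial with critical points $c$ and $1$ and with a Siegel disk of rotation number $\theta$ centered at the fixed point $0$. The parameter space $\mathcal{P}_3^{cm}(\theta)=\{P_c\}_{c\in\mathbb{C}^*}$ is identified with $\mathbb{C}^*$. The cubic connectedness locus is $\mathcal{M}_3(\theta)=\{c\in\mathbb{C}^*: J(P_c)\text{ is connected}\}$, where $J(P_c)$ is the Julia set; its boundary is taken in $\mathbb{C}^*$. The cubic $P_{c_0}$ (or the parameter $c_0$) is $J$-stable if, over some neighborhood of $c_0$ in $\mathbb{C}^*$, the Julia sets move holomorphically respecting the dynamics: there is a holomorphic motion $\phi_c:J(P_{c_0})\to\mathbb{C}$ with $\phi_{c_0}=\mathrm{id}$, $\phi_c(J(P_{c_0}))=J(P_c)$ and $\phi_c\circ P_{c_0}=P_c\circ\phi_c$ on $J(P_{c_0})$. *)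

theory Defs
  imports "HOL-Complex_Analysis.Complex_Analysis"
begin

text \<open>Complete quotients of the regular continued fraction expansion; the partial quotients
  are their integer parts.\<close>

primrec cf_complete :: "real \<Rightarrow> nat \<Rightarrow> real" where
  "cf_complete \<theta> 0 = \<theta>"
| "cf_complete \<theta> (Suc n) = 1 / frac (cf_complete \<theta> n)"

definition cf_digit :: "real \<Rightarrow> nat \<Rightarrow> int" where
  "cf_digit \<theta> n = \<lfloor>cf_complete \<theta> n\<rfloor>"

text \<open>The denominator \<open>q\<^sub>n\<close> of the convergent
  \<open>p\<^sub>n / q\<^sub>n = [a\<^sub>0; a\<^sub>1, \<dots>, a\<^sub>n]\<close> in lowest terms.\<close>

fun cf_denom :: "real \<Rightarrow> nat \<Rightarrow> int" where
  "cf_denom \<theta> 0 = 1"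
| "cf_denom \<theta> (Suc 0) = cf_digit \<theta> 1"
| "cf_denom \<theta> (Suc (Suc n)) =
     cf_digit \<theta> (Suc (Suc n)) * cf_denom \<theta> (Suc n) + cf_denom \<theta> n"

text \<open>The series is indexed from \<open>n = 1\<close>, hence the shift by one.\<close>

definition brjuno :: "real \<Rightarrow> bool" where
  "brjuno \<theta> \<longleftrightarrow> \<theta> \<notin> \<rat> \<and>
     summable (\<lambda>n. ln (real_of_int (cf_denom \<theta> (n + 2))) / real_of_int (cf_denom \<theta> (n + 1)))"

text \<open>Normality with respect to the spherical metric, for families of holomorphic functions on a
  connected open set \<open>U\<close>: there a locally uniform limit of holomorphic functions into the Riemann
  sphere is either finite everywhere or identically \<open>\<infinity>\<close>.\<close>

definition normal_family_on :: "complex set \<Rightarrow> (complex \<Rightarrow> complex) set \<Rightarrow> bool" where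
  "normal_family_on U F \<longleftrightarrow>
     (\<forall>\<sigma>::nat \<Rightarrow> complex \<Rightarrow> complex. range \<sigma> \<subseteq> F \<longrightarrow>
       (\<exists>r::nat \<Rightarrow> nat. strict_mono r \<and>
         ((\<exists>g. \<forall>K. compact K \<and> K \<subseteq> U \<longrightarrow> uniform_limit K (\<sigma> \<circ> r) g sequentially) \<or>
          (\<forall>K B. compact K \<and> K \<subseteq> U \<longrightarrow>
             (\<forall>\<^sub>F n in sequentially. \<forall>z\<in>K. B \<le> norm (\<sigma> (r n) z))))))"

text \<open>For entire \<open>f\<close>. The point at infinity is left out; for a polynomial of degree at least 2 it
  belongs to the Fatou set.\<close>

definition fatou_set :: "(complex \<Rightarrow> complex) \<Rightarrow> complex set" where
  "fatou_set f =
     {z. \<exists>U. open U \<and> connected U \<and> z \<in> U \<and> normal_family_on U (range (\<lambda>n. f ^^ n))}"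

definition julia_set :: "(complex \<Rightarrow> complex) \<Rightarrow> complex set" where
  "julia_set f = - fatou_set f"

definition holomorphic_motion ::
    "complex set \<Rightarrow> complex \<Rightarrow> complex set \<Rightarrow> (complex \<Rightarrow> complex \<Rightarrow> complex) \<Rightarrow> bool" where
  "holomorphic_motion W c0 E \<phi> \<longleftrightarrow>
     (\<forall>z\<in>E. \<phi> c0 z = z) \<and>
     (\<forall>c\<in>W. inj_on (\<phi> c) E) \<and>
     (\<forall>z\<in>E. (\<lambda>c. \<phi> c z) holomorphic_on W)"

text \<open>\<open>\<Lambda>\<close> is the (open) parameter space of the family \<open>P\<close>.\<close>

definition J_stable ::
    "complex set \<Rightarrow> (complex \<Rightarrow> complex \<Rightarrow> complex) \<Rightarrow> complex \<Rightarrow> bool" where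
  "J_stable \<Lambda> P c0 \<longleftrightarrow>
     (\<exists>W \<phi>. open W \<and> c0 \<in> W \<and> W \<subseteq> \<Lambda> \<and>
        holomorphic_motion W c0 (julia_set (P c0)) \<phi> \<and>
        (\<forall>c\<in>W. \<phi> c ` julia_set (P c0) = julia_set (P c)) \<and>
        (\<forall>c\<in>W. \<forall>z\<in>julia_set (P c0). \<phi> c (P c0 z) = P c (\<phi> c z)))"

definition siegel_cubic :: "real \<Rightarrow> complex \<Rightarrow> complex \<Rightarrow> complex" where
  "siegel_cubic \<theta> c z =
     exp (2 * of_real pi * \<i> * of_real \<theta>) * z * (1 - 1/2 * (1 + 1/c) * z + 1 / (3 * c) * z\<^sup>2)"

abbreviation punctured_plane :: "complex set" where
  "punctured_plane \<equiv> UNIV - {0}"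

definition connectedness_locus :: "real \<Rightarrow> complex set" where
  "connectedness_locus \<theta> = {c \<in> punctured_plane. connected (julia_set (siegel_cubic \<theta> c))}"

end

theory Submission
  imports Defs "HOL-Computational_Algebra.Fundamental_Theorem_Algebra"
begin

text \<open>
  The connectedness of the Julia set of a polynomial is decided by its critical points: it is
  connected exactly when all of them lie in the filled Julia set
  (\<open>connected_julia_set_poly_iff\<close>, under the normalisation that \<open>0\<close> has a bounded
  orbit). In the cubic family the critical points are \<open>1\<close> and \<open>c\<close>, and since the fixed point \<open>0\<close> has a multiplier of modulus one they cannot both escape to infinity
  (\<open>critical_point_in_filled_julia_if_indifferent\<close>).

  A parameter \<open>c\<^sub>0\<close> off the boundary of the connectedness locus therefore has a neighbourhood of one
  of two kinds. Either both critical orbits are bounded throughout, or one fixed critical point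
  escapes throughout and the other orbit is bounded throughout. In both cases there are an escape
  radius \<open>R\<close> and a value \<open>a\<close> with \<open>\<bar>a\<bar> \<ge> R\<close> that no critical orbit hits, for any parameter of a
  small disc about \<open>c\<^sub>0\<close>. Then all iterated preimages of \<open>a\<close> are simple, so they can be continued
  holomorphically over the disc without collisions and compatibly with the dynamics. By the
  \<open>\<lambda>\<close>-lemma (\<open>holomorphic_motion_extension\<close>) this motion extends to the closure of the backward orbit
  of \<open>a\<close>. That closure is the disjoint union of the backward orbit and the Julia set
  (\<open>julia_set_eq_limit_backward_orbit\<close>), so the Julia sets move holomorphically
  (\<open>J_stable_if_escaping_value_avoided\<close>).

  Conversely, the maps of a holomorphic motion of a compact set are homeomorphisms over a small
  disc. If \<open>c\<^sub>0\<close> is \<open>J\<close>-stable, the connectedness of the Julia set is thus constant near \<open>c\<^sub>0\<close>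
  (\<open>J_stable_connected_locally_constant\<close>), which is impossible at a boundary point.
\<close>

section \<open>Escape radii, filled Julia sets and Julia sets\<close>

text \<open>The factor \<open>2\<close> makes orbits grow geometrically once they have left the disc.\<close>

definition escape_radius :: "(complex \<Rightarrow> complex) \<Rightarrow> real \<Rightarrow> bool" where
  "escape_radius f R \<longleftrightarrow> 0 < R \<and> (\<forall>z. R \<le> norm z \<longrightarrow> 2 * norm z \<le> norm (f z))"

definition filled_julia :: "(complex \<Rightarrow> complex) \<Rightarrow> complex set" where
  "filled_julia f = {z. bounded (range (\<lambda>n. (f ^^ n) z))}"

lemma escape_radius_mono: "escape_radius f R \<Longrightarrow> R \<le> R' \<Longrightarrow> escape_radius f R'"
  unfolding escape_radius_def by force

lemma escape_growth:
  assumes "escape_radius f R" "R \<le> norm z"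
  shows "2 ^ n * norm z \<le> norm ((f ^^ n) z)"
proof (induction n)
  case (Suc n)
  have "norm z \<le> 2 ^ n * norm z"
    using mult_right_mono[of 1 "2 ^ n" "norm z"] by simp
  then have "R \<le> norm ((f ^^ n) z)"
    using Suc assms(2) by linarith
  then have "2 * norm ((f ^^ n) z) \<le> norm (f ((f ^^ n) z))"
    using assms(1) unfolding escape_radius_def by blast
  then show ?case using Suc by simp
qed simp

lemma escape_growth_from:
  assumes "escape_radius f R" "R \<le> norm ((f ^^ N) z)" "N \<le> n"
  shows "2 ^ (n - N) * norm ((f ^^ N) z) \<le> norm ((f ^^ n) z)"
proof -
  have "(f ^^ n) z = (f ^^ (n - N)) ((f ^^ N) z)"
    using assms(3) by (metis comp_apply funpow_add le_add_diff_inverse2)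
  then show ?thesis
    using escape_growth[OF assms(1,2), of "n - N"] by simp
qed

lemma escape_growth_from_le:
  assumes "escape_radius f R" "R \<le> norm ((f ^^ N) z)" "N \<le> n"
  shows "norm ((f ^^ N) z) \<le> norm ((f ^^ n) z)"
proof -
  have "1 * norm ((f ^^ N) z) \<le> 2 ^ (n - N) * norm ((f ^^ N) z)"
    by (intro mult_right_mono) auto
  then show ?thesis
    using escape_growth_from[OF assms] by linarith
qed

lemma escape_at_top:
  assumes "escape_radius f R" "R \<le> norm ((f ^^ N) z)"
  shows "\<exists>M\<ge>N. B \<le> norm ((f ^^ M) z)"
proof -
  have R: "R > 0" using assms unfolding escape_radius_def by blast
  obtain k where k: "B / R < 2 ^ k"
    using real_arch_pow[of 2 "B / R"] by auto
  have "B \<le> 2 ^ k * R" using k R by (simp add: field_simps)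
  also have "\<dots> \<le> 2 ^ (N + k - N) * norm ((f ^^ N) z)"
    using assms(2) by simp
  also have "\<dots> \<le> norm ((f ^^ (N + k)) z)"
    by (rule escape_growth_from[OF assms]) simp
  finally show ?thesis by (metis le_add1)
qed

lemma filled_julia_iff:
  assumes "escape_radius f R"
  shows "z \<in> filled_julia f \<longleftrightarrow> (\<forall>n. norm ((f ^^ n) z) < R)"
proof
  assume "z \<in> filled_julia f"
  then obtain B where B: "\<And>n. norm ((f ^^ n) z) \<le> B"
    unfolding filled_julia_def bounded_iff by auto
  show "\<forall>n. norm ((f ^^ n) z) < R"
  proof (rule ccontr)
    assume "\<not> ?thesis"
    then obtain N where N: "R \<le> norm ((f ^^ N) z)" by (meson not_le)
    obtain M where "B + 1 \<le> norm ((f ^^ M) z)"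
      using escape_at_top[OF assms N] by blast
    then show False using B[of M] by linarith
  qed
next
  assume "\<forall>n. norm ((f ^^ n) z) < R"
  then show "z \<in> filled_julia f"
    unfolding filled_julia_def bounded_iff by (auto intro: less_imp_le)
qed

lemma not_filled_juliaE:
  assumes "escape_radius f R" "z \<notin> filled_julia f"
  obtains N where "B \<le> norm ((f ^^ N) z)" "R \<le> norm ((f ^^ N) z)" "M \<le> N"
proof -
  obtain N where N: "R \<le> norm ((f ^^ N) z)"
    using assms(2) filled_julia_iff[OF assms(1), of z] by (meson not_le)
  have "norm ((f ^^ N) z) \<le> norm ((f ^^ max N M) z)"
    by (rule escape_growth_from_le[OF assms(1) N]) simp
  then have "R \<le> norm ((f ^^ max N M) z)" using N by linarith
  then obtain L where "L \<ge> max N M" "max B R \<le> norm ((f ^^ L) z)"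
    using escape_at_top[OF assms(1)] by metis
  then show ?thesis using that[of L] by simp
qed

lemma filled_julia_invariant: "f z \<in> filled_julia f \<longleftrightarrow> z \<in> filled_julia f"
proof -
  have "range (\<lambda>n. (f ^^ n) z) = insert ((f ^^ 0) z) (range (\<lambda>n. (f ^^ Suc n) z))"
    by (subst UNIV_nat_eq) (simp only: image_insert image_image)
  also have "\<dots> = insert z (range (\<lambda>n. (f ^^ n) (f z)))"
    by (simp add: funpow_swap1)
  finally have "range (\<lambda>n. (f ^^ n) z) = insert z (range (\<lambda>n. (f ^^ n) (f z)))" .
  then show ?thesis unfolding filled_julia_def by simp
qed

lemma filled_julia_invariant_funpow: "(f ^^ n) z \<in> filled_julia f \<longleftrightarrow> z \<in> filled_julia f"
  by (induction n) (simp_all add: filled_julia_invariant)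

lemma filled_julia_fixed_point: "f z = z \<Longrightarrow> z \<in> filled_julia f"
proof -
  assume "f z = z"
  then have "(f ^^ n) z = z" for n by (induction n) auto
  then show ?thesis unfolding filled_julia_def by simp
qed

lemma holomorphic_on_funpow:
  assumes "f holomorphic_on UNIV"
  shows "(f ^^ n) holomorphic_on S"
proof (induction n)
  case 0 show ?case by (simp add: id_def holomorphic_on_ident)
next
  case (Suc n)
  then show ?case
    using holomorphic_on_compose[of "f ^^ n" S f] assms
    by (simp add: o_def) (metis Suc holomorphic_on_compose holomorphic_on_subset o_def top_greatest)
qed

lemma continuous_on_funpow:
  "f holomorphic_on UNIV \<Longrightarrow> continuous_on S (f ^^ n)"
  by (meson holomorphic_on_funpow holomorphic_on_imp_continuous_on)

lemma open_funpow_norm_gt: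
  assumes "f holomorphic_on UNIV"
  shows "open {z. B < norm ((f ^^ n) z)}"
  by (intro open_Collect_less continuous_intros continuous_on_funpow assms)

lemma open_funpow_norm_less:
  assumes "f holomorphic_on UNIV"
  shows "open {z. norm ((f ^^ n) z) < B}"
  by (intro open_Collect_less continuous_intros continuous_on_funpow assms)

lemma closed_funpow_norm_le:
  assumes "f holomorphic_on UNIV"
  shows "closed {z. norm ((f ^^ n) z) \<le> B}"
  by (intro closed_Collect_le continuous_intros continuous_on_funpow assms)

lemma filled_julia_eq_Inter:
  assumes "escape_radius f R"
  shows "filled_julia f = (\<Inter>n. {z. norm ((f ^^ n) z) \<le> R})"
proof -
  have "z \<in> filled_julia f" if "\<And>n. norm ((f ^^ n) z) \<le> R" for z
    using that unfolding filled_julia_def bounded_iff by auto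
  then show ?thesis
    using filled_julia_iff[OF assms] by (auto intro: less_imp_le)
qed

lemma compact_filled_julia:
  assumes "f holomorphic_on UNIV" "escape_radius f R"
  shows "compact (filled_julia f)"
proof -
  have "closed (filled_julia f)"
    unfolding filled_julia_eq_Inter[OF assms(2)]
    by (intro closed_INT closed_funpow_norm_le assms ballI)
  moreover have "filled_julia f \<subseteq> ball 0 R"
  proof
    fix z assume "z \<in> filled_julia f"
    then have "norm ((f ^^ 0) z) < R" using filled_julia_iff[OF assms(2)] by blast
    then show "z \<in> ball 0 R" by simp
  qed
  ultimately show ?thesis
    by (meson bounded_ball bounded_subset compact_eq_bounded_closed)
qed

text \<open>A sequence taken from the family of iterates may repeat indices; this supplies the subsequence
  along which either the iterate is fixed or its index tends to infinity.\<close>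

lemma nat_sequence_constant_or_strict_mono:
  fixes k :: "nat \<Rightarrow> nat"
  shows "\<exists>r::nat \<Rightarrow> nat. strict_mono r \<and>
    ((\<forall>i. k (r i) = k (r 0)) \<or> strict_mono (\<lambda>i. k (r i)))"
proof (cases "\<exists>m. infinite {i. k i = m}")
  case True
  then obtain m where "infinite {i. k i = m}" by blast
  then obtain r :: "nat \<Rightarrow> nat" where "strict_mono r" "\<forall>n. r n \<in> {i. k i = m}"
    using infinite_enumerate by blast
  then show ?thesis by (intro exI[of _ r]) simp
next
  case False
  have ex: "\<exists>j>i. k j > k i" for i
  proof -
    have "finite ({..i} \<union> (\<Union>m\<in>{..k i}. {j. k j = m}))"
      using False by auto
    then obtain j where "j \<notin> {..i} \<union> (\<Union>m\<in>{..k i}. {j. k j = m})"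
      using ex_new_if_finite[OF infinite_UNIV_nat] by blast
    then show ?thesis by (intro exI[of _ j]) auto
  qed
  then obtain nx where nx: "\<And>i. nx i > i \<and> k (nx i) > k i" by metis
  define r where "r i = (nx ^^ i) 0" for i
  have "strict_mono r" "strict_mono (\<lambda>i. k (r i))"
    using nx unfolding strict_mono_Suc_iff r_def by simp_all
  then show ?thesis by blast
qed

text \<open>Around an escaping point all late iterates are uniformly large; around an interior point of
  the filled Julia set the iterates are uniformly bounded, so Montel's theorem applies. At a
  boundary point neither kind of subsequence limit can occur.\<close>

theorem julia_set_eq_frontier:
  assumes hol: "f holomorphic_on UNIV" and R: "escape_radius f R"
  shows "julia_set f = frontier (filled_julia f)"
proof -
  have Rpos: "R > 0" using R unfolding escape_radius_def by blast
  have cl: "closed (filled_julia f)"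
    using compact_filled_julia[OF hol R] compact_imp_closed by blast
  have esc: "z \<in> fatou_set f" if z: "z \<notin> filled_julia f" for z
  proof -
    obtain N where N: "R + 1 \<le> norm ((f ^^ N) z)"
      using not_filled_juliaE[OF R z, of "R + 1"] by metis
    obtain e where e: "e > 0" "ball z e \<subseteq> {w. R < norm ((f ^^ N) w)}"
      by (rule openE[OF open_funpow_norm_gt[OF hol, of R N], of z]) (use N in auto)
    have "normal_family_on (ball z e) (range (\<lambda>n. f ^^ n))"
      unfolding normal_family_on_def
    proof (intro allI impI)
      fix \<sigma> :: "nat \<Rightarrow> complex \<Rightarrow> complex"
      assume "range \<sigma> \<subseteq> range (\<lambda>n. f ^^ n)"
      then have "\<forall>i. \<exists>n. \<sigma> i = f ^^ n" by blast
      then obtain k where k: "\<And>i. \<sigma> i = f ^^ k i" by metis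
      obtain r :: "nat \<Rightarrow> nat" where r: "strict_mono r"
        and "(\<forall>i. k (r i) = k (r 0)) \<or> strict_mono (\<lambda>i. k (r i))"
        using nat_sequence_constant_or_strict_mono[of k] by blast
      then consider "\<And>i. k (r i) = k (r 0)" | "strict_mono (\<lambda>i. k (r i))" by blast
      then show "\<exists>r. strict_mono r \<and>
        ((\<exists>g. \<forall>K. compact K \<and> K \<subseteq> ball z e \<longrightarrow> uniform_limit K (\<sigma> \<circ> r) g sequentially) \<or>
         (\<forall>K B. compact K \<and> K \<subseteq> ball z e \<longrightarrow>
            (\<forall>\<^sub>F n in sequentially. \<forall>z\<in>K. B \<le> cmod (\<sigma> (r n) z))))"
      proof cases
        case 1
        have "(\<sigma> \<circ> r) n = f ^^ k (r 0)" for n using k 1[of n] by simp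
        then have "\<sigma> \<circ> r = (\<lambda>n. f ^^ k (r 0))" by blast
        then show ?thesis
          using r by (intro exI[of _ r] conjI disjI1 exI[of _ "f ^^ k (r 0)"])
            (simp_all add: uniform_limit_iff)
      next
        case 2
        have "\<forall>\<^sub>F n in sequentially. \<forall>z\<in>K. B \<le> cmod (\<sigma> (r n) z)"
          if K: "K \<subseteq> ball z e" for K B
        proof -
          obtain m where m: "B / R < 2 ^ m"
            using real_arch_pow[of 2 "B / R"] by auto
          have "B \<le> cmod (\<sigma> (r n) w)" if n: "n \<ge> N + m" and w: "w \<in> K" for n w
          proof -
            have kn: "k (r n) \<ge> N + m"
              using n seq_suble[OF 2, of n] by linarith
            have Rw: "R \<le> norm ((f ^^ N) w)" using e w K by force
            have "B \<le> 2 ^ m * R" using m Rpos by (simp add: field_simps)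
            also have "\<dots> \<le> 2 ^ (k (r n) - N) * norm ((f ^^ N) w)"
              by (rule mult_mono) (use kn Rw Rpos in \<open>auto intro: power_increasing\<close>)
            also have "\<dots> \<le> norm ((f ^^ k (r n)) w)"
              by (rule escape_growth_from[OF R Rw]) (use kn in simp)
            finally show ?thesis by (simp add: k)
          qed
          then show ?thesis unfolding eventually_sequentially by blast
        qed
        then show ?thesis using r by blast
      qed
    qed
    then show ?thesis
      unfolding fatou_set_def mem_Collect_eq
      by (intro exI[of _ "ball z e"]) (use e(1) in simp)
  qed
  have int: "z \<in> fatou_set f" if z: "z \<in> interior (filled_julia f)" for z
  proof -
    obtain e where e: "e > 0" "ball z e \<subseteq> filled_julia f"
      using z by (meson mem_interior)
    have "normal_family_on (ball z e) (range (\<lambda>n. f ^^ n))"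
      unfolding normal_family_on_def
    proof (intro allI impI)
      fix \<sigma> :: "nat \<Rightarrow> complex \<Rightarrow> complex"
      assume rng: "range \<sigma> \<subseteq> range (\<lambda>n. f ^^ n)"
      have bd: "\<exists>B. \<forall>h\<in>range (\<lambda>n. f ^^ n). \<forall>z\<in>K. norm (h z) \<le> B" if "K \<subseteq> ball z e" for K
      proof -
        have "norm ((f ^^ n) w) \<le> R" if "w \<in> K" for n w
          using that \<open>K \<subseteq> ball z e\<close> e filled_julia_iff[OF R] by (meson less_imp_le subsetD)
        then show ?thesis by blast
      qed
      have hols: "h holomorphic_on ball z e" if "h \<in> range (\<lambda>n. f ^^ n)" for h
        using that holomorphic_on_funpow[OF hol] by blast
      obtain g r where "strict_mono (r :: nat \<Rightarrow> nat)"
          "\<And>K. \<lbrakk>compact K; K \<subseteq> ball z e\<rbrakk> \<Longrightarrow> uniform_limit K (\<sigma> \<circ> r) g sequentially"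
        by (rule Montel[of "ball z e" "range (\<lambda>n. f ^^ n)" \<sigma>, OF open_ball hols bd rng]) blast+
      then show "\<exists>r. strict_mono r \<and>
        ((\<exists>g. \<forall>K. compact K \<and> K \<subseteq> ball z e \<longrightarrow> uniform_limit K (\<sigma> \<circ> r) g sequentially) \<or>
         (\<forall>K B. compact K \<and> K \<subseteq> ball z e \<longrightarrow>
            (\<forall>\<^sub>F n in sequentially. \<forall>z\<in>K. B \<le> cmod (\<sigma> (r n) z))))"
        by blast
    qed
    then show ?thesis
      unfolding fatou_set_def mem_Collect_eq
      by (intro exI[of _ "ball z e"]) (use e(1) in simp)
  qed
  have bdry: "z \<notin> fatou_set f" if z: "z \<in> frontier (filled_julia f)" for z
  proof
    assume "z \<in> fatou_set f"
    then obtain U where U: "open U" "z \<in> U" "normal_family_on U (range (\<lambda>n. f ^^ n))"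
      unfolding fatou_set_def by blast
    have zK: "z \<in> filled_julia f" using z cl by (simp add: frontier_def)
    obtain y where y: "y \<in> U" "y \<notin> filled_julia f"
    proof -
      have "\<not> U \<subseteq> filled_julia f"
        using z U unfolding frontier_def by (meson DiffD2 interiorI)
      then show ?thesis using that by blast
    qed
    obtain r :: "nat \<Rightarrow> nat" where r: "strict_mono r" and
      alt: "(\<exists>g. \<forall>K. compact K \<and> K \<subseteq> U \<longrightarrow> uniform_limit K ((\<lambda>n. f ^^ n) \<circ> r) g sequentially) \<or>
         (\<forall>K B. compact K \<and> K \<subseteq> U \<longrightarrow>
            (\<forall>\<^sub>F n in sequentially. \<forall>z\<in>K. B \<le> cmod ((f ^^ r n) z)))"
      using U(3)[unfolded normal_family_on_def, rule_format, of "\<lambda>n. f ^^ n", OF order_refl]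
      by (elim exE conjE) (rule that)
    from alt show False
    proof (elim disjE exE)
      fix g assume g: "\<forall>K. compact K \<and> K \<subseteq> U \<longrightarrow> uniform_limit K ((\<lambda>n. f ^^ n) \<circ> r) g sequentially"
      then have "uniform_limit {y} ((\<lambda>n. f ^^ n) \<circ> r) g sequentially"
        using g[rule_format, of "{y}"] y by simp
      then have "(\<lambda>n. (f ^^ r n) y) \<longlonglongrightarrow> g y"
        using tendsto_uniform_limitI by fastforce
      then have "Bseq (\<lambda>n. (f ^^ r n) y)" using convergentI convergent_imp_Bseq by blast
      then obtain B where B: "\<And>n. norm ((f ^^ r n) y) \<le> B" unfolding Bseq_def by blast
      obtain N where N: "B + 1 \<le> norm ((f ^^ N) y)" "R \<le> norm ((f ^^ N) y)"
        using not_filled_juliaE[OF R y(2), of "B + 1"] by metis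
      have "norm ((f ^^ N) y) \<le> norm ((f ^^ r N) y)"
        by (rule escape_growth_from_le[OF R N(2)]) (use r seq_suble in blast)
      then show False using B[of N] N by linarith
    next
      assume *: "\<forall>K B. compact K \<and> K \<subseteq> U \<longrightarrow>
            (\<forall>\<^sub>F n in sequentially. \<forall>z\<in>K. B \<le> cmod ((f ^^ r n) z))"
      have "\<forall>\<^sub>F n in sequentially. R \<le> cmod ((f ^^ r n) z)"
        using *[rule_format, of "{z}" R] U(2) by simp
      then obtain n where "R \<le> cmod ((f ^^ r n) z)"
        by (meson eventually_sequentially order_refl)
      then show False using zK filled_julia_iff[OF R, of z] by (meson not_le)
    qed
  qed
  show ?thesis
    unfolding julia_set_def using esc int bdry cl
    by (auto simp: frontier_def closure_closed)
qed

text \<open>By the maximum principle the basin of infinity has no bounded component.\<close>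

lemma connected_basin:
  assumes hol: "f holomorphic_on UNIV" and R: "escape_radius f R"
  shows "connected (- filled_julia f)"
proof (rule ccontr)
  assume nc: "\<not> connected (- filled_julia f)"
  have comp: "compact (filled_julia f)" by (rule compact_filled_julia[OF hol R])
  then have "bounded (- (- filled_julia f))" by (simp add: compact_imp_bounded)
  then obtain C where C: "C \<in> components (- filled_julia f)" "bounded C"
    using cobounded_has_bounded_component[OF _ nc] by auto
  have oC: "open C" using C(1) comp by (meson compact_imp_closed open_Compl open_components)
  have fr: "frontier C \<subseteq> filled_julia f"
    using frontier_of_components_closed_complement[OF compact_imp_closed[OF comp] C(1)]
      frontier_subset_closed[OF compact_imp_closed[OF comp]] by blast
  obtain z where z: "z \<in> C" using C(1) in_components_nonempty by blast
  have "norm ((f ^^ n) z) \<le> R" for n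
  proof (rule maximum_modulus_frontier[of "f ^^ n" C])
    show "norm ((f ^^ n) w) \<le> R" if "w \<in> frontier C" for w
      using that fr filled_julia_iff[OF R] by (force intro: less_imp_le)
  qed (use C z hol in \<open>auto intro: holomorphic_on_funpow continuous_on_funpow\<close>)
  then have "z \<in> filled_julia f" unfolding filled_julia_eq_Inter[OF R] by blast
  then show False using z C(1) in_components_subset by blast
qed

text \<open>Each part of a separation of \<open>K\<close> is compact, so it has boundary points, and these are boundary
  points of \<open>K\<close>.\<close>

lemma connected_if_connected_frontier:
  fixes K :: "'a::euclidean_space set"
  assumes "compact K" "connected (frontier K)"
  shows "connected K"
proof (rule ccontr)
  assume "\<not> connected K"
  then obtain A B where AB: "closed A" "closed B" "A \<union> B = K" "A \<inter> B = {}" "A \<noteq> {}" "B \<noteq> {}"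
    using connected_closed_set[OF compact_imp_closed[OF assms(1)]] by metis
  have *: "frontier X \<subseteq> frontier K" if "closed X" "closed Y" "X \<union> Y = K" "X \<inter> Y = {}" for X Y
  proof
    fix x assume x: "x \<in> frontier X"
    then have xX: "x \<in> X" using that(1) frontier_subset_closed by blast
    have "x \<notin> interior K"
    proof
      assume "x \<in> interior K"
      then have "x \<in> interior K \<inter> - Y" using xX that by blast
      moreover have "open (interior K \<inter> - Y)" using that(2) by auto
      moreover have "interior K \<inter> - Y \<subseteq> X" using interior_subset that(3) by blast
      ultimately have "x \<in> interior X" by (meson interiorI)
      then show False using x by (simp add: frontier_def)
    qed
    moreover have "x \<in> K" using xX that by blast
    ultimately show "x \<in> frontier K"
      using closure_subset by (auto simp: frontier_def)
  qed
  have ne: "frontier X \<noteq> {}" if "X \<noteq> {}" "X \<subseteq> K" for X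
  proof -
    have "X \<noteq> UNIV" using that assms(1) by (metis compact_imp_bounded bounded_subset not_bounded_UNIV)
    then show ?thesis using that frontier_eq_empty by blast
  qed
  have fA: "frontier A \<subseteq> frontier K" using *[of A B] AB by blast
  have fB: "frontier B \<subseteq> frontier K" using *[of B A] AB by blast
  have "frontier K \<subseteq> A \<union> B" using AB frontier_subset_closed assms(1) compact_imp_closed by metis
  moreover have "A \<inter> frontier K \<noteq> {}"
    using fA ne[of A] AB frontier_subset_closed[of A] by blast
  moreover have "B \<inter> frontier K \<noteq> {}"
    using fB ne[of B] AB frontier_subset_closed[of B] by blast
  ultimately show False
    using assms(2) AB unfolding connected_closed by blast
qed

text \<open>The boundary of the single complementary component of a connected compact plane set is
  connected.\<close>

lemma connected_julia_set_iff:
  assumes hol: "f holomorphic_on UNIV" and R: "escape_radius f R"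
  shows "connected (julia_set f) \<longleftrightarrow> connected (filled_julia f)"
proof
  assume "connected (julia_set f)"
  then show "connected (filled_julia f)"
    using connected_if_connected_frontier compact_filled_julia[OF hol R]
    by (simp add: julia_set_eq_frontier[OF hol R])
next
  assume K: "connected (filled_julia f)"
  have "- filled_julia f \<noteq> {}"
    using compact_filled_julia[OF hol R]
    by (metis compact_imp_bounded compl_bot_eq double_compl not_bounded_UNIV)
  then have "- filled_julia f \<in> components (- filled_julia f)"
    using connected_basin[OF hol R] by (simp add: in_components_self)
  then have "connected (frontier (- filled_julia f))"
    using connected_frontier_component_complement[OF K] by blast
  then show "connected (julia_set f)"
    by (simp add: julia_set_eq_frontier[OF hol R])
qed

section \<open>Roots of polynomials depending on a parameter\<close>

lemma card_roots_rsquarefree: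
  fixes p :: "complex poly"
  assumes "rsquarefree p"
  shows "card {z. poly p z = 0} = degree p"
proof -
  have "p \<noteq> 0" using assms by (simp add: rsquarefree_def)
  then have lc: "lead_coeff p \<noteq> 0" by simp
  have "degree p = degree (\<Prod>z|poly p z = 0. [:-z, 1:])"
    using lc by (subst complex_poly_decompose_rsquarefree[OF assms, symmetric]) simp
  also have "\<dots> = (\<Sum>z|poly p z = 0. 1)"
    by (subst degree_prod_sum_eq) auto
  finally show ?thesis by simp
qed

text \<open>A multiple root is still a root after one division by its linear factor.\<close>

lemma card_roots_less_degree:
  fixes p :: "complex poly"
  assumes "degree p > 0" "poly p w = 0" "poly (pderiv p) w = 0"
  shows "card {z. poly p z = 0} < degree p"
proof -
  have "p \<noteq> 0" using assms(1) by auto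
  obtain q where q: "p = [:-w, 1:] * q" using assms(2) by (auto simp: poly_eq_0_iff_dvd)
  have "poly q w = 0" using assms(3) unfolding q pderiv_mult by (simp add: pderiv_pCons)
  then have "{z. poly p z = 0} = {z. poly q z = 0}" unfolding q by auto
  moreover have "q \<noteq> 0" using q \<open>p \<noteq> 0\<close> by auto
  moreover have "degree p = Suc (degree q)"
    unfolding q using \<open>q \<noteq> 0\<close> by (subst degree_mult_eq) auto
  moreover have "card {z. poly q z = 0} \<le> degree q"
    using \<open>q \<noteq> 0\<close> by (rule card_poly_roots_bound)
  ultimately show ?thesis by simp
qed

text \<open>If all roots had distance at least \<open>e\<close> from \<open>w\<close>, the factorisation into linear factors would
  bound the value at \<open>w\<close> from below.\<close>

lemma root_near_small_value:
  fixes p :: "complex poly"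
  assumes "norm (poly p w) < norm (lead_coeff p) * e ^ degree p" "0 < e"
  obtains z where "poly p z = 0" "dist w z < e"
proof (rule ccontr)
  assume "\<not> thesis"
  with that have far: "e \<le> dist w z" if "poly p z = 0" for z using \<open>poly p z = 0\<close> by force
  obtain r where r: "smult (lead_coeff p) (\<Prod>i<degree p. [:-r i, 1:]) = p"
    using complex_poly_decompose' by blast
  have val: "poly p z = lead_coeff p * (\<Prod>i<degree p. z - r i)" for z
    by (subst r[symmetric]) (simp add: poly_prod)
  have "poly p (r i) = 0" if "i < degree p" for i
    using that unfolding val by auto
  then have "(\<Prod>i<degree p. e) \<le> (\<Prod>i<degree p. norm (w - r i))"
    using far assms(2) by (intro prod_mono) (auto simp: dist_norm)
  then have "norm (lead_coeff p) * e ^ degree p \<le> norm (poly p w)"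
    unfolding val by (simp add: norm_mult prod_norm mult_left_mono)
  then show False using assms(1) by linarith
qed

lemma root_persists:
  fixes p :: "'a::topological_space \<Rightarrow> complex poly"
  assumes deg: "\<And>x. x \<in> T \<Longrightarrow> degree (p x) = d"
    and lc: "\<And>x. x \<in> T \<Longrightarrow> lead_coeff (p x) \<noteq> 0" "continuous_on T (\<lambda>x. lead_coeff (p x))"
    and val: "\<And>z. continuous_on T (\<lambda>x. poly (p x) z)"
    and x: "x \<in> T" and w: "poly (p x) w = 0" and e: "0 < e"
  obtains N where "openin (top_of_set T) N" "x \<in> N"
    "\<And>y. y \<in> N \<Longrightarrow> \<exists>z. poly (p y) z = 0 \<and> dist w z < e"
proof
  let ?N = "T \<inter> (\<lambda>x. norm (lead_coeff (p x)) * e ^ d - norm (poly (p x) w)) -` {0<..}"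
  show "openin (top_of_set T) ?N"
    by (intro continuous_openin_preimage_gen continuous_intros lc val)
  show "x \<in> ?N" using x w e lc(1)[OF x] by simp
  show "\<exists>z. poly (p y) z = 0 \<and> dist w z < e" if y: "y \<in> ?N" for y
  proof -
    have "norm (poly (p y) w) < norm (lead_coeff (p y)) * e ^ degree (p y)"
      using y deg[of y] by simp
    then show ?thesis using root_near_small_value e by metis
  qed
qed

text \<open>Each root persists near its position, and counting shows that there are no others; so over a
  small neighbourhood the roots form disjoint sheets, one for each root at the centre.\<close>

theorem covering_space_roots:
  fixes p :: "'a::real_normed_vector \<Rightarrow> complex poly"
  assumes deg: "\<And>x. x \<in> T \<Longrightarrow> degree (p x) = d" and d: "0 < d"
    and lc: "continuous_on T (\<lambda>x. lead_coeff (p x))"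
    and val: "\<And>z. continuous_on T (\<lambda>x. poly (p x) z)"
    and sq: "\<And>x. x \<in> T \<Longrightarrow> rsquarefree (p x)"
  shows "covering_space (SIGMA x:T. {z. poly (p x) z = 0}) fst T"
proof
  let ?C = "SIGMA x:T. {z. poly (p x) z = 0}"
  have lc0: "lead_coeff (p x) \<noteq> 0" if "x \<in> T" for x
    using deg[OF that] d by auto
  have cardT: "card {z. poly (p x) z = 0} = d" if "x \<in> T" for x
    using card_roots_rsquarefree[OF sq[OF that]] deg[OF that] by simp
  have fin: "finite {z. poly (p x) z = 0}" if "x \<in> T" for x
    using poly_roots_finite lc0[OF that] by fastforce
  show "continuous_on ?C fst" by (intro continuous_intros)
  show "fst ` ?C = T"
  proof -
    have "{z. poly (p x) z = 0} \<noteq> {}" if "x \<in> T" for x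
      using cardT[OF that] d by (metis card.empty less_irrefl)
    then show ?thesis by force
  qed
  fix x assume x: "x \<in> T"
  let ?R = "{z. poly (p x) z = 0}"
  obtain e0 where e0: "0 < e0" "\<And>a b. a \<in> ?R \<Longrightarrow> b \<in> ?R \<Longrightarrow> dist a b < e0 \<Longrightarrow> a = b"
  proof -
    have "uniform_discrete ?R" using fin[OF x] uniform_discrete_finite_iff[of ?R] by blast
    then show ?thesis using that unfolding uniform_discrete_def by metis
  qed
  define e where "e = e0 / 2"
  have e: "0 < e" using e0 e_def by simp
  have disj: "a = b" if "a \<in> ?R" "b \<in> ?R" "dist a z < e" "dist b z < e" for a b z
    using e0(2)[OF that(1,2)] dist_triangle2[of a b z] that(3,4) unfolding e_def by linarith
  have "\<exists>N. openin (top_of_set T) N \<and> x \<in> N \<and> (\<forall>y\<in>N. \<exists>z. poly (p y) z = 0 \<and> dist w z < e)"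
    if "w \<in> ?R" for w
  proof -
    have w: "poly (p x) w = 0" using that by simp
    show ?thesis by (rule root_persists[where p=p and T=T, OF deg lc0 lc val x w e]) blast+
  qed
  then obtain Nb where Nb: "\<And>w. w \<in> ?R \<Longrightarrow> openin (top_of_set T) (Nb w)"
      "\<And>w. w \<in> ?R \<Longrightarrow> x \<in> Nb w"
      "\<And>w y. w \<in> ?R \<Longrightarrow> y \<in> Nb w \<Longrightarrow> \<exists>z. poly (p y) z = 0 \<and> dist w z < e"
    by metis
  define N where "N = T \<inter> \<Inter>(Nb ` ?R)"
  have oN: "openin (top_of_set T) N"
  proof -
    have "?R \<noteq> {}" using cardT[OF x] d by (metis card.empty less_irrefl)
    then have "openin (top_of_set T) (\<Inter>(Nb ` ?R))"
      using Nb(1) fin[OF x] by (intro openin_Inter) auto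
    then show ?thesis unfolding N_def by (metis inf.absorb2 openin_imp_subset)
  qed
  have xN: "x \<in> N" using x Nb(2) by (auto simp: N_def)
  have NT: "N \<subseteq> T" by (auto simp: N_def)
  have exz: "\<exists>z. poly (p y) z = 0 \<and> dist w z < e" if "w \<in> ?R" "y \<in> N" for w y
    using Nb(3)[OF that(1), of y] that by (auto simp: N_def)
  define s where "s y w = (SOME z. poly (p y) z = 0 \<and> dist w z < e)" for y w
  have s: "poly (p y) (s y w) = 0" "dist w (s y w) < e" if "w \<in> ?R" "y \<in> N" for w y
    using someI_ex[OF exz[OF that]] unfolding s_def by auto
  have inj: "inj_on (s y) ?R" if "y \<in> N" for y
    using disj s(2)[OF _ that] by (intro inj_onI) metis
  have img: "s y ` ?R = {z. poly (p y) z = 0}" if "y \<in> N" for y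
  proof (rule card_subset_eq)
    show "finite {z. poly (p y) z = 0}" using fin that NT by blast
    show "s y ` ?R \<subseteq> {z. poly (p y) z = 0}" using s(1) that by auto
    show "card (s y ` ?R) = card {z. poly (p y) z = 0}"
      using card_image[OF inj[OF that]] cardT[OF x] cardT[of y] that NT by auto
  qed
  have uniq: "z = s y w" if "y \<in> N" "w \<in> ?R" "poly (p y) z = 0" "dist w z < e" for y w z
  proof -
    have "z \<in> s y ` ?R" using img[OF that(1)] that(3) by auto
    then obtain w' where w': "w' \<in> ?R" "z = s y w'" by auto
    then show ?thesis using disj[OF that(2) w'(1), of z] s(2)[OF w'(1) that(1)] that(4) by auto
  qed
  have cont_s: "continuous_on N (\<lambda>y. s y w)" if w: "w \<in> ?R" for w
    unfolding continuous_on_eq_continuous_within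
  proof
    fix y assume y: "y \<in> N"
    show "continuous (at y within N) (\<lambda>y. s y w)"
      unfolding continuous_within tendsto_iff
    proof (intro allI impI)
      fix e' :: real assume "0 < e'"
      define e2 where "e2 = min e' (e - dist w (s y w))"
      have e2: "0 < e2" using \<open>0 < e'\<close> s(2)[OF w y] by (simp add: e2_def)
      obtain M where M: "openin (top_of_set T) M" "y \<in> M"
          "\<And>y'. y' \<in> M \<Longrightarrow> \<exists>z. poly (p y') z = 0 \<and> dist (s y w) z < e2"
      proof -
        have yT: "y \<in> T" using y NT by blast
        show ?thesis
          by (rule root_persists[where p=p and T=T, OF deg lc0 lc val yT s(1)[OF w y] e2]) (use that in blast)+
      qed
      have close: "dist (s y' w) (s y w) < e'" if y': "y' \<in> N" "y' \<in> M" for y'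
      proof -
        obtain z where z: "poly (p y') z = 0" "dist (s y w) z < e2" using M(3) y' by blast
        have "dist w z < e"
          using dist_triangle[of w z "s y w"] z(2) unfolding e2_def by linarith
        then have "z = s y' w" using uniq[OF y'(1) w z(1)] by blast
        then show ?thesis using z(2) by (simp add: e2_def dist_commute)
      qed
      obtain O' where O': "open O'" "M = T \<inter> O'" using M(1) by (auto simp: openin_open)
      show "\<forall>\<^sub>F y' in at y within N. dist (s y' w) (s y w) < e'"
        unfolding eventually_at_topological
        using O' M(2) close NT by (intro exI[of _ O']) auto
    qed
  qed
  define u where "u w = ?C \<inter> (N \<times> ball w e)" for w
  show "\<exists>T'. x \<in> T' \<and> openin (top_of_set T) T' \<and>
          (\<exists>v. \<Union> v = ?C \<inter> fst -` T' \<and> (\<forall>u\<in>v. openin (top_of_set ?C) u) \<and>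
               pairwise disjnt v \<and> (\<forall>u\<in>v. \<exists>q. homeomorphism u T' fst q))"
  proof (intro exI[of _ N] conjI exI[of _ "u ` ?R"] ballI xN oN)
    show "\<Union> (u ` ?R) = ?C \<inter> fst -` N"
    proof (intro subset_antisym subsetI)
      fix c assume "c \<in> ?C \<inter> fst -` N"
      then have c: "fst c \<in> N" "poly (p (fst c)) (snd c) = 0" "fst c \<in> T" by auto
      then obtain w where "w \<in> ?R" "snd c = s (fst c) w" using img[of "fst c"] by auto
      then show "c \<in> \<Union> (u ` ?R)"
        using c s(2)[of w "fst c"] unfolding u_def by (cases c) auto
    qed (auto simp: u_def)
    obtain O' where O': "open O'" "N = T \<inter> O'" using oN by (auto simp: openin_open)
    show "openin (top_of_set ?C) U" if U: "U \<in> u ` ?R" for U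
    proof -
      obtain w where "U = u w" using U by blast
      then have "U = ?C \<inter> (O' \<times> ball w e)" using O' by (auto simp: u_def)
      moreover have "open (O' \<times> ball w e)" using O'(1) by (intro open_Times) auto
      ultimately show ?thesis unfolding openin_open by blast
    qed
    show "pairwise disjnt (u ` ?R)"
    proof (rule pairwiseI)
      fix A B assume "A \<in> u ` ?R" "B \<in> u ` ?R" "A \<noteq> B"
      then obtain a b where ab: "a \<in> ?R" "b \<in> ?R" "A = u a" "B = u b" "a \<noteq> b" by blast
      have False if "c \<in> u a" "c \<in> u b" for c
        using disj[OF ab(1,2), of "snd c"] ab(5) that unfolding u_def by auto
      then show "disjnt A B" using ab unfolding disjnt_def by blast
    qed
    show "\<exists>q. homeomorphism U N fst q" if U: "U \<in> u ` ?R" for U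
    proof -
      obtain w where w: "w \<in> ?R" "U = u w" using U by blast
      have "homeomorphism U N fst (\<lambda>y. (y, s y w))"
        unfolding homeomorphism_def
      proof (intro conjI ballI)
        show "fst ` U = N"
        proof (intro subset_antisym subsetI)
          fix y assume y: "y \<in> N"
          then have "(y, s y w) \<in> U"
            using s[OF w(1) y] NT by (auto simp: w u_def)
          then show "y \<in> fst ` U" by force
        qed (auto simp: w u_def)
        show "continuous_on U fst" by (intro continuous_intros)
        show "continuous_on N (\<lambda>y. (y, s y w))" by (intro continuous_intros cont_s w)
        show "(\<lambda>y. (y, s y w)) ` N = U"
        proof (intro subset_antisym subsetI)
          fix c assume "c \<in> U"
          then have "fst c \<in> N" "poly (p (fst c)) (snd c) = 0" "dist w (snd c) < e"
            by (auto simp: w u_def)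
          then have "c = (fst c, s (fst c) w)" using uniq[OF _ w(1)] by (metis prod.collapse)
          then show "c \<in> (\<lambda>y. (y, s y w)) ` N" using \<open>fst c \<in> N\<close> by blast
        next
          fix c assume "c \<in> (\<lambda>y. (y, s y w)) ` N"
          then show "c \<in> U" using s[OF w(1)] NT by (auto simp: w u_def)
        qed
        show "(\<lambda>y. (y, s y w)) (fst c) = c" if "c \<in> U" for c
        proof -
          have "fst c \<in> N" "poly (p (fst c)) (snd c) = 0" "dist w (snd c) < e"
            using that by (auto simp: w u_def)
          then show ?thesis using uniq[OF _ w(1)] by (metis prod.collapse)
        qed
      qed auto
      then show ?thesis by blast
    qed
  qed
qed

lemma continuous_root_exists:
  fixes p :: "'a::real_normed_vector \<Rightarrow> complex poly"
  assumes cov: "covering_space (SIGMA x:T. {z. poly (p x) z = 0}) fst T"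
    and T: "simply_connected T" "locally path_connected T"
    and x: "x \<in> T" and z: "poly (p x) z = 0"
  obtains g where "continuous_on T g" "g x = z" "\<And>y. y \<in> T \<Longrightarrow> poly (p y) (g y) = 0"
proof -
  have "(x, z) \<in> (SIGMA x:T. {z. poly (p x) z = 0})" using x z by simp
  then obtain G where G: "continuous_on T G" "G \<in> T \<rightarrow> (SIGMA x:T. {z. poly (p x) z = 0})"
      "G x = (x, z)" "\<And>y. y \<in> T \<Longrightarrow> fst (G y) = y"
    using covering_space_lift_strong[OF cov _ x T, of "(x, z)" "\<lambda>y. y"]
    by (metis Pi_I' continuous_on_id fst_conv)
  show ?thesis
  proof
    show "continuous_on T (\<lambda>y. snd (G y))" by (intro continuous_intros G)
    show "snd (G x) = z" using G by simp
    fix y assume "y \<in> T"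
    then have "G y \<in> (SIGMA x:T. {z. poly (p x) z = 0})" "fst (G y) = y" using G by auto
    then show "poly (p y) (snd (G y)) = 0" by (cases "G y") auto
  qed
qed

lemma continuous_root_unique:
  fixes p :: "'a::real_normed_vector \<Rightarrow> complex poly"
  assumes cov: "covering_space (SIGMA x:T. {z. poly (p x) z = 0}) fst T" and T: "connected T"
    and f: "continuous_on T f" "\<And>y. y \<in> T \<Longrightarrow> poly (p y) (f y) = 0"
    and g: "continuous_on T g" "\<And>y. y \<in> T \<Longrightarrow> poly (p y) (g y) = 0"
    and x: "x \<in> T" "f x = g x" and y: "y \<in> T"
  shows "f y = g y"
proof -
  have "(y, f y) = (y, g y)"
    by (rule covering_space_lift_unique[OF cov, where a = x and T = T and f = "\<lambda>y. y"
          and ?g1.0 = "\<lambda>y. (y, f y)" and ?g2.0 = "\<lambda>y. (y, g y)"])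
      (use assms in \<open>auto intro!: continuous_intros\<close>)
  then show ?thesis by simp
qed

lemma poly_eq_sum_atMost:
  fixes p :: "'a::comm_ring_1 poly"
  assumes "degree p \<le> d"
  shows "poly p z = (\<Sum>i\<le>d. coeff p i * z ^ i)"
  unfolding poly_altdef
  by (rule sum.mono_neutral_left) (use assms coeff_eq_0 in \<open>auto simp: coeff_eq_0\<close>)

text \<open>Dividing \<open>p\<^sub>x(f(x)) - p\<^sub>x(f(c)) = - p\<^sub>x(f(c))\<close> by \<open>f(x) - f(c)\<close> gives a continuous function
  whose value at \<open>c\<close> is the derivative of \<open>p\<^sub>c\<close> at the root.\<close>

lemma holomorphic_root:
  fixes p :: "complex \<Rightarrow> complex poly"
  assumes W: "open W"
    and coef: "\<And>i. (\<lambda>x. coeff (p x) i) holomorphic_on W"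
    and deg: "\<And>x. x \<in> W \<Longrightarrow> degree (p x) \<le> d"
    and f: "continuous_on W f" "\<And>x. x \<in> W \<Longrightarrow> poly (p x) (f x) = 0"
    and simple: "\<And>x. x \<in> W \<Longrightarrow> poly (pderiv (p x)) (f x) \<noteq> 0"
  shows "f holomorphic_on W"
proof -
  have "f field_differentiable (at c)" if c: "c \<in> W" for c
  proof -
    define D where "D x = (\<Sum>i\<le>d. coeff (p x) i * (\<Sum>j<i. f c ^ (i - Suc j) * f x ^ j))" for x
    define h where "h x = - poly (p x) (f c)" for x
    have eq: "(f x - f c) * D x = h x" if "x \<in> W" for x
    proof -
      have "(f x - f c) * D x = (\<Sum>i\<le>d. coeff (p x) i * (f x ^ i - f c ^ i))"
        unfolding D_def sum_distrib_left power_diff_sumr2 by (intro sum.cong) (auto simp: mult_ac)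
      also have "\<dots> = poly (p x) (f x) - poly (p x) (f c)"
        unfolding poly_eq_sum_atMost[OF deg[OF that]] by (simp add: algebra_simps sum_subtractf)
      finally show ?thesis using f(2)[OF that] by (simp add: h_def)
    qed
    have contD: "continuous_on W D"
      unfolding D_def
      by (intro continuous_intros f holomorphic_on_imp_continuous_on coef)
    have "poly (pderiv (p c)) z = (\<Sum>i\<le>d. coeff (p c) i * (of_nat i * z ^ (i - Suc 0)))" for z
    proof -
      have "((\<lambda>z. \<Sum>i\<le>d. coeff (p c) i * z ^ i) has_field_derivative poly (pderiv (p c)) z) (at z)"
        using poly_DERIV[of "p c" z] unfolding poly_eq_sum_atMost[OF deg[OF c]] .
      moreover have "((\<lambda>z. \<Sum>i\<le>d. coeff (p c) i * z ^ i) has_field_derivative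
          (\<Sum>i\<le>d. coeff (p c) i * (of_nat i * z ^ (i - Suc 0)))) (at z)"
        by (auto intro!: derivative_eq_intros simp: mult_ac)
      ultimately show ?thesis by (rule DERIV_unique)
    qed
    moreover have "(\<Sum>j<i. f c ^ (i - Suc j) * f c ^ j) = of_nat i * f c ^ (i - Suc 0)" for i
    proof -
      have "(\<Sum>j<i. f c ^ (i - Suc j) * f c ^ j) = (\<Sum>j<i. f c ^ (i - Suc 0))"
        by (intro sum.cong) (auto simp flip: power_add)
      then show ?thesis by simp
    qed
    ultimately have Dc: "D c \<noteq> 0" using simple[OF c] unfolding D_def by simp
    have "D \<midarrow>c\<rightarrow> D c"
      using contD c W by (simp add: continuous_on_eq_continuous_at isCont_def)
    moreover have "h holomorphic_on W"
      unfolding h_def poly_altdef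
    proof -
      have "(\<lambda>x. - (\<Sum>i\<le>d. coeff (p x) i * f c ^ i)) holomorphic_on W"
        by (intro holomorphic_intros coef)
      then show "(\<lambda>x. - (\<Sum>i\<le>degree (p x). coeff (p x) i * f c ^ i)) holomorphic_on W"
        by (rule holomorphic_transform) (simp flip: poly_eq_sum_atMost[OF deg] add: poly_altdef)
    qed
    then obtain h' where "(h has_field_derivative h') (at c)"
      using W c holomorphic_on_open by blast
    then have "(\<lambda>x. (h x - h c) / (x - c)) \<midarrow>c\<rightarrow> h'"
      by (simp add: has_field_derivative_iff)
    ultimately have lim: "(\<lambda>x. (h x - h c) / (x - c) / D x) \<midarrow>c\<rightarrow> h' / D c"
      using Dc by (intro tendsto_divide)
    have "eventually (\<lambda>x. x \<in> W) (at c)" using W c eventually_at_in_open' by blast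
    moreover have "eventually (\<lambda>x. D x \<noteq> 0) (at c)"
      using \<open>D \<midarrow>c\<rightarrow> D c\<close> Dc by (rule tendsto_imp_eventually_ne)
    ultimately have "eventually (\<lambda>x. (h x - h c) / (x - c) / D x = (f x - f c) / (x - c)) (at c)"
    proof eventually_elim
      case (elim x)
      have "h c = 0" using eq[OF c] by simp
      then show ?case using elim(2) by (simp flip: eq[OF elim(1)])
    qed
    with lim have "(\<lambda>x. (f x - f c) / (x - c)) \<midarrow>c\<rightarrow> h' / D c"
      by (rule Lim_transform_eventually)
    then show ?thesis
      unfolding field_differentiable_def has_field_derivative_iff by blast
  qed
  then show ?thesis
    using W by (simp add: holomorphic_on_def field_differentiable_at_within)
qed

lemma covering_space_roots_holomorphic:
  fixes p :: "complex \<Rightarrow> complex poly"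
  assumes coef: "\<And>i. (\<lambda>x. coeff (p x) i) holomorphic_on W"
    and deg: "\<And>x. x \<in> W \<Longrightarrow> degree (p x) = d" and d: "0 < d"
    and simple: "\<And>x z. x \<in> W \<Longrightarrow> poly (p x) z = 0 \<Longrightarrow> poly (pderiv (p x)) z \<noteq> 0"
  shows "covering_space (SIGMA x:W. {z. poly (p x) z = 0}) fst W"
proof (rule covering_space_roots[OF deg d])
  have "continuous_on W (\<lambda>x. lead_coeff (p x)) \<longleftrightarrow> continuous_on W (\<lambda>x. coeff (p x) d)"
    using deg by (intro continuous_on_cong) auto
  then show "continuous_on W (\<lambda>x. lead_coeff (p x))"
    using coef holomorphic_on_imp_continuous_on by blast
  show "continuous_on W (\<lambda>x. poly (p x) z)" for z
  proof -
    have "continuous_on W (\<lambda>x. \<Sum>i\<le>d. coeff (p x) i * z ^ i)"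
      by (intro continuous_intros holomorphic_on_imp_continuous_on coef)
    moreover have "continuous_on W (\<lambda>x. \<Sum>i\<le>d. coeff (p x) i * z ^ i) \<longleftrightarrow>
        continuous_on W (\<lambda>x. poly (p x) z)"
      using deg by (intro continuous_on_cong) (auto simp: poly_altdef)
    ultimately show ?thesis by blast
  qed
  show "rsquarefree (p x)" if "x \<in> W" for x
    using simple[OF that] by (auto simp: rsquarefree_roots)
qed

text \<open>Over a simply connected domain the covering formed by the roots has a section through every
  root.\<close>

theorem holomorphic_root_exists:
  fixes p :: "complex \<Rightarrow> complex poly"
  assumes W: "open W" "simply_connected W"
    and coef: "\<And>i. (\<lambda>x. coeff (p x) i) holomorphic_on W"
    and deg: "\<And>x. x \<in> W \<Longrightarrow> degree (p x) = d" and d: "0 < d"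
    and simple: "\<And>x z. x \<in> W \<Longrightarrow> poly (p x) z = 0 \<Longrightarrow> poly (pderiv (p x)) z \<noteq> 0"
    and x: "x \<in> W" and z: "poly (p x) z = 0"
  obtains f where "f holomorphic_on W" "f x = z" "\<And>y. y \<in> W \<Longrightarrow> poly (p y) (f y) = 0"
proof -
  obtain f where f: "continuous_on W f" "f x = z" "\<And>y. y \<in> W \<Longrightarrow> poly (p y) (f y) = 0"
    by (rule continuous_root_exists[OF covering_space_roots_holomorphic[OF coef deg d simple]
          W(2) open_imp_locally_path_connected[OF W(1)] x z]) blast+
  have "f holomorphic_on W"
    by (rule holomorphic_root[OF W(1) coef _ f(1) f(3) simple[OF _ f(3)], of d]) (use deg in auto)
  then show ?thesis using f that by blast
qed

section \<open>Extending holomorphic motions to the closure\<close>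

text \<open>A limit of zero-free functions is zero-free or identically zero (Hurwitz), so by compactness
  (Montel) a bounded zero-free function that is small at the centre is small on a smaller disc.\<close>

lemma nonvanishing_small_at_centre:
  fixes c0 :: complex
  assumes \<rho>: "0 < \<rho>'" "\<rho>' < \<rho>" and \<epsilon>: "0 < \<epsilon>"
  obtains \<delta> where "0 < \<delta>"
    "\<And>h c. \<lbrakk>h holomorphic_on ball c0 \<rho>; \<And>x. x \<in> ball c0 \<rho> \<Longrightarrow> h x \<noteq> 0;
      \<And>x. x \<in> ball c0 \<rho> \<Longrightarrow> norm (h x) \<le> M; norm (h c0) < \<delta>; c \<in> cball c0 \<rho>'\<rbrakk> \<Longrightarrow> norm (h c) < \<epsilon>"
proof (rule ccontr)
  let ?H = "{h. h holomorphic_on ball c0 \<rho> \<and> (\<forall>x\<in>ball c0 \<rho>. h x \<noteq> 0 \<and> norm (h x) \<le> M)}"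
  assume no: "\<not> thesis"
  have "\<exists>h c. h \<in> ?H \<and> norm (h c0) < 1 / real (Suc n) \<and> c \<in> cball c0 \<rho>' \<and> \<epsilon> \<le> norm (h c)" for n
  proof (rule ccontr)
    assume *: "\<not> (\<exists>h c. h \<in> ?H \<and> norm (h c0) < 1 / real (Suc n) \<and> c \<in> cball c0 \<rho>' \<and> \<epsilon> \<le> norm (h c))"
    have thesis
    proof (rule that[of "1 / real (Suc n)"])
      fix h c
      assume h: "h holomorphic_on ball c0 \<rho>" "\<And>x. x \<in> ball c0 \<rho> \<Longrightarrow> h x \<noteq> 0"
        "\<And>x. x \<in> ball c0 \<rho> \<Longrightarrow> norm (h x) \<le> M" "norm (h c0) < 1 / real (Suc n)" "c \<in> cball c0 \<rho>'"
      then have "h \<in> ?H" by blast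
      then have "\<not> \<epsilon> \<le> norm (h c)" using * h(4,5) by blast
      then show "norm (h c) < \<epsilon>" by simp
    qed simp
    then show False using no by blast
  qed
  then have "\<forall>n. \<exists>h. \<exists>c. h \<in> ?H \<and> norm (h c0) < 1 / real (Suc n) \<and> c \<in> cball c0 \<rho>' \<and> \<epsilon> \<le> norm (h c)"
    by (rule allI)
  from choice[OF this] obtain h where "\<forall>n. \<exists>c. h n \<in> ?H \<and> norm (h n c0) < 1 / real (Suc n)
      \<and> c \<in> cball c0 \<rho>' \<and> \<epsilon> \<le> norm (h n c)"
    by (rule exE)
  from choice[OF this] obtain c where "\<forall>n. h n \<in> ?H \<and> norm (h n c0) < 1 / real (Suc n)
      \<and> c n \<in> cball c0 \<rho>' \<and> \<epsilon> \<le> norm (h n (c n))"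
    by (rule exE)
  note hc = spec[OF this]
  have h: "h n \<in> ?H" "norm (h n c0) < 1 / real (Suc n)"
      "c n \<in> cball c0 \<rho>'" "\<epsilon> \<le> norm (h n (c n))" for n
    by (rule conjunct1[OF hc], rule conjunct1[OF conjunct2[OF hc]],
        rule conjunct1[OF conjunct2[OF conjunct2[OF hc]]],
        rule conjunct2[OF conjunct2[OF conjunct2[OF hc]]])
  have bd: "\<exists>B. \<forall>h\<in>?H. \<forall>z\<in>K. norm (h z) \<le> B" if "K \<subseteq> ball c0 \<rho>" for K
    using that by (intro exI[of _ M]) blast
  have rng: "range h \<subseteq> ?H" using h(1) by blast
  obtain g r where g: "g holomorphic_on ball c0 \<rho>" and r: "strict_mono (r :: nat \<Rightarrow> nat)"
    and lim: "\<And>x. x \<in> ball c0 \<rho> \<Longrightarrow> (\<lambda>n. h (r n) x) \<longlonglongrightarrow> g x"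
    and ul: "\<And>K. \<lbrakk>compact K; K \<subseteq> ball c0 \<rho>\<rbrakk> \<Longrightarrow> uniform_limit K (h \<circ> r) g sequentially"
    using Montel[of "ball c0 \<rho>" ?H h, OF open_ball _ bd rng] by blast
  have c0: "c0 \<in> ball c0 \<rho>" using \<rho> by simp
  have "g c0 = 0"
  proof (rule LIMSEQ_unique[OF lim[OF c0]])
    have "(\<lambda>n. h n c0) \<longlonglongrightarrow> 0"
    proof (rule Lim_null_comparison[OF _ LIMSEQ_inverse_real_of_nat])
      show "\<forall>\<^sub>F n in sequentially. norm (h n c0) \<le> inverse (real (Suc n))"
        using h(2) by (intro always_eventually) (auto simp: inverse_eq_divide intro: less_imp_le)
    qed
    then show "(\<lambda>n. h (r n) c0) \<longlonglongrightarrow> 0"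
      using r LIMSEQ_subseq_LIMSEQ[of "\<lambda>n. h n c0" 0 r] by (simp add: o_def)
  qed
  moreover have "g c0 \<noteq> 0" if "\<not> g constant_on ball c0 \<rho>"
  proof (rule Hurwitz_no_zeros[OF open_ball connected_ball _ g _ that _ c0, of "h \<circ> r"])
    show "uniform_limit K (h \<circ> r) g sequentially" if "compact K" "K \<subseteq> ball c0 \<rho>" for K
      using ul that .
  qed (use h(1) in auto)
  ultimately have "g constant_on ball c0 \<rho>" by blast
  then have g0: "g x = 0" if "x \<in> ball c0 \<rho>" for x
    using that \<open>g c0 = 0\<close> c0 unfolding constant_on_def by metis
  have sub: "cball c0 \<rho>' \<subseteq> ball c0 \<rho>" using \<rho> by auto
  then have "uniform_limit (cball c0 \<rho>') (h \<circ> r) g sequentially" by (intro ul) auto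
  then have "\<forall>\<^sub>F n in sequentially. \<forall>x\<in>cball c0 \<rho>'. dist ((h \<circ> r) n x) (g x) < \<epsilon>"
    using \<epsilon> by (simp add: uniform_limit_iff)
  then obtain n where "\<forall>x\<in>cball c0 \<rho>'. dist ((h \<circ> r) n x) (g x) < \<epsilon>"
    using eventually_happens'[OF sequentially_bot] by blast
  then have "dist (h (r n) (c (r n))) (g (c (r n))) < \<epsilon>" using h(3) by simp
  moreover have "g (c (r n)) = 0" using g0 h(3) sub by blast
  ultimately show False using h(4)[of "r n"] by (simp add: dist_norm)
qed

text \<open>Two moving points never collide, so their difference is a zero-free function of the parameter;
  this makes a bounded motion equicontinuous in the moving point.\<close>

theorem holomorphic_motion_extension:
  assumes \<rho>: "0 < \<rho>'" "\<rho>' < \<rho>"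
    and mot: "holomorphic_motion (ball c0 \<rho>) c0 E \<phi>"
    and bd: "\<And>c z. c \<in> ball c0 \<rho> \<Longrightarrow> z \<in> E \<Longrightarrow> norm (\<phi> c z) \<le> M"
  obtains \<Phi> where "\<And>c z. c \<in> ball c0 \<rho>' \<Longrightarrow> z \<in> E \<Longrightarrow> \<Phi> c z = \<phi> c z"
    "holomorphic_motion (ball c0 \<rho>') c0 (closure E) \<Phi>"
    "\<And>c. c \<in> ball c0 \<rho>' \<Longrightarrow> continuous_on (closure E) (\<Phi> c)"
proof -
  have c0: "c0 \<in> ball c0 \<rho>" "c0 \<in> ball c0 \<rho>'" using \<rho> by auto
  have sub: "ball c0 \<rho>' \<subseteq> ball c0 \<rho>" using \<rho> by auto
  have id: "\<phi> c0 z = z" if "z \<in> E" for z using mot that by (simp add: holomorphic_motion_def)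
  have inj: "inj_on (\<phi> c) E" if "c \<in> ball c0 \<rho>" for c
    using mot that by (simp add: holomorphic_motion_def)
  have hol: "(\<lambda>c. \<phi> c z) holomorphic_on ball c0 \<rho>" if "z \<in> E" for z
    using mot that by (simp add: holomorphic_motion_def)
  have modulus: "\<exists>\<delta>>0. \<forall>z\<in>E. \<forall>w\<in>E. \<forall>c\<in>ball c0 \<rho>'. dist z w < \<delta> \<longrightarrow> dist (\<phi> c z) (\<phi> c w) < \<epsilon>"
    if \<epsilon>: "\<epsilon> > 0" for \<epsilon>
  proof -
    obtain \<delta> where \<delta>: "0 < \<delta>"
      "\<And>h c. \<lbrakk>h holomorphic_on ball c0 \<rho>; \<And>x. x \<in> ball c0 \<rho> \<Longrightarrow> h x \<noteq> 0;
      \<And>x. x \<in> ball c0 \<rho> \<Longrightarrow> norm (h x) \<le> 2 * M; norm (h c0) < \<delta>; c \<in> cball c0 \<rho>'\<rbrakk> \<Longrightarrow> norm (h c) < \<epsilon>"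
      using nonvanishing_small_at_centre[OF \<rho> \<epsilon>, of c0 "2 * M"] by blast
    have "dist (\<phi> c z) (\<phi> c w) < \<epsilon>"
      if zw: "z \<in> E" "w \<in> E" and c: "c \<in> ball c0 \<rho>'" and d: "dist z w < \<delta>" for z w c
    proof (cases "z = w")
      case False
      have "norm (\<phi> c z - \<phi> c w) < \<epsilon>"
      proof (rule \<delta>(2)[of "\<lambda>c. \<phi> c z - \<phi> c w"])
        show "(\<lambda>c. \<phi> c z - \<phi> c w) holomorphic_on ball c0 \<rho>"
          by (intro holomorphic_intros hol zw)
        show "\<phi> x z - \<phi> x w \<noteq> 0" if "x \<in> ball c0 \<rho>" for x
          using inj_onD[OF inj[OF that] _ zw] False by auto
        show "norm (\<phi> x z - \<phi> x w) \<le> 2 * M" if "x \<in> ball c0 \<rho>" for x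
          using bd[OF that zw(1)] bd[OF that zw(2)] norm_triangle_ineq4[of "\<phi> x z" "\<phi> x w"] by linarith
        show "norm (\<phi> c0 z - \<phi> c0 w) < \<delta>" using d zw by (simp add: id dist_norm)
        show "c \<in> cball c0 \<rho>'" using c by auto
      qed
      then show ?thesis by (simp add: dist_norm)
    qed (use \<epsilon> in simp)
    then show ?thesis using \<delta>(1) by blast
  qed
  have "\<exists>g. uniformly_continuous_on (closure E) g \<and> (\<forall>z\<in>E. \<phi> c z = g z)" if c: "c \<in> ball c0 \<rho>'" for c
  proof -
    have "uniformly_continuous_on E (\<phi> c)"
      unfolding uniformly_continuous_on_def
    proof (intro allI impI)
      fix \<epsilon> :: real assume "\<epsilon> > 0"
      then obtain \<delta> where "\<delta> > 0" "\<forall>z\<in>E. \<forall>w\<in>E. \<forall>c\<in>ball c0 \<rho>'. dist z w < \<delta> \<longrightarrow> dist (\<phi> c z) (\<phi> c w) < \<epsilon>"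
        using modulus by blast
      then show "\<exists>d>0. \<forall>x\<in>E. \<forall>x'\<in>E. dist x' x < d \<longrightarrow> dist (\<phi> c x') (\<phi> c x) < \<epsilon>"
        using c by blast
    qed
    then show ?thesis using uniformly_continuous_on_extension_on_closure by metis
  qed
  then obtain \<Phi> where \<Phi>: "\<And>c. c \<in> ball c0 \<rho>' \<Longrightarrow> uniformly_continuous_on (closure E) (\<Phi> c)"
    "\<And>c z. c \<in> ball c0 \<rho>' \<Longrightarrow> z \<in> E \<Longrightarrow> \<phi> c z = \<Phi> c z"
    by metis
  have cont: "continuous_on (closure E) (\<Phi> c)" if "c \<in> ball c0 \<rho>'" for c
    using \<Phi>(1)[OF that] uniformly_continuous_imp_continuous by blast
  have ptlim: "(\<lambda>n. \<phi> c (x n)) \<longlonglongrightarrow> \<Phi> c z"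
    if "c \<in> ball c0 \<rho>'" "z \<in> closure E" "\<And>n. x n \<in> E" "x \<longlonglongrightarrow> z" for c z x
  proof -
    have "(\<lambda>n. \<Phi> c (x n)) \<longlonglongrightarrow> \<Phi> c z"
    proof (rule continuous_on_tendsto_compose[OF cont[OF that(1)] that(4,2)])
      show "\<forall>\<^sub>F n in sequentially. x n \<in> closure E"
        using that(3) closure_subset by (intro always_eventually) blast
    qed
    then show ?thesis using \<Phi>(2)[OF that(1) that(3)] by simp
  qed
  have ulim: "uniform_limit (ball c0 \<rho>') (\<lambda>n c. \<phi> c (x n)) (\<lambda>c. \<Phi> c z) sequentially"
    if z: "z \<in> closure E" and x: "\<And>n. x n \<in> E" "x \<longlonglongrightarrow> z" for z x
    unfolding uniform_limit_iff
  proof (intro allI impI)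
    fix \<epsilon> :: real assume \<epsilon>: "\<epsilon> > 0"
    then obtain \<delta> where \<delta>: "\<delta> > 0"
      "\<forall>z\<in>E. \<forall>w\<in>E. \<forall>c\<in>ball c0 \<rho>'. dist z w < \<delta> \<longrightarrow> dist (\<phi> c z) (\<phi> c w) < \<epsilon> / 2"
      using modulus[of "\<epsilon> / 2"] by auto
    obtain N where N: "\<And>m n. m \<ge> N \<Longrightarrow> n \<ge> N \<Longrightarrow> dist (x m) (x n) < \<delta>"
      using LIMSEQ_imp_Cauchy[OF x(2)] \<delta>(1) unfolding Cauchy_def by metis
    have "dist (\<phi> c (x n)) (\<Phi> c z) < \<epsilon>" if n: "n \<ge> N" and c: "c \<in> ball c0 \<rho>'" for n c
    proof -
      have "dist (\<phi> c (x n)) (\<Phi> c z) \<le> \<epsilon> / 2"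
      proof (rule Lim_dist_ubound[OF sequentially_bot ptlim[OF c z x]])
        show "\<forall>\<^sub>F m in sequentially. dist (\<phi> c (x n)) (\<phi> c (x m)) \<le> \<epsilon> / 2"
          unfolding eventually_sequentially
        proof (intro exI[of _ N] allI impI)
          fix m assume "m \<ge> N"
          then have "dist (x n) (x m) < \<delta>" using N n by blast
          then show "dist (\<phi> c (x n)) (\<phi> c (x m)) \<le> \<epsilon> / 2"
            using \<delta>(2) x(1) c by (blast intro: less_imp_le)
        qed
      qed
      then show ?thesis using \<epsilon> by linarith
    qed
    then show "\<forall>\<^sub>F n in sequentially. \<forall>c\<in>ball c0 \<rho>'. dist (\<phi> c (x n)) (\<Phi> c z) < \<epsilon>"
      unfolding eventually_sequentially by blast
  qed
  have hol\<Phi>: "(\<lambda>c. \<Phi> c z) holomorphic_on ball c0 \<rho>'" if z: "z \<in> closure E" for z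
  proof -
    obtain x where x: "\<And>n. x n \<in> E" "x \<longlonglongrightarrow> z" using z unfolding closure_sequential by blast
    show ?thesis
    proof (rule holomorphic_uniform_sequence[of _ "\<lambda>n c. \<phi> c (x n)"])
      show "(\<lambda>c. \<phi> c (x n)) holomorphic_on ball c0 \<rho>'" for n
        using hol[OF x(1)] sub holomorphic_on_subset by blast
      show "\<exists>d>0. cball c d \<subseteq> ball c0 \<rho>' \<and> uniform_limit (cball c d) (\<lambda>n c. \<phi> c (x n)) (\<lambda>c. \<Phi> c z) sequentially"
        if cin: "c \<in> ball c0 \<rho>'" for c
      proof -
        obtain d where d: "d > 0" "cball c d \<subseteq> ball c0 \<rho>'"
          using open_contains_cball[THEN iffD1, OF open_ball, rule_format, OF cin] by blast
        then show ?thesis using uniform_limit_on_subset[OF ulim[OF z x] d(2)] by blast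
      qed
    qed simp
  qed
  have id\<Phi>: "\<Phi> c0 z = z" if z: "z \<in> closure E" for z
  proof -
    obtain x where x: "\<And>n. x n \<in> E" "x \<longlonglongrightarrow> z" using z unfolding closure_sequential by blast
    have "(\<lambda>n. \<phi> c0 (x n)) = x" using id x(1) by auto
    then show ?thesis using ptlim[OF c0(2) z x] x(2) LIMSEQ_unique by metis
  qed
  have inj\<Phi>: "inj_on (\<Phi> c) (closure E)" if c: "c \<in> ball c0 \<rho>'" for c
  proof (rule inj_onI, rule ccontr)
    fix z w assume z: "z \<in> closure E" and w: "w \<in> closure E" and eq: "\<Phi> c z = \<Phi> c w" and ne: "z \<noteq> w"
    obtain x where x: "\<And>n. x n \<in> E" "x \<longlonglongrightarrow> z" using z unfolding closure_sequential by blast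
    obtain y where y: "\<And>n. y n \<in> E" "y \<longlonglongrightarrow> w" using w unfolding closure_sequential by blast
    have "(\<lambda>n. x n - y n) \<longlonglongrightarrow> z - w" by (intro tendsto_intros x y)
    then have "\<forall>\<^sub>F n in sequentially. x n - y n \<noteq> 0"
      using ne by (intro tendsto_imp_eventually_ne) auto
    then obtain N where N: "\<And>n. n \<ge> N \<Longrightarrow> x n \<noteq> y n"
      unfolding eventually_sequentially by auto
    define x' y' where "x' n = x (n + N)" and "y' n = y (n + N)" for n
    have x': "\<And>n. x' n \<in> E" "x' \<longlonglongrightarrow> z" unfolding x'_def using x LIMSEQ_ignore_initial_segment by auto
    have y': "\<And>n. y' n \<in> E" "y' \<longlonglongrightarrow> w" unfolding y'_def using y LIMSEQ_ignore_initial_segment by auto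
    have "\<Phi> c z - \<Phi> c w \<noteq> 0" if nc: "\<not> (\<lambda>c. \<Phi> c z - \<Phi> c w) constant_on ball c0 \<rho>'"
    proof (rule Hurwitz_no_zeros[OF open_ball connected_ball _ _ _ nc _ c,
          of "\<lambda>n c. \<phi> c (x' n) - \<phi> c (y' n)"])
      show "(\<lambda>c. \<phi> c (x' n) - \<phi> c (y' n)) holomorphic_on ball c0 \<rho>'" for n
        by (intro holomorphic_intros holomorphic_on_subset[OF hol sub] x' y')
      show "(\<lambda>c. \<Phi> c z - \<Phi> c w) holomorphic_on ball c0 \<rho>'"
        by (intro holomorphic_intros hol\<Phi> z w)
      show "uniform_limit K (\<lambda>n c. \<phi> c (x' n) - \<phi> c (y' n)) (\<lambda>c. \<Phi> c z - \<Phi> c w) sequentially"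
        if "K \<subseteq> ball c0 \<rho>'" for K
        using uniform_limit_on_subset[OF uniform_limit_minus[OF ulim[OF z x'] ulim[OF w y']] that] .
      show "\<phi> c (x' n) - \<phi> c (y' n) \<noteq> 0" if "c \<in> ball c0 \<rho>'" for n c
      proof -
        have "x' n \<noteq> y' n" using N[of "n + N"] by (simp add: x'_def y'_def)
        moreover have "c \<in> ball c0 \<rho>" using that sub by blast
        ultimately show ?thesis using inj_onD[OF inj _ x'(1) y'(1)] by auto
      qed
    qed
    then have "(\<lambda>c. \<Phi> c z - \<Phi> c w) constant_on ball c0 \<rho>'" using eq by auto
    then have "\<Phi> c0 z - \<Phi> c0 w = \<Phi> c z - \<Phi> c w"
      using c c0(2) unfolding constant_on_def by metis
    then show False using eq ne id\<Phi>[OF z] id\<Phi>[OF w] by simp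
  qed
  show ?thesis
  proof (rule that)
    show "\<Phi> c z = \<phi> c z" if "c \<in> ball c0 \<rho>'" "z \<in> E" for c z
      using \<Phi>(2)[OF that] by (rule sym)
    show "holomorphic_motion (ball c0 \<rho>') c0 (closure E) \<Phi>"
      unfolding holomorphic_motion_def using hol\<Phi> id\<Phi> inj\<Phi> by blast
  qed (rule cont)
qed

section \<open>Iterates of polynomials\<close>

primrec iter_poly :: "complex poly \<Rightarrow> nat \<Rightarrow> complex poly" where
  "iter_poly p 0 = [:0, 1:]"
| "iter_poly p (Suc n) = p \<circ>\<^sub>p iter_poly p n"

lemma poly_iter_poly: "poly (iter_poly p n) z = (poly p ^^ n) z"
  by (induction n) (simp_all add: poly_pcompose)

lemma degree_iter_poly: "degree (iter_poly p n) = degree p ^ n"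
  by (induction n) (simp_all add: degree_pcompose)

lemma critical_point_iter_poly:
  "poly (pderiv (iter_poly p n)) z = 0 \<longleftrightarrow> (\<exists>j<n. poly (pderiv p) ((poly p ^^ j) z) = 0)"
proof (induction n)
  case (Suc n)
  have "poly (pderiv (iter_poly p (Suc n))) z =
      poly (pderiv p) ((poly p ^^ n) z) * poly (pderiv (iter_poly p n)) z"
    by (simp add: pderiv_pcompose poly_pcompose poly_iter_poly)
  then show ?case using Suc by (auto simp: less_Suc_eq)
qed (simp add: pderiv_pCons)

lemma holomorphic_on_poly: "poly p holomorphic_on S"
  by (intro holomorphic_intros)

text \<open>Beyond this radius the leading term dominates all the others.\<close>

lemma escape_radius_poly:
  fixes p :: "complex poly"
  assumes "2 \<le> degree p"
  shows "escape_radius (poly p)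
    (1 + (2 + (\<Sum>i<degree p. norm (coeff p i))) / norm (lead_coeff p))"
proof -
  define d where "d = degree p"
  define S where "S = (\<Sum>i<d. norm (coeff p i))"
  define L where "L = norm (lead_coeff p)"
  have S: "0 \<le> S" unfolding S_def by (intro sum_nonneg) simp
  have L: "0 < L" using assms by (auto simp: L_def)
  have "2 * norm z \<le> norm (poly p z)" if z: "1 + (2 + S) / L \<le> norm z" for z
  proof -
    have z1: "1 \<le> norm z" using z S L by (smt (verit) divide_nonneg_nonneg)
    have "(2 + S) / L \<le> norm z" using z by linarith
    then have zS: "2 + S \<le> L * norm z" using L by (simp add: field_simps)
    have dd: "d = Suc (d - 1)" "1 \<le> d - 1" using assms by (auto simp: d_def)
    have "norm (\<Sum>i<d. coeff p i * z ^ i) \<le> (\<Sum>i<d. norm (coeff p i) * norm z ^ (d - 1))"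
    proof (rule sum_norm_le)
      fix i assume "i \<in> {..<d}"
      then have "norm z ^ i \<le> norm z ^ (d - 1)" using z1 by (intro power_increasing) auto
      then show "norm (coeff p i * z ^ i) \<le> norm (coeff p i) * norm z ^ (d - 1)"
        by (simp add: norm_mult norm_power mult_left_mono)
    qed
    then have low: "norm (\<Sum>i<d. coeff p i * z ^ i) \<le> S * norm z ^ (d - 1)"
      by (simp add: S_def sum_distrib_right)
    have "poly p z = (\<Sum>i<d. coeff p i * z ^ i) + lead_coeff p * z ^ d"
      unfolding poly_altdef d_def[symmetric] by (simp flip: lessThan_Suc_atMost add: d_def)
    then have "norm (lead_coeff p * z ^ d) \<le> norm (poly p z) + norm (\<Sum>i<d. coeff p i * z ^ i)"
      by (metis add_diff_cancel_left' norm_triangle_ineq4 add.commute norm_minus_commute)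
    moreover have "norm (lead_coeff p * z ^ d) = L * norm z * norm z ^ (d - 1)"
      using arg_cong[OF dd(1), of "\<lambda>k. norm z ^ k"] by (simp add: norm_mult norm_power L_def)
    ultimately have "(L * norm z - S) * norm z ^ (d - 1) \<le> norm (poly p z)"
      using low by (simp add: algebra_simps)
    moreover have "2 * norm z \<le> (L * norm z - S) * norm z ^ (d - 1)"
    proof (rule mult_mono)
      show "norm z \<le> norm z ^ (d - 1)" using power_increasing[OF dd(2) z1] by simp
    qed (use zS in auto)
    ultimately show ?thesis by linarith
  qed
  moreover have "0 < 1 + (2 + S) / L" using S L by (simp add: add_pos_nonneg)
  ultimately show ?thesis
    unfolding escape_radius_def S_def L_def d_def by blast
qed

lemma compact_poly_sublevel:
  fixes p :: "complex poly"
  assumes "0 < degree p"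
  shows "compact {z. norm (poly p z) \<le> B}"
proof -
  have "eventually (\<lambda>z. B < norm (poly p z)) at_infinity"
    using filterlim_poly_at_infinity[OF assms] unfolding filterlim_at_infinity_conv_norm_at_top
      filterlim_at_top_dense by blast
  then obtain b where b: "\<And>z. b \<le> norm z \<Longrightarrow> B < norm (poly p z)"
    unfolding eventually_at_infinity by blast
  have "{z. norm (poly p z) \<le> B} \<subseteq> ball 0 b"
  proof
    fix z assume "z \<in> {z. norm (poly p z) \<le> B}"
    then show "z \<in> ball 0 b" using b[of z] by (cases "b \<le> norm z") auto
  qed
  moreover have "closed {z. norm (poly p z) \<le> B}"
    by (intro closed_Collect_le continuous_intros)
  ultimately show ?thesis
    by (meson bounded_ball bounded_subset compact_eq_bounded_closed)
qed

section \<open>Critical points and connectedness of the filled Julia set\<close>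

text \<open>Over \<open>\<bar>w\<bar> > R\<close> the polynomial is a covering, so the radial contraction of this region towards
  the circle of radius \<open>R'\<close> lifts to a retraction of the plane onto the sublevel set.\<close>

lemma connected_poly_sublevel:
  fixes q :: "complex poly"
  assumes deg: "0 < degree q" and R: "0 \<le> R" "R < R'"
    and crit: "\<And>w. poly (pderiv q) w = 0 \<Longrightarrow> norm (poly q w) \<le> R"
  shows "connected {z. norm (poly q z) \<le> R'}"
proof -
  define T where "T = {w::complex. R < norm w}"
  define p where "p w = q - [:w:]" for w
  define C where "C = (SIGMA w:T. {z. poly (p w) z = 0})"
  define U where "U = {z. R < norm (poly q z)}"
  have poly_p: "poly (p w) z = poly q z - w" for w z by (simp add: p_def)
  have degp: "degree (p w) = degree q" for w
  proof (rule antisym)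
    show "degree (p w) \<le> degree q" unfolding p_def by (intro degree_diff_le) auto
    have "coeff (p w) (degree q) = lead_coeff q"
      unfolding p_def using deg by (simp add: coeff_pCons split: nat.splits)
    then show "degree q \<le> degree (p w)" using deg by (intro le_degree) auto
  qed
  have lcp: "lead_coeff (p w) = lead_coeff q" for w
    unfolding degp using deg by (simp add: p_def coeff_pCons split: nat.splits)
  have cov: "covering_space C fst T"
    unfolding C_def
  proof (rule covering_space_roots[where d = "degree q"])
    show "continuous_on T (\<lambda>w. lead_coeff (p w))" unfolding lcp by (intro continuous_intros)
    show "continuous_on T (\<lambda>w. poly (p w) z)" for z unfolding poly_p by (intro continuous_intros)
    show "rsquarefree (p w)" if w: "w \<in> T" for w
      unfolding rsquarefree_roots
    proof (intro allI notI)
      fix a assume a: "poly (p w) a = 0 \<and> poly (pderiv (p w)) a = 0"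
      then have "poly (pderiv q) a = 0" unfolding p_def by (simp add: pderiv_diff pderiv_pCons)
      then show False using crit[of a] a w by (simp add: poly_p T_def)
    qed
  qed (simp_all add: degp lcp deg)
  \<comment> \<open>The factor by which \<open>q(z)\<close> has shrunk at time \<open>t\<close>; at time \<open>1\<close> the scaled value
     has modulus at most \<open>R'\<close>.\<close>
  define s where "s t z = 1 - t + t * min 1 (R' / norm (poly q z))" for t z
  have ge: "min (norm (poly q z)) R' \<le> s t z * norm (poly q z)"
    if "z \<in> U" "t \<in> {0..1}" for t z
  proof -
    have q: "0 < norm (poly q z)" using that R unfolding U_def mem_Collect_eq by linarith
    have "s t z * norm (poly q z) = (1 - t) * norm (poly q z) + t * min (norm (poly q z)) R'"
      using q by (simp add: s_def min_def field_simps)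
    moreover have "(1 - t) * min (norm (poly q z)) R' \<le> (1 - t) * norm (poly q z)"
      using that by (intro mult_left_mono) auto
    ultimately show ?thesis by (simp add: algebra_simps)
  qed
  define h where "h = (\<lambda>(t::real, z). of_real (s t z) * poly q z)"
  have s0: "0 \<le> s t z" if "t \<in> {0..1}" for t z
    using that R unfolding s_def by (auto intro!: add_nonneg_nonneg)
  have conth: "continuous_on ({0..1} \<times> U) h"
    unfolding h_def s_def case_prod_beta by (intro continuous_intros) (use R in \<open>auto simp: U_def\<close>)
  have him: "h \<in> {0..1} \<times> U \<rightarrow> T"
  proof
    fix x :: "real \<times> complex" assume x: "x \<in> {0..1} \<times> U"
    then obtain t z where tz: "x = (t, z)" "t \<in> {0..1}" "z \<in> U" by auto
    have "norm (h x) = s t z * norm (poly q z)"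
      using s0[OF tz(2)] by (simp add: tz h_def norm_mult)
    then show "h x \<in> T" using ge[OF tz(3,2)] tz(3) R by (simp add: T_def U_def)
  qed
  have heq: "h (0, z) = fst (poly q z, z)" for z by (simp add: h_def s_def)
  have fim: "(\<lambda>z. (poly q z, z)) \<in> U \<rightarrow> C" by (auto simp: C_def T_def U_def poly_p)
  obtain k where k: "continuous_on ({0..1} \<times> U) k" "k \<in> {0..1} \<times> U \<rightarrow> C"
      "\<And>y. y \<in> U \<Longrightarrow> k (0, y) = (poly q y, y)"
      "\<And>z. z \<in> {0..1} \<times> U \<Longrightarrow> h z = fst (k z)"
    by (rule covering_space_lift_homotopy[OF cov conth him heq _ fim])
      (auto intro!: continuous_intros)
  \<comment> \<open>Points on the level \<open>R'\<close> are not moved, as constant paths lift to constant paths; so the lifted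
     contraction fits together with the identity on the sublevel set.\<close>
  have ends: "k (1, z) = (poly q z, z)" if z: "norm (poly q z) = R'" for z
  proof -
    have zU: "z \<in> U" using z R by (simp add: U_def)
    have st: "s t z = 1" for t using z R by (simp add: s_def)
    show ?thesis
    proof (rule covering_space_lift_unique[OF cov, where a = 0 and T = "{0..1}" and x = 1
          and f = "\<lambda>t. h (t, z)" and ?g1.0 = "\<lambda>t. k (t, z)" and ?g2.0 = "\<lambda>t. (poly q z, z)"])
      show "continuous_on {0..1} (\<lambda>t. h (t, z))" "continuous_on {0..1} (\<lambda>t. k (t, z))"
        by (intro continuous_on_compose2[OF conth] continuous_on_compose2[OF k(1)] continuous_intros;
            use zU in auto)+
      show "(\<lambda>t. h (t, z)) \<in> {0..1} \<rightarrow> T" "(\<lambda>t. k (t, z)) \<in> {0..1} \<rightarrow> C"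
        using him k(2) zU by blast+
      show "(\<lambda>t. (poly q z, z)) \<in> {0..1} \<rightarrow> C" using fim zU by blast
      show "h (t, z) = fst (k (t, z))" if "t \<in> {0..1}" for t using k(4) that zU by blast
      show "h (t, z) = fst (poly q z, z)" for t by (simp add: h_def st)
    qed (use k(3)[OF zU] in auto)
  qed
  define r where "r z = (if norm (poly q z) \<le> R' then z else snd (k (1, z)))" for z
  have qk: "norm (poly q (snd (k (1, z)))) \<le> R'" if z: "R' \<le> norm (poly q z)" for z
  proof -
    have zU: "z \<in> U" using z R by (simp add: U_def)
    have "k (1, z) \<in> C" "fst (k (1, z)) = h (1, z)" using k(2) k(4)[of "(1, z)"] zU by auto
    then have "poly q (snd (k (1, z))) = h (1, z)" by (cases "k (1, z)") (auto simp: C_def poly_p)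
    moreover have "norm (h (1, z)) = R'"
    proof -
      have pos: "0 < norm (poly q z)" using z R by linarith
      then have "R' / norm (poly q z) \<le> 1" using z by (simp add: divide_le_eq_1)
      then have "s 1 z = R' / norm (poly q z)" by (simp add: s_def)
      then show ?thesis using R pos by (simp add: h_def norm_mult norm_divide)
    qed
    ultimately show ?thesis by simp
  qed
  have "continuous_on ({z. norm (poly q z) \<le> R'} \<union> {z. R' \<le> norm (poly q z)}) r"
    unfolding r_def
  proof (rule continuous_on_cases)
    show "closed {z. norm (poly q z) \<le> R'}" "closed {z. R' \<le> norm (poly q z)}"
      by (intro closed_Collect_le continuous_intros)+
    have "continuous_on {z. R' \<le> norm (poly q z)} (\<lambda>z. k (1, z))"
      by (rule continuous_on_compose2[OF k(1)]) (use R in \<open>auto intro!: continuous_intros simp: U_def\<close>)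
    then show "continuous_on {z. R' \<le> norm (poly q z)} (\<lambda>z. snd (k (1, z)))"
      by (intro continuous_intros)
  qed (use ends in \<open>auto intro: continuous_intros\<close>)
  moreover have "{z. norm (poly q z) \<le> R'} \<union> {z. R' \<le> norm (poly q z)} = UNIV" by auto
  ultimately have "connected (r ` UNIV)" by (metis connected_continuous_image connected_UNIV)
  moreover have "r ` UNIV = {z. norm (poly q z) \<le> R'}"
  proof (intro subset_antisym subsetI)
    fix z assume "z \<in> {z. norm (poly q z) \<le> R'}"
    then have "r z = z" by (simp add: r_def)
    then show "z \<in> range r" by (metis rangeI)
  qed (use qk in \<open>auto simp: r_def\<close>)
  ultimately show ?thesis by simp
qed

text \<open>The critical values of all iterates are bounded by the escape radius \<open>R\<close>, so the filled Julia
  set is a nested intersection of connected compact sublevel sets at any level above \<open>R\<close>.\<close>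

theorem connected_filled_julia_if_critical_points_in:
  fixes p :: "complex poly"
  assumes deg: "2 \<le> degree p"
    and crit: "\<And>w. poly (pderiv p) w = 0 \<Longrightarrow> w \<in> filled_julia (poly p)"
  shows "connected (filled_julia (poly p))"
proof -
  obtain R where R: "escape_radius (poly p) R" using escape_radius_poly[OF deg] by blast
  have Rpos: "0 < R" using R by (simp add: escape_radius_def)
  have R1: "escape_radius (poly p) (R + 1)" by (rule escape_radius_mono[OF R]) simp
  have conn: "connected {z. norm ((poly p ^^ n) z) \<le> R + 1}" for n
  proof -
    have "connected {z. norm (poly (iter_poly p n) z) \<le> R + 1}"
    proof (rule connected_poly_sublevel[where R = R])
      show "0 < degree (iter_poly p n)" using deg by (simp add: degree_iter_poly)
      fix w assume "poly (pderiv (iter_poly p n)) w = 0"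
      then obtain j where "poly (pderiv p) ((poly p ^^ j) w) = 0"
        unfolding critical_point_iter_poly by blast
      then have "w \<in> filled_julia (poly p)"
        using crit filled_julia_invariant_funpow by blast
      then show "norm (poly (iter_poly p n) w) \<le> R"
        using filled_julia_iff[OF R] by (simp add: poly_iter_poly less_imp_le)
    qed (use Rpos in auto)
    then show ?thesis by (simp add: poly_iter_poly)
  qed
  have comp: "compact {z. norm ((poly p ^^ n) z) \<le> R + 1}" for n
    using compact_poly_sublevel[of "iter_poly p n" "R + 1"] deg
    by (simp add: poly_iter_poly degree_iter_poly)
  have "connected (\<Inter> (range (\<lambda>n. {z. norm ((poly p ^^ n) z) \<le> R + 1})))"
  proof (rule connected_nest[OF comp conn])
    fix m n :: nat assume mn: "m \<le> n"
    have "norm ((poly p ^^ m) z) \<le> R + 1" if "norm ((poly p ^^ n) z) \<le> R + 1" for z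
    proof (rule ccontr)
      assume "\<not> norm ((poly p ^^ m) z) \<le> R + 1"
      then have "R + 1 < norm ((poly p ^^ m) z)" by simp
      moreover from this have "norm ((poly p ^^ m) z) \<le> norm ((poly p ^^ n) z)"
        by (intro escape_growth_from_le[OF R1 _ mn]) simp
      ultimately show False using that by linarith
    qed
    then show "{z. norm ((poly p ^^ n) z) \<le> R + 1} \<subseteq> {z. norm ((poly p ^^ m) z) \<le> R + 1}" by blast
  qed
  then show ?thesis by (simp add: filled_julia_eq_Inter[OF R1])
qed

text \<open>Moving \<open>a\<close> to \<open>b\<close> along a path in \<open>S\<close> deforms the quotient to the constant \<open>1\<close> through
  zero-free functions.\<close>

lemma continuous_log_quotient:
  fixes a b :: complex
  assumes "open S" "connected S" "a \<in> S" "b \<in> S" "V \<inter> S = {}"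
  obtains l where "continuous_on V l" "\<And>z. z \<in> V \<Longrightarrow> exp (l z) = (z - b) / (z - a)"
proof -
  have "path_connected S" using assms by (simp add: connected_open_path_connected)
  then obtain g where g: "path g" "path_image g \<subseteq> S" "pathstart g = a" "pathfinish g = b"
    using assms unfolding path_connected_def by blast
  have nz: "z - g t \<noteq> 0" if "z \<in> V" "t \<in> {0..1}" for z t
  proof -
    have "g t \<in> S" using g(2) that(2) unfolding path_image_def by blast
    then show ?thesis using that(1) assms(5) by auto
  qed
  define h where "h = (\<lambda>(t, z). (z - g t) / (z - a))"
  have g0: "g 0 = a" "g 1 = b" using g by (auto simp: pathstart_def pathfinish_def)
  have nza: "z - a \<noteq> 0" if "z \<in> V" for z using nz[OF that, of 0] g0 by simp
  have conth: "continuous_on ({0..1} \<times> V) h"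
  proof -
    have "continuous_on ({0..1} \<times> V) (\<lambda>x. g (fst x))"
      by (rule continuous_on_compose2[OF g(1)[unfolded path_def]]) (auto intro: continuous_intros)
    then show ?thesis
      unfolding h_def case_prod_beta by (intro continuous_intros) (use nza in auto)
  qed
  have him: "h \<in> {0..1} \<times> V \<rightarrow> - {0}"
  proof
    fix x :: "real \<times> complex" assume "x \<in> {0..1} \<times> V"
    then obtain t z where tz: "x = (t, z)" "t \<in> {0..1}" "z \<in> V" by blast
    then show "h x \<in> - {0}" using nz[OF tz(3,2)] nza[OF tz(3)] by (simp add: h_def)
  qed
  have heq: "h (0, z) = exp ((\<lambda>_. 0) z)" if "z \<in> V" for z
    using nza[OF that] by (simp add: h_def g0)
  obtain k where k: "continuous_on ({0..1} \<times> V) k" "\<And>x. x \<in> {0..1} \<times> V \<Longrightarrow> h x = exp (k x)"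
    by (rule covering_space_lift_homotopy[OF covering_space_exp_punctured_plane conth him heq]) auto
  show ?thesis
  proof
    show "continuous_on V (\<lambda>z. k (1, z))"
      by (rule continuous_on_compose2[OF k(1)]) (auto intro!: continuous_intros)
    show "exp (k (1, z)) = (z - b) / (z - a)" if "z \<in> V" for z
      using k(2)[of "(1, z)"] that by (simp add: h_def g0)
  qed
qed

text \<open>All factors \<open>z - r\<^sub>i\<close> of \<open>q\<close> differ from \<open>z - r\<^sub>0\<close> by factors that have logarithms on \<open>V\<close>.\<close>

lemma continuous_degree_root:
  fixes q :: "complex poly"
  assumes deg: "0 < degree q" and S: "open S" "connected S" "V \<inter> S = {}"
    and roots: "\<And>z. poly q z = 0 \<Longrightarrow> z \<in> S"
  obtains B where "continuous_on V B" "\<And>z. z \<in> V \<Longrightarrow> B z ^ degree q = poly q z"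
proof -
  let ?d = "degree q"
  obtain r where r: "smult (lead_coeff q) (\<Prod>i<?d. [:-r i, 1:]) = q"
    using complex_poly_decompose' by blast
  have val: "poly q z = lead_coeff q * (\<Prod>i<?d. z - r i)" for z
    by (subst r[symmetric]) (simp add: poly_prod)
  have rS: "r i \<in> S" if "i < ?d" for i
    using that by (intro roots) (auto simp: val)
  have "\<exists>l. continuous_on V l \<and> (\<forall>z\<in>V. exp (l z) = (z - r i) / (z - r 0))" if "i < ?d" for i
    using continuous_log_quotient[OF S(1,2) rS[OF deg] rS[OF that] S(3)] by metis
  then obtain l where l: "\<And>i. i < ?d \<Longrightarrow> continuous_on V (l i)"
      "\<And>i z. i < ?d \<Longrightarrow> z \<in> V \<Longrightarrow> exp (l i z) = (z - r i) / (z - r 0)"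
    by metis
  have lc: "lead_coeff q \<noteq> 0" using deg by auto
  define B where "B z = (z - r 0) * exp ((Ln (lead_coeff q) + (\<Sum>i<?d. l i z)) / of_nat ?d)" for z
  show ?thesis
  proof
    show "continuous_on V B" unfolding B_def using l(1) deg by (intro continuous_intros) auto
    fix z assume z: "z \<in> V"
    have nz: "z - r 0 \<noteq> 0" using z rS[OF deg] S(3) by auto
    have "B z ^ ?d = (z - r 0) ^ ?d * exp (of_nat ?d * ((Ln (lead_coeff q) + (\<Sum>i<?d. l i z)) / of_nat ?d))"
      unfolding B_def power_mult_distrib exp_of_nat_mult ..
    also have "\<dots> = (z - r 0) ^ ?d * (lead_coeff q * (\<Prod>i<?d. exp (l i z)))"
      using deg lc by (simp add: exp_add exp_sum)
    also have "(\<Prod>i<?d. exp (l i z)) = (\<Prod>i<?d. z - r i) / (z - r 0) ^ ?d"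
      using l(2) z by (simp add: prod_dividef)
    finally show "B z ^ ?d = poly q z" using nz by (simp add: val)
  qed
qed

lemma coeff_diff_const: "coeff (p - [:c:]) i = coeff p i - (if i = 0 then c else 0)"
  by (simp add: coeff_pCons split: nat.splits)

text \<open>As all roots of \<open>q\<close> lie in a connected open part of the sublevel set, \<open>q\<close> has a continuous
  \<open>d\<close>-th root outside the sublevel set. It is a proper open map onto the complement of a disc; so each of the \<open>d\<close> roots of
  \<open>y\<^sup>d = w\<close> is attained, and \<open>q = w\<close> has \<open>d\<close> distinct solutions.\<close>

lemma no_critical_point_outside:
  fixes q :: "complex poly"
  assumes deg: "0 < degree q" and R: "0 < R"
    and S: "open S" "connected S" "\<And>z. poly q z = 0 \<Longrightarrow> z \<in> S" "\<And>z. z \<in> S \<Longrightarrow> norm (poly q z) \<le> R"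
    and w: "R < norm (poly q w)"
  shows "poly (pderiv q) w \<noteq> 0"
proof
  assume crit: "poly (pderiv q) w = 0"
  let ?d = "degree q"
  define V where "V = {z. R < norm (poly q z)}"
  define Y where "Y = {y::complex. root ?d R < norm y}"
  have VS: "V \<inter> S = {}" using S(4) by (auto simp: V_def) (meson not_less)
  obtain B where B: "continuous_on V B" "\<And>z. z \<in> V \<Longrightarrow> B z ^ ?d = poly q z"
    using continuous_degree_root[OF deg S(1,2) VS S(3)] by metis
  have oV: "open V" unfolding V_def by (intro open_Collect_less continuous_intros)
  have normY: "y \<in> Y \<longleftrightarrow> R < norm (y ^ ?d)" for y
    using deg R by (simp add: Y_def norm_power)
      (metis norm_ge_zero not_le real_root_le_iff real_root_power_cancel)
  have holB: "B holomorphic_on V"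
  proof (rule holomorphic_root[where p = "\<lambda>x. monom 1 ?d - [:poly q x:]" and d = ?d, OF oV _ _ B(1)])
    show "(\<lambda>x. coeff (monom 1 ?d - [:poly q x:]) i) holomorphic_on V" for i
      unfolding coeff_diff_const by (cases "i = 0") (auto intro!: holomorphic_intros)
    show "degree (monom 1 ?d - [:poly q x:]) \<le> ?d" for x
      by (intro degree_diff_le) (auto simp: degree_monom_eq)
    show "poly (monom 1 ?d - [:poly q x:]) (B x) = 0" if "x \<in> V" for x
      using B(2)[OF that] by (simp add: poly_monom)
    show "poly (pderiv (monom 1 ?d - [:poly q x:])) (B x) \<noteq> 0" if "x \<in> V" for x
    proof -
      have "B x \<noteq> 0" using B(2)[OF that] that R deg by (auto simp: V_def power_0_left)
      then show ?thesis using deg by (simp add: pderiv_diff pderiv_monom poly_monom pderiv_pCons)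
    qed
  qed
  have wV: "w \<in> V" using w by (simp add: V_def)
  have "open (B ` V)"
  proof (subst open_subopen, intro ballI)
    fix y assume "y \<in> B ` V"
    then obtain z where z: "z \<in> V" "y = B z" by blast
    obtain e where e: "0 < e" "ball z e \<subseteq> V" using oV z(1) openE by blast
    have nc: "\<not> B constant_on ball z e"
    proof
      assume "B constant_on ball z e"
      then obtain b where b: "\<And>x. x \<in> ball z e \<Longrightarrow> B x = b" unfolding constant_on_def by blast
      have "poly q x = b ^ ?d" if "x \<in> ball z e" for x
        using B(2)[of x] b[OF that] that e(2) by auto
      then have "ball z e \<subseteq> {x. poly (q - [:b ^ ?d:]) x = 0}" by auto
      moreover have "q - [:b ^ ?d:] \<noteq> 0" using deg by (metis degree_pCons_0 eq_iff_diff_eq_0 less_irrefl)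
      ultimately have "finite (ball z e)" using poly_roots_finite finite_subset by blast
      then show False using uncountable_ball[OF e(1), of z] countable_finite by blast
    qed
    have "open (B ` ball z e)"
      by (rule open_mapping_thm[OF holomorphic_on_subset[OF holB e(2)] open_ball connected_ball
            open_ball order_refl nc])
    then show "\<exists>T. open T \<and> y \<in> T \<and> T \<subseteq> B ` V"
      using z e by (intro exI[of _ "B ` ball z e"]) auto
  qed
  moreover have BY: "B ` V \<subseteq> Y" unfolding image_subset_iff normY using B(2) by (simp add: V_def)
  ultimately have op: "openin (top_of_set Y) (B ` V)"
    by (simp add: open_subset)
  have cl: "closedin (top_of_set Y) (B ` V)"
    unfolding closedin_limpt
  proof (intro conjI BY allI impI)
    fix y assume y: "y islimpt B ` V \<and> y \<in> Y"
    then obtain x where xy: "(\<forall>n. x n \<in> B ` V) \<and> y \<in> Y \<and> x \<longlonglongrightarrow> y"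
      unfolding islimpt_sequential by blast
    then have "\<forall>n. \<exists>z. z \<in> V \<and> x n = B z" by blast
    then obtain z where z: "\<And>n. z n \<in> V" "\<And>n. x n = B (z n)" by metis
    have lim: "(\<lambda>n. poly q (z n)) \<longlonglongrightarrow> y ^ ?d"
    proof -
      have "(\<lambda>n. x n ^ ?d) \<longlonglongrightarrow> y ^ ?d" using xy by (intro tendsto_intros) auto
      then show ?thesis using z B(2) by simp
    qed
    then have "Bseq (\<lambda>n. poly q (z n))" using convergentI convergent_imp_Bseq by blast
    then obtain M where "\<And>n. norm (poly q (z n)) \<le> M" unfolding Bseq_def by blast
    then have "\<forall>n. z n \<in> {z. norm (poly q z) \<le> M}" by blast
    then obtain l r where lr: "strict_mono (r::nat\<Rightarrow>nat)" "(z \<circ> r) \<longlonglongrightarrow> l"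
      using compact_poly_sublevel[OF deg, of M, unfolded compact_def, rule_format, of z] by blast
    have "(\<lambda>n. poly q ((z \<circ> r) n)) \<longlonglongrightarrow> poly q l"
      by (intro tendsto_intros lr)
    moreover have "(\<lambda>n. poly q ((z \<circ> r) n)) \<longlonglongrightarrow> y ^ ?d"
      using LIMSEQ_subseq_LIMSEQ[OF lim lr(1)] by (simp add: o_def)
    ultimately have ql: "poly q l = y ^ ?d" by (rule LIMSEQ_unique)
    then have lV: "l \<in> V" using xy normY by (simp add: V_def)
    then have "(\<lambda>n. B ((z \<circ> r) n)) \<longlonglongrightarrow> B l"
      using z by (intro continuous_on_tendsto_compose[OF B(1) lr(2)]) auto
    moreover have "(\<lambda>n. B ((z \<circ> r) n)) \<longlonglongrightarrow> y"
      using LIMSEQ_subseq_LIMSEQ[of x y r] xy lr(1) z(2) by (simp add: o_def)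
    ultimately have "B l = y" by (rule LIMSEQ_unique)
    then show "y \<in> B ` V" using lV by blast
  qed
  have "connected Y"
  proof -
    have "Y = - cball 0 (root ?d R)" by (auto simp: Y_def)
    then show ?thesis using connected_complement_bounded_convex[of "cball (0::complex) (root ?d R)"] by simp
  qed
  then have surj: "B ` V = Y" using op cl wV unfolding connected_clopen by blast
  let ?w = "poly q w"
  have w0: "?w \<noteq> 0" using w R by auto
  have cardroots: "card {y. y ^ ?d = ?w} = ?d" by (rule card_nth_roots[OF w0 deg])
  have "{y. y ^ ?d = ?w} \<subseteq> B ` {z. poly (q - [:?w:]) z = 0}"
  proof
    fix y assume y: "y \<in> {y. y ^ ?d = ?w}"
    then have "y \<in> Y" using w normY by simp
    then obtain z where z: "z \<in> V" "y = B z" using surj by blast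
    then have "poly q z = ?w" using y B(2) by simp
    then show "y \<in> B ` {z. poly (q - [:?w:]) z = 0}" using z by auto
  qed
  moreover have degw: "degree (q - [:?w:]) = ?d"
  proof (rule antisym)
    show "?d \<le> degree (q - [:?w:])" using deg by (intro le_degree) (simp only: coeff_diff_const; auto)
  qed (intro degree_diff_le, auto)
  moreover have fin: "finite {z. poly (q - [:?w:]) z = 0}"
    using poly_roots_finite[of "q - [:?w:]"] degw deg by fastforce
  ultimately have "?d \<le> card {z. poly (q - [:?w:]) z = 0}"
    using surj_card_le cardroots by metis
  moreover have "card {z. poly (q - [:?w:]) z = 0} < ?d"
    using card_roots_less_degree[of "q - [:?w:]" w] crit deg degw by (simp add: pderiv_diff pderiv_pCons)
  ultimately show False by linarith
qed

text \<open>The normalisation \<open>0 \<in> K\<close> puts the roots of every iterate into the filled Julia set \<open>K\<close>. As \<open>K\<close> is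
  connected, they lie in one component of a sublevel set, and the previous lemma applies to an iterate
  that carries the escaping critical point beyond the escape radius.\<close>

theorem critical_points_in_connected_filled_julia:
  fixes p :: "complex poly"
  assumes deg: "2 \<le> degree p" and zero: "0 \<in> filled_julia (poly p)"
    and conn: "connected (filled_julia (poly p))" and crit: "poly (pderiv p) w = 0"
  shows "w \<in> filled_julia (poly p)"
proof (rule ccontr)
  assume w: "w \<notin> filled_julia (poly p)"
  obtain R where R: "escape_radius (poly p) R" using escape_radius_poly[OF deg] by blast
  have Rpos: "0 < R" using R by (simp add: escape_radius_def)
  obtain N where N: "R + 1 \<le> norm ((poly p ^^ N) w)" "1 \<le> N"
    using not_filled_juliaE[OF R w, of "R + 1" 1] by metis
  define q where "q = iter_poly p N"
  define S where "S = connected_component_set {z. norm ((poly p ^^ N) z) < R} 0"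
  have K: "filled_julia (poly p) \<subseteq> {z. norm ((poly p ^^ N) z) < R}"
    using filled_julia_iff[OF R] by blast
  have KS: "filled_julia (poly p) \<subseteq> S"
    unfolding S_def by (rule connected_component_maximal[OF zero conn K])
  have "poly (pderiv q) w \<noteq> 0"
  proof (rule no_critical_point_outside[where R = R and S = S])
    show "0 < degree q" using deg by (simp add: q_def degree_iter_poly)
    show "open S" unfolding S_def
      by (intro open_connected_component open_funpow_norm_less holomorphic_on_poly)
    show "z \<in> S" if "poly q z = 0" for z
    proof -
      have "(poly p ^^ N) z \<in> filled_julia (poly p)"
        using that zero by (simp add: q_def poly_iter_poly)
      then show ?thesis using KS filled_julia_invariant_funpow by blast
    qed
    show "norm (poly q z) \<le> R" if "z \<in> S" for z
      using that connected_component_subset unfolding S_def q_def poly_iter_poly by force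
    show "R < norm (poly q w)" using N by (simp add: q_def poly_iter_poly)
  qed (simp_all add: S_def Rpos)
  moreover have "poly (pderiv q) w = 0"
    unfolding q_def critical_point_iter_poly using N crit by (intro exI[of _ 0]) simp
  ultimately show False by blast
qed

section \<open>Indifferent fixed points\<close>

lemma finite_bounded_orbit_part:
  assumes R: "escape_radius f R" and z: "z \<notin> filled_julia f"
  shows "finite {n. norm ((f ^^ n) z) \<le> B}"
proof -
  obtain N where N: "max B R + 1 \<le> norm ((f ^^ N) z)" "R \<le> norm ((f ^^ N) z)"
    using not_filled_juliaE[OF R z, of "max B R + 1"] by metis
  have "n < N" if n: "norm ((f ^^ n) z) \<le> B" for n
  proof (rule ccontr)
    assume "\<not> n < N"
    then have "norm ((f ^^ N) z) \<le> norm ((f ^^ n) z)"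
      using escape_growth_from_le[OF R N(2), of n] by simp
    then show False using n N(1) by simp
  qed
  then have "{n. norm ((f ^^ n) z) \<le> B} \<subseteq> {..<N}" by blast
  then show ?thesis using finite_subset by blast
qed

text \<open>As \<open>F\<close> is injective near \<open>a\<close>, two lifts through \<open>F\<close> that agree with value \<open>a\<close> at one point agree
  near that point, hence everywhere.\<close>

lemma lift_unique_if_deriv_nonzero:
  assumes F: "F holomorphic_on UNIV" "deriv F a \<noteq> 0"
    and D: "open D" "connected D" "b \<in> D"
    and f: "f holomorphic_on D" "g holomorphic_on D" "f b = a" "g b = a"
    and eq: "\<And>x. x \<in> D \<Longrightarrow> F (f x) = F (g x)" and x: "x \<in> D"
  shows "f x = g x"
proof -
  obtain e where e: "0 < e" "inj_on F (ball a e)"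
    using has_complex_derivative_locally_injective[OF F(1) UNIV_I open_UNIV F(2)] by blast
  have cont: "continuous_on D f" "continuous_on D g"
    using f holomorphic_on_imp_continuous_on by blast+
  define V where "V = (D \<inter> f -` ball a e) \<inter> (D \<inter> g -` ball a e)"
  have "open V"
    unfolding V_def using cont D(1) by (intro open_Int continuous_open_preimage) auto
  moreover have "b \<in> V" using D f e by (simp add: V_def)
  moreover have "f y = g y" if "y \<in> V" for y
    using that eq[of y] inj_onD[OF e(2)] by (auto simp: V_def)
  moreover have "V \<subseteq> D" by (auto simp: V_def)
  ultimately show ?thesis
    using analytic_continuation_open[of V D f g] D f x by blast
qed

lemma strict_mono_add_le:
  fixes r :: "nat \<Rightarrow> nat"
  assumes "strict_mono r"
  shows "r n + k \<le> r (n + k)"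
proof (induction k)
  case (Suc k)
  have "r (n + k) < r (n + Suc k)" using assms by (simp add: strict_mono_def)
  then show ?case using Suc by simp
qed simp

text \<open>Lifting step by step through \<open>p\<close> never meets a critical point \<open>w\<close>, because some iterate of \<open>w\<close>
  would then land in \<open>D\<close>.\<close>

lemma holomorphic_inverse_branches:
  fixes p :: "complex poly"
  assumes deg: "0 < degree p" and fixpt: "poly p z0 = z0"
    and D: "open D" "simply_connected D" "z0 \<in> D"
    and crit: "\<And>w n. poly (pderiv p) w = 0 \<Longrightarrow> (poly p ^^ Suc n) w \<notin> D"
  shows "\<exists>g. g holomorphic_on D \<and> g z0 = z0 \<and> (\<forall>x\<in>D. (poly p ^^ n) (g x) = x)"
proof (induction n)
  case 0
  show ?case by (intro exI[of _ "\<lambda>x. x"]) (simp add: holomorphic_on_ident)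
next
  case (Suc n)
  then obtain g where g: "g holomorphic_on D" "g z0 = z0" "\<And>x. x \<in> D \<Longrightarrow> (poly p ^^ n) (g x) = x"
    by blast
  define P where "P x = p - [:g x:]" for x
  have poly_P: "poly (P x) z = poly p z - g x" for x z by (simp add: P_def)
  have degP: "degree (P x) = degree p" for x
  proof (rule antisym)
    show "degree p \<le> degree (P x)"
      using deg unfolding P_def by (intro le_degree) (simp only: coeff_diff_const; auto)
  qed (simp add: P_def degree_diff_le)
  obtain f where f: "f holomorphic_on D" "f z0 = z0" "\<And>y. y \<in> D \<Longrightarrow> poly (P y) (f y) = 0"
  proof (rule holomorphic_root_exists[where p = P and d = "degree p" and x = z0 and z = z0, OF D(1,2)])
    show "(\<lambda>x. coeff (P x) i) holomorphic_on D" for i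
      unfolding P_def coeff_diff_const by (cases "i = 0") (auto intro!: holomorphic_intros g)
    show "poly (pderiv (P x)) z \<noteq> 0" if x: "x \<in> D" and z: "poly (P x) z = 0" for x z
    proof
      assume "poly (pderiv (P x)) z = 0"
      then have "poly (pderiv p) z = 0" by (simp add: P_def pderiv_diff pderiv_pCons)
      moreover have "(poly p ^^ Suc n) z = x"
        using z g(3)[OF x] by (simp add: poly_P funpow_swap1)
      ultimately show False using crit x by metis
    qed
    show "poly (P z0) z0 = 0" by (simp add: poly_P fixpt g)
  qed (use that deg D in \<open>auto simp: degP\<close>)
  have "(poly p ^^ Suc n) (f x) = x" if "x \<in> D" for x
    using f(3)[OF that] g(3)[OF that] by (simp add: poly_P funpow_swap1)
  then show ?case using f by blast
qed

lemma tendsto_uniform_limit_compose: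
  fixes h :: "'a::metric_space \<Rightarrow> 'b::metric_space"
  assumes ul: "uniform_limit S F h sequentially" and cont: "continuous_on S h"
    and y: "y \<longlonglongrightarrow> a" "a \<in> S" "eventually (\<lambda>n. y n \<in> S) sequentially"
  shows "(\<lambda>n. F n (y n)) \<longlonglongrightarrow> h a"
proof (rule tendstoI)
  fix e :: real assume e: "0 < e"
  have "(\<lambda>n. h (y n)) \<longlonglongrightarrow> h a"
    by (rule continuous_on_tendsto_compose[OF cont y])
  then have "\<forall>\<^sub>F n in sequentially. dist (h (y n)) (h a) < e / 2"
    using e by (intro tendstoD) auto
  moreover have "\<forall>\<^sub>F n in sequentially. \<forall>x\<in>S. dist (F n x) (h x) < e / 2"
    using e by (intro uniform_limitD[OF ul]) auto
  ultimately show "\<forall>\<^sub>F n in sequentially. dist (F n (y n)) (h a) < e"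
    using y(3)
  proof eventually_elim
    case (elim n)
    then have "dist (F n (y n)) (h (y n)) < e / 2" by blast
    then show ?case using elim(1) dist_triangle[of "F n (y n)" "h a" "h (y n)"] by linarith
  qed
qed

text \<open>Suppose that all critical points escape, and take the largest disc about the fixed point
  \<open>z\<^sub>0\<close> that avoids the postcritical set. On it all iterates have inverse branches \<open>g\<^sub>n\<close> fixing
  \<open>z\<^sub>0\<close>, and they form a normal family. As \<open>\<bar>g\<^sub>n'(z\<^sub>0)\<bar> = 1\<close>, their limits are open maps, and
  \<open>g\<^sub>m\<^sub>+\<^sub>n = g\<^sub>m \<circ> g\<^sub>n\<close> makes the identity one of the limits. But the disc contains escaping points,
  and near them large iterates cannot have inverse branches close to the identity.\<close>

theorem critical_point_in_filled_julia_if_indifferent: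
  fixes p :: "complex poly"
  assumes deg: "2 \<le> degree p" and fixpt: "poly p z0 = z0"
    and mult: "norm (poly (pderiv p) z0) = 1"
  shows "\<exists>w. poly (pderiv p) w = 0 \<and> w \<in> filled_julia (poly p)"
proof (rule ccontr)
  assume "\<not> ?thesis"
  then have crit: "w \<notin> filled_julia (poly p)" if "poly (pderiv p) w = 0" for w
    using that by blast
  obtain R0 where R0: "escape_radius (poly p) R0" using escape_radius_poly[OF deg] by blast
  have degd: "0 < degree (pderiv p)" using deg by (simp add: degree_pderiv)
  have z0K: "z0 \<in> filled_julia (poly p)" by (rule filled_julia_fixed_point[of "poly p", OF fixpt])
  define PC where "PC = {(poly p ^^ Suc n) w | n w. poly (pderiv p) w = 0}"
  have PCK: "v \<notin> filled_julia (poly p)" if v: "v \<in> PC" for v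
  proof -
    obtain n w where "v = (poly p ^^ Suc n) w" "poly (pderiv p) w = 0" using v PC_def by blast
    then show ?thesis using crit filled_julia_invariant_funpow by metis
  qed
  have finPC: "finite {v \<in> PC. norm v \<le> B}" for B
  proof -
    let ?A = "SIGMA w:{w. poly (pderiv p) w = 0}. {n. norm ((poly p ^^ n) w) \<le> B}"
    have "pderiv p \<noteq> 0" using degd by auto
    then have "finite ?A"
      using poly_roots_finite finite_bounded_orbit_part[OF R0 crit] by (intro finite_SigmaI) auto
    moreover have "{v \<in> PC. norm v \<le> B} \<subseteq> (\<lambda>(w, n). (poly p ^^ n) w) ` ?A"
    proof
      fix v assume "v \<in> {v \<in> PC. norm v \<le> B}"
      then obtain n w where "v = (poly p ^^ Suc n) w" "poly (pderiv p) w = 0" "norm v \<le> B"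
        unfolding PC_def by blast
      then have "(w, Suc n) \<in> ?A" "v = (\<lambda>(w, n). (poly p ^^ n) w) (w, Suc n)" by auto
      then show "v \<in> (\<lambda>(w, n). (poly p ^^ n) w) ` ?A" by (rule rev_image_eqI)
    qed
    ultimately show ?thesis using finite_surj by blast
  qed
  obtain v where v: "v \<in> PC" "\<And>u. u \<in> PC \<Longrightarrow> dist z0 v \<le> dist z0 u"
  proof -
    have "\<not> constant (poly (pderiv p))" using degd constant_degree by (metis less_irrefl)
    then obtain w where "poly (pderiv p) w = 0" using fundamental_theorem_of_algebra by blast
    then have v0: "poly p w \<in> PC"
      unfolding PC_def by (intro CollectI exI[of _ "0::nat"] exI[of _ w]) simp
    define F where "F = {u \<in> PC. dist z0 u \<le> dist z0 (poly p w)}"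
    have "F \<subseteq> {u \<in> PC. norm u \<le> norm z0 + dist z0 (poly p w)}"
      using norm_triangle_ineq2 unfolding F_def dist_norm
      by (auto simp: norm_minus_commute) (smt (verit) norm_minus_commute norm_triangle_ineq2)
    then have "finite F" using finPC finite_subset by blast
    moreover have "F \<noteq> {}" using v0 by (auto simp: F_def)
    ultimately have fin: "finite (dist z0 ` F)" "dist z0 ` F \<noteq> {}" by auto
    then obtain v where v: "v \<in> F" "dist z0 v = Min (dist z0 ` F)"
      using Min_in[OF fin] by (metis imageE)
    have "dist z0 v \<le> dist z0 u" if "u \<in> PC" for u
    proof (cases "u \<in> F")
      case True
      then show ?thesis using v(2) Min_le[OF fin(1)] by auto
    next
      case False
      then show ?thesis using that v(1) by (auto simp: F_def)
    qed
    then show ?thesis using that[of v] v(1) by (auto simp: F_def)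
  qed
  define r where "r = dist z0 v"
  define D where "D = ball z0 r"
  have r: "0 < r" using PCK[OF v(1)] z0K by (auto simp: r_def)
  have D: "open D" "connected D" "simply_connected D" "z0 \<in> D"
    using r by (auto simp: D_def convex_imp_simply_connected)
  define R where "R = max R0 (norm z0 + r)"
  have R: "escape_radius (poly p) R" by (rule escape_radius_mono[OF R0]) (simp add: R_def)
  have DR: "norm x < R" if "x \<in> D" for x
  proof -
    have "norm (x - z0) < r" using that by (simp add: D_def dist_norm norm_minus_commute)
    then show ?thesis using norm_triangle_ineq[of z0 "x - z0"] by (simp add: R_def)
  qed
  have PCD: "(poly p ^^ Suc n) w \<notin> D" if "poly (pderiv p) w = 0" for w n
  proof -
    have "(poly p ^^ Suc n) w \<in> PC" unfolding PC_def using that by blast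
    then show ?thesis using v(2) by (fastforce simp: D_def r_def)
  qed
  have "\<exists>g. g holomorphic_on D \<and> g z0 = z0 \<and> (\<forall>x\<in>D. (poly p ^^ n) (g x) = x)" for n
    using holomorphic_inverse_branches[OF _ fixpt D(1,3,4) PCD] deg by simp
  then have "\<forall>n. \<exists>g. g holomorphic_on D \<and> g z0 = z0 \<and> (\<forall>x\<in>D. (poly p ^^ n) (g x) = x)" by blast
  then obtain g where g: "\<And>n. g n holomorphic_on D" "\<And>n. g n z0 = z0"
      "\<And>n x. x \<in> D \<Longrightarrow> (poly p ^^ n) (g n x) = x"
    by metis
  have gR: "norm (g n x) \<le> R" if x: "x \<in> D" for n x
  proof (rule ccontr)
    assume "\<not> norm (g n x) \<le> R"
    then have "R < norm (g n x)" by simp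
    moreover from this have "norm (g n x) \<le> norm ((poly p ^^ n) (g n x))"
      using escape_growth_from_le[OF R, of 0 "g n x" n] by simp
    ultimately show False using g(3)[OF x, of n] DR[OF x] by simp
  qed
  have dF: "norm (deriv (poly p ^^ n) z0) = 1" for n
  proof -
    have eq: "(poly p ^^ n) = poly (iter_poly p n)" by (simp add: fun_eq_iff poly_iter_poly)
    have it: "(poly p ^^ n) z0 = z0" for n by (induction n) (simp_all add: fixpt)
    have "norm (poly (pderiv (iter_poly p n)) z0) = 1"
      by (induction n)
        (simp_all add: pderiv_pCons pderiv_pcompose poly_pcompose poly_iter_poly it norm_mult mult)
    then show ?thesis unfolding eq using DERIV_imp_deriv[OF poly_DERIV] by metis
  qed
  have holF: "(poly p ^^ n) holomorphic_on UNIV" for n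
    by (rule holomorphic_on_funpow[OF holomorphic_on_poly])
  have dg: "norm (deriv (g n) z0) = 1" for n
  proof -
    have "((poly p ^^ n) has_field_derivative deriv (poly p ^^ n) z0) (at (g n z0))"
      using holomorphic_derivI[OF holF[of n] open_UNIV, of z0] by (simp add: g(2))
    moreover have "(g n has_field_derivative deriv (g n) z0) (at z0)"
      using holomorphic_derivI[OF g(1) D(1,4)] .
    ultimately have "((\<lambda>x. (poly p ^^ n) (g n x)) has_field_derivative
        deriv (poly p ^^ n) z0 * deriv (g n) z0) (at z0)"
      by (rule DERIV_chain2)
    moreover have "((\<lambda>x. (poly p ^^ n) (g n x)) has_field_derivative 1) (at z0)"
    proof -
      have "((\<lambda>x. x) has_field_derivative 1) (at z0)" by simp
      then show ?thesis
        by (rule has_field_derivative_transform_within_open[OF _ D(1,4)]) (simp add: g(3))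
    qed
    ultimately have "deriv (poly p ^^ n) z0 * deriv (g n) z0 = 1" by (rule DERIV_unique)
    then have "norm (deriv (poly p ^^ n) z0) * norm (deriv (g n) z0) = 1"
      by (metis norm_mult norm_one)
    then show ?thesis by (simp add: dF)
  qed
  let ?H = "{h. h holomorphic_on D \<and> (\<forall>x\<in>D. norm (h x) \<le> R)}"
  have gH: "g n \<in> ?H" for n using g(1) gR by blast
  have Hhol: "h holomorphic_on D" if "h \<in> ?H" for h using that by blast
  have Hbd: "\<exists>B. \<forall>h\<in>?H. \<forall>z\<in>K. norm (h z) \<le> B" if "K \<subseteq> D" for K
    using that by (intro exI[of _ R]) blast
  have rng1: "range g \<subseteq> ?H" using gH by blast
  obtain G r1 where G: "G holomorphic_on D" and r1: "strict_mono (r1 :: nat \<Rightarrow> nat)"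
    and Gpt: "\<And>x. x \<in> D \<Longrightarrow> (\<lambda>n. g (r1 n) x) \<longlonglongrightarrow> G x"
    and Gul: "\<And>K. \<lbrakk>compact K; K \<subseteq> D\<rbrakk> \<Longrightarrow> uniform_limit K (g \<circ> r1) G sequentially"
    by (rule Montel[of D ?H g, OF D(1) Hhol Hbd rng1]) blast+
  \<comment> \<open>Differences of indices along the convergent subsequence, chosen to tend to infinity.\<close>
  define m where "m j = r1 (2 * j) - r1 j" for j
  have m: "r1 (2 * j) = r1 j + m j" "j \<le> m j" for j
    using strict_mono_add_le[OF r1, of j j] by (simp_all add: m_def mult_2)
  have rng2: "range (\<lambda>j. g (m j)) \<subseteq> ?H" using gH by blast
  obtain h s where h: "h holomorphic_on D" and s: "strict_mono (s :: nat \<Rightarrow> nat)"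
    and hpt: "\<And>x. x \<in> D \<Longrightarrow> (\<lambda>n. g (m (s n)) x) \<longlonglongrightarrow> h x"
    and hul: "\<And>K. \<lbrakk>compact K; K \<subseteq> D\<rbrakk> \<Longrightarrow> uniform_limit K ((\<lambda>j. g (m j)) \<circ> s) h sequentially"
    by (rule Montel[of D ?H "\<lambda>j. g (m j)", OF D(1) Hhol Hbd rng2]) blast+
  define S where "S = cball z0 (r / 2)"
  have S: "compact S" "S \<subseteq> D" using r by (auto simp: S_def D_def)
  have Gz0: "G z0 = z0" using Gpt[OF D(4)] by (simp add: g(2) LIMSEQ_const_iff)
  have contG: "continuous (at z0) G"
    using G D continuous_on_eq_continuous_at holomorphic_on_imp_continuous_on by blast
  obtain d where d: "0 < d" "\<And>x. dist x z0 < d \<Longrightarrow> dist (G x) z0 < r / 4"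
    using contG[unfolded continuous_at_eps_delta, rule_format, of "r / 4"] r Gz0 by auto
  define \<delta> where "\<delta> = min d (r / 2)"
  have \<delta>: "0 < \<delta>" "ball z0 \<delta> \<subseteq> S" "ball z0 \<delta> \<subseteq> D"
    using d r by (auto simp: \<delta>_def S_def D_def)
  have Gsmall: "dist (G x) z0 < r / 4" if "x \<in> ball z0 \<delta>" for x
    using d(2)[of x] that by (simp add: \<delta>_def dist_commute)
  have "\<forall>\<^sub>F j in sequentially. \<forall>x\<in>S. dist ((g \<circ> r1) j x) (G x) < r / 4"
    using r by (intro uniform_limitD[OF Gul[OF S]]) simp
  then obtain J where J: "\<And>j x. j \<ge> J \<Longrightarrow> x \<in> S \<Longrightarrow> dist (g (r1 j) x) (G x) < r / 4"
    unfolding eventually_sequentially by auto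
  have gS: "g (r1 j) x \<in> S" if "j \<ge> J" "x \<in> ball z0 \<delta>" for j x
  proof -
    have "dist (g (r1 j) x) z0 < r / 2"
      using J[OF that(1)] Gsmall[OF that(2)] that(2) \<delta>(2)
        dist_triangle[of "g (r1 j) x" z0 "G x"] by fastforce
    then show ?thesis by (simp add: S_def dist_commute)
  qed
  have comp: "g (r1 (2 * j)) x = g (m j) (g (r1 j) x)" if j: "j \<ge> J" and x: "x \<in> ball z0 \<delta>" for j x
  proof (rule lift_unique_if_deriv_nonzero[where F = "poly p ^^ r1 (2 * j)" and D = "ball z0 \<delta>"
        and f = "g (r1 (2 * j))" and g = "\<lambda>x. g (m j) (g (r1 j) x)" and a = z0 and b = z0, OF holF _ _ _ _ _ _ g(2) _ _ x])
    show "deriv (poly p ^^ r1 (2 * j)) z0 \<noteq> 0" using dF[of "r1 (2 * j)"] by auto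
    show "g (r1 (2 * j)) holomorphic_on ball z0 \<delta>" using g(1) \<delta>(3) holomorphic_on_subset by blast
    have "g (m j) \<circ> g (r1 j) holomorphic_on ball z0 \<delta>"
    proof (rule holomorphic_on_compose_gen)
      show "g (r1 j) holomorphic_on ball z0 \<delta>" using g(1) \<delta>(3) holomorphic_on_subset by blast
      show "g (m j) holomorphic_on D" by (rule g(1))
      show "g (r1 j) ` ball z0 \<delta> \<subseteq> D" using gS[OF j] S(2) by blast
    qed
    then show "(\<lambda>x. g (m j) (g (r1 j) x)) holomorphic_on ball z0 \<delta>" by (simp add: o_def)
    fix y assume y: "y \<in> ball z0 \<delta>"
    have "g (r1 j) y \<in> D" "y \<in> D" using gS[OF j y] S(2) y \<delta>(3) by blast+
    then show "(poly p ^^ r1 (2 * j)) (g (r1 (2 * j)) y) =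
        (poly p ^^ r1 (2 * j)) (g (m j) (g (r1 j) y))"
      using g(3) by (simp add: m(1)[of j] funpow_add) (metis g(3) m(1) funpow_add comp_apply)
  qed (use \<delta> g(2) in simp_all)
  have sj: "j \<le> s j" for j using s seq_suble by blast
  have hG: "h (G x) = G x" if x: "x \<in> ball z0 \<delta>" for x
  proof (rule LIMSEQ_unique)
    have xD: "x \<in> D" using x \<delta>(3) by blast
    have Gsub: "(\<lambda>j. g (r1 (t j)) x) \<longlonglongrightarrow> G x" if "strict_mono t" for t
      using LIMSEQ_subseq_LIMSEQ[OF Gpt[OF xD] that] by (simp add: o_def)
    have "strict_mono (\<lambda>j. 2 * s j)" using s by (simp add: strict_mono_def)
    then have "(\<lambda>j. g (r1 (2 * s j)) x) \<longlonglongrightarrow> G x" by (rule Gsub)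
    moreover have "\<forall>\<^sub>F j in sequentially. g (r1 (2 * s j)) x = g (m (s j)) (g (r1 (s j)) x)"
      unfolding eventually_sequentially using comp x sj order_trans by blast
    ultimately show "(\<lambda>j. g (m (s j)) (g (r1 (s j)) x)) \<longlonglongrightarrow> G x"
      by (rule Lim_transform_eventually)
    have "(\<lambda>j. ((\<lambda>j. g (m j)) \<circ> s) j (g (r1 (s j)) x)) \<longlonglongrightarrow> h (G x)"
    proof (rule tendsto_uniform_limit_compose[OF hul[OF S]])
      show "continuous_on S h"
        using h S(2) holomorphic_on_imp_continuous_on continuous_on_subset by blast
      show "(\<lambda>j. g (r1 (s j)) x) \<longlonglongrightarrow> G x" by (rule Gsub[OF s])
      show "G x \<in> S" using Gsmall[OF x] r by (simp add: S_def dist_commute)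
      show "\<forall>\<^sub>F j in sequentially. g (r1 (s j)) x \<in> S"
        unfolding eventually_sequentially using gS x sj order_trans by blast
    qed
    then show "(\<lambda>j. g (m (s j)) (g (r1 (s j)) x)) \<longlonglongrightarrow> h (G x)" by (simp add: o_def)
  qed
  have dG: "deriv G z0 \<noteq> 0"
  proof -
    have "(\<lambda>n. (deriv ^^ 1) ((g \<circ> r1) n) z0) \<longlonglongrightarrow> (deriv ^^ 1) G z0"
    proof (rule higher_deriv_complex_uniform_limit[where A = "ball z0 (r / 2)"])
      show "uniform_limit (ball z0 (r / 2)) (g \<circ> r1) G sequentially"
        by (rule uniform_limit_on_subset[OF Gul[OF S]]) (auto simp: S_def)
      have "ball z0 (r / 2) \<subseteq> D" using r by (auto simp: D_def)
      then show "\<forall>\<^sub>F n in sequentially. (g \<circ> r1) n holomorphic_on ball z0 (r / 2)"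
        using holomorphic_on_subset[OF g(1)] by (intro always_eventually) simp
    qed (use r in auto)
    then have "(\<lambda>n. norm (deriv (g (r1 n)) z0)) \<longlonglongrightarrow> norm (deriv G z0)"
      by (intro tendsto_norm) simp
    then have "norm (deriv G z0) = 1" by (simp add: dg LIMSEQ_const_iff)
    then show ?thesis by auto
  qed
  have nc: "\<not> G constant_on ball z0 \<delta>"
  proof
    assume "G constant_on ball z0 \<delta>"
    then obtain c where c: "\<And>x. x \<in> ball z0 \<delta> \<Longrightarrow> G x = c" unfolding constant_on_def by blast
    have "((\<lambda>_. c) has_field_derivative 0) (at z0)" by simp
    then have "(G has_field_derivative 0) (at z0)"
      by (rule has_field_derivative_transform_within_open[OF _ open_ball]) (use c \<delta> in auto)
    then show False using dG DERIV_imp_deriv by blast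
  qed
  have GD: "G holomorphic_on ball z0 \<delta>" using G \<delta>(3) holomorphic_on_subset by blast
  have openV: "open (G ` ball z0 \<delta>)"
    by (rule open_mapping_thm[OF GD open_ball connected_ball open_ball order_refl nc])
  have hid: "h x = x" if x: "x \<in> D" for x
  proof (rule analytic_continuation_open[OF openV D(1) _ D(2) _ h _ _ x])
    show "G ` ball z0 \<delta> \<noteq> {}" using \<delta>(1) by simp
    show "G ` ball z0 \<delta> \<subseteq> D"
    proof
      fix y assume "y \<in> G ` ball z0 \<delta>"
      then obtain x where "x \<in> ball z0 \<delta>" "y = G x" by blast
      then have "dist y z0 < r / 4" using Gsmall by blast
      then show "y \<in> D" using r by (simp add: D_def dist_commute)
    qed
    show "(\<lambda>x. x) holomorphic_on D" by (rule holomorphic_on_ident)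
    show "h z = z" if "z \<in> G ` ball z0 \<delta>" for z using that hG by auto
  qed
  obtain e where e: "e \<in> D" "e \<notin> filled_julia (poly p)"
  proof -
    have "open (- filled_julia (poly p))"
      using compact_filled_julia[OF holomorphic_on_poly R] by (simp add: compact_imp_closed open_Compl)
    moreover have "v \<in> closure D" using r by (simp add: D_def r_def)
    ultimately have "- filled_julia (poly p) \<inter> D \<noteq> {}"
      using open_Int_closure_eq_empty PCK[OF v(1)] by (metis ComplI IntI empty_iff)
    then show ?thesis using that by blast
  qed
  obtain N where N: "R + 1 \<le> norm ((poly p ^^ N) e)"
    using not_filled_juliaE[OF R e(2), of "R + 1"] by metis
  have "(\<lambda>j. g (m (s j)) e) \<longlonglongrightarrow> e" using hpt[OF e(1)] hid[OF e(1)] by simp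
  moreover have "isCont (poly p ^^ N) e"
    using continuous_on_funpow[OF holomorphic_on_poly, of UNIV N p]
    by (simp add: continuous_on_eq_continuous_at)
  ultimately have "(\<lambda>j. (poly p ^^ N) (g (m (s j)) e)) \<longlonglongrightarrow> (poly p ^^ N) e"
    by (rule isCont_tendsto_compose[rotated])
  then have "(\<lambda>j. norm ((poly p ^^ N) (g (m (s j)) e))) \<longlonglongrightarrow> norm ((poly p ^^ N) e)"
    by (rule tendsto_norm)
  then have "\<forall>\<^sub>F j in sequentially. R < norm ((poly p ^^ N) (g (m (s j)) e))"
    using N by (intro order_tendstoD(1)) auto
  moreover have "\<forall>\<^sub>F j in sequentially. N \<le> j" by (rule eventually_ge_at_top)
  ultimately have "\<forall>\<^sub>F j in sequentially. False"
  proof eventually_elim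
    case (elim j)
    have "N \<le> m (s j)" using elim(2) sj[of j] m(2)[of "s j"] by linarith
    then have "norm ((poly p ^^ N) (g (m (s j)) e)) \<le> norm ((poly p ^^ m (s j)) (g (m (s j)) e))"
      using elim(1) by (intro escape_growth_from_le[OF R]) auto
    then show False using elim(1) g(3)[OF e(1)] DR[OF e(1)] by simp
  qed
  then show False by simp
qed

section \<open>Backward orbits of escaping points\<close>

definition backward_orbit :: "(complex \<Rightarrow> complex) \<Rightarrow> complex \<Rightarrow> complex set" where
  "backward_orbit f a = {z. \<exists>n. (f ^^ n) z = a}"

lemma escaping_iterate_eq_iff:
  assumes "escape_radius f R" "R \<le> norm a"
  shows "(f ^^ n) a = a \<longleftrightarrow> n = 0"
proof
  assume *: "(f ^^ n) a = a"
  have a: "0 < norm a" using assms unfolding escape_radius_def by linarith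
  have "2 ^ n * norm a \<le> norm a" using escape_growth[OF assms, of n] * by simp
  then have "(2::real) ^ n \<le> 1" using a by simp
  then show "n = 0" by (metis one_less_numeral_iff one_less_power not_le gr0I semiring_norm(76))
qed simp

lemma backward_orbit_level_unique:
  assumes R: "escape_radius f R" "R \<le> norm a" and "(f ^^ n) z = a" "(f ^^ m) z = a"
  shows "n = m"
proof -
  have *: "n = m" if "n \<le> m" "(f ^^ n) z = a" "(f ^^ m) z = a" for n m
  proof -
    have "(f ^^ m) z = (f ^^ (m - n)) ((f ^^ n) z)"
      using that(1) by (metis comp_apply funpow_add le_add_diff_inverse2)
    then have "(f ^^ (m - n)) a = a" using that by simp
    then show ?thesis using escaping_iterate_eq_iff[OF R] that(1) by simp
  qed
  then show ?thesis using assms by (cases "n \<le> m") (auto simp: not_le intro: less_imp_le dest: sym)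
qed

lemma backward_orbit_norm_le:
  assumes R: "escape_radius f R" "R \<le> norm a" and "z \<in> backward_orbit f a"
  shows "norm z \<le> norm a"
proof (rule ccontr)
  assume *: "\<not> ?thesis"
  obtain n where n: "(f ^^ n) z = a" using assms by (auto simp: backward_orbit_def)
  have "norm ((f ^^ 0) z) \<le> norm ((f ^^ n) z)"
    by (rule escape_growth_from_le[OF R(1)]) (use R * in auto)
  then show False using * n by simp
qed

lemma self_in_backward_orbit: "a \<in> backward_orbit f a"
  unfolding backward_orbit_def by (intro CollectI exI[of _ 0]) simp

text \<open>Near an escaping point only finitely many levels of the backward orbit occur, and each level is
  closed; so the orbit accumulates outside itself only at non-escaping points. Conversely, if the
  iterates omit \<open>a\<close> near a point of the Julia set, they also omit the preimages of \<open>a\<close>, and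
  Schottky's theorem bounds them uniformly near that point, although escaping points are nearby.\<close>

theorem julia_set_eq_limit_backward_orbit:
  fixes p :: "complex poly"
  assumes deg: "2 \<le> degree p" and R: "escape_radius (poly p) R" and a: "R \<le> norm a"
  shows "julia_set (poly p) = closure (backward_orbit (poly p) a) - backward_orbit (poly p) a"
proof -
  let ?K = "filled_julia (poly p)" and ?X = "backward_orbit (poly p) a"
  have a0: "0 < norm a" using R a unfolding escape_radius_def by linarith
  have aK: "a \<notin> ?K" using filled_julia_iff[OF R, of a] a by (metis funpow_0 not_le)
  have XK: "?X \<inter> ?K = {}"
    using aK filled_julia_invariant_funpow unfolding backward_orbit_def by fastforce
  have J: "julia_set (poly p) = frontier ?K" by (rule julia_set_eq_frontier[OF holomorphic_on_poly R])
  have compK: "compact ?K" by (rule compact_filled_julia[OF holomorphic_on_poly R])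
  have clK: "closed ?K" using compK by (rule compact_imp_closed)
  have "w \<in> frontier ?K" if w: "w \<in> closure ?X" "w \<notin> ?X" for w
  proof -
    have "w \<in> ?K"
    proof (rule ccontr)
      assume "w \<notin> ?K"
      then obtain N where N: "max R (norm a) + 1 \<le> norm ((poly p ^^ N) w)"
        using not_filled_juliaE[OF R, of w "max R (norm a) + 1"] by metis
      define U where "U = {z. max R (norm a) < norm ((poly p ^^ N) z)}"
      have oU: "open U" unfolding U_def by (rule open_funpow_norm_gt[OF holomorphic_on_poly])
      have wU: "w \<in> U" unfolding U_def mem_Collect_eq using N by linarith
      define F where "F = (\<Union>n<N. {z. poly (iter_poly p n) z = a})"
      have "closed F" unfolding F_def
        by (intro closed_UN finite_lessThan ballI closed_Collect_eq continuous_intros)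
      have "U \<inter> ?X \<subseteq> F"
      proof
        fix z assume z: "z \<in> U \<inter> ?X"
        then obtain n where n: "(poly p ^^ n) z = a" by (auto simp: backward_orbit_def)
        have "n < N"
        proof (rule ccontr)
          assume "\<not> n < N"
          then have "norm ((poly p ^^ N) z) \<le> norm ((poly p ^^ n) z)"
            using z by (intro escape_growth_from_le[OF R]) (auto simp: U_def)
          then show False using n z by (auto simp: U_def)
        qed
        then show "z \<in> F" using n by (auto simp: F_def poly_iter_poly)
      qed
      moreover have "w \<in> closure (U \<inter> ?X)" using open_Int_closure_subset[OF oU] wU w(1) by blast
      ultimately have "w \<in> F" using \<open>closed F\<close> by (metis closure_minimal subsetD)
      then show False using w(2) by (auto simp: F_def backward_orbit_def poly_iter_poly)
    qed
    moreover have "w \<in> closure (- ?K)"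
      using w(1) XK closure_mono[of ?X "- ?K"] by blast
    ultimately show ?thesis by (simp add: frontier_closures closure_closed[OF clK])
  qed
  moreover have "w \<in> closure ?X" if w: "w \<in> frontier ?K" for w
  proof (rule ccontr)
    assume "w \<notin> closure ?X"
    then have "w \<in> - closure ?X" by simp
    moreover have "open (- closure ?X)" by (intro open_Compl closed_closure)
    ultimately obtain e where e: "0 < e" "ball w e \<subseteq> - closure ?X" using openE by blast
    have disj: "z \<notin> ?X" if "z \<in> ball w e" for z using e(2) that closure_subset by blast
    have "\<not> constant (poly (p - [:a:]))"
    proof
      assume "constant (poly (p - [:a:]))"
      then have "degree (p - [:a:]) = 0" using constant_degree by blast
      moreover have "coeff (p - [:a:]) (degree p) \<noteq> 0" using deg
        by (simp only: coeff_diff_const) auto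
      then have "degree p \<le> degree (p - [:a:])" by (rule le_degree)
      ultimately show False using deg by simp
    qed
    then obtain b where "poly (p - [:a:]) b = 0" using fundamental_theorem_of_algebra by blast
    then have b: "poly p b = a" by simp
    have ba: "b \<noteq> a"
    proof
      assume "b = a"
      then have "2 * norm a \<le> norm a" using R a b unfolding escape_radius_def by metis
      then show False using a0 by linarith
    qed
    define F where "F n z = ((poly p ^^ n) z - a) / (b - a)" for n z
    have F: "F n z \<noteq> 0" "F n z \<noteq> 1" if z: "z \<in> ball w e" for n z
    proof -
      have "(poly p ^^ n) z \<noteq> a" "(poly p ^^ Suc n) z \<noteq> a"
        using disj[OF z] unfolding backward_orbit_def by blast+
      then have "(poly p ^^ n) z \<noteq> a" "(poly p ^^ n) z \<noteq> b" using b by auto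
      then show "F n z \<noteq> 0" "F n z \<noteq> 1" using ba by (simp_all add: F_def)
    qed
    have wK: "w \<in> ?K" using w clK by (simp add: frontier_def)
    \<comment> \<open>\<open>c\<close> bounds the normalised iterates \<open>F n\<close> at \<open>w\<close>, and \<open>M\<close> is Schottky's bound for radius \<open>1/2\<close>.\<close>
    define c where "c = (R + norm a) / norm (b - a)"
    define M where "M = exp (pi * exp (pi * (2 + 2 * c + 12 * (1/2) / (1 - 1/2))))"
    have bound: "norm (F n y) \<le> M" if y: "y \<in> ball w (e / 4)" for n y
    proof -
      define f where "f \<zeta> = F n (w + of_real (e / 2) * \<zeta>)" for \<zeta>
      have inb: "w + of_real (e / 2) * \<zeta> \<in> ball w e" if "\<zeta> \<in> cball 0 1" for \<zeta>
      proof -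
        have "norm (of_real (e / 2) * \<zeta>) \<le> e / 2 * 1"
          unfolding norm_mult using that e(1) by (intro mult_mono) auto
        then show ?thesis using e(1) by (simp add: dist_norm)
      qed
      define \<zeta> where "\<zeta> = (y - w) / of_real (e / 2)"
      have "of_real (e / 2) \<noteq> (0::complex)" using e(1) by simp
      then have \<zeta>_eq: "of_real (e / 2) * \<zeta> = y - w"
        unfolding \<zeta>_def times_divide_eq_right by (rule nonzero_mult_div_cancel_left)
      have y_eq: "y = w + of_real (e / 2) * \<zeta>" unfolding \<zeta>_eq by simp
      have "e / 2 * norm \<zeta> = norm (of_real (e / 2) * \<zeta>)" using e(1) by (simp add: norm_mult)
      also have "\<dots> < e / 4" unfolding \<zeta>_eq using y by (simp add: dist_norm norm_minus_commute)
      finally have "e / 2 * norm \<zeta> < e / 2 * (1 / 2)" by simp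
      then have "norm \<zeta> \<le> 1 / 2" using e(1) by (simp only: mult_less_cancel_left_pos half_gt_zero less_imp_le)
      have "norm (f \<zeta>) \<le> M"
        unfolding M_def
      proof (rule Schottky[where f = f and z = \<zeta>])
        have "(\<lambda>\<zeta>. (poly (iter_poly p n) (w + of_real (e / 2) * \<zeta>) - a) / (b - a)) holomorphic_on cball 0 1"
          using ba by (intro holomorphic_intros) auto
        then show "f holomorphic_on cball 0 1"
          by (rule holomorphic_transform) (simp only: f_def F_def poly_iter_poly)
        have "norm ((poly p ^^ n) w - a) \<le> R + norm a"
          using norm_triangle_ineq4[of "(poly p ^^ n) w" a] wK filled_julia_iff[OF R, of w]
          by (smt (verit))
        then show "norm (f 0) \<le> c"
          by (simp add: f_def F_def c_def norm_divide divide_right_mono)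
        show "\<not> (f z = 0 \<or> f z = 1)" if "z \<in> cball 0 1" for z
          unfolding f_def using F[OF inb[OF that]] by blast
      qed (use \<open>norm \<zeta> \<le> 1 / 2\<close> in auto)
      then show ?thesis unfolding f_def y_eq .
    qed
    have "\<not> ball w (e / 4) \<subseteq> ?K"
      using w e(1) unfolding frontier_def by (meson DiffD2 centre_in_ball divide_pos_pos
          interiorI open_ball zero_less_numeral)
    then obtain y where y: "y \<in> ball w (e / 4)" "y \<notin> ?K" by blast
    obtain N where N: "M * norm (b - a) + norm a + 1 \<le> norm ((poly p ^^ N) y)"
      using not_filled_juliaE[OF R y(2), of "M * norm (b - a) + norm a + 1"] by metis
    have "norm ((poly p ^^ N) y - a) \<le> M * norm (b - a)"
      using bound[OF y(1), of N] ba by (simp add: F_def norm_divide field_simps)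
    then show False using N norm_triangle_ineq2[of "(poly p ^^ N) y" a] by linarith
  qed
  moreover have "w \<notin> ?X" if w: "w \<in> frontier ?K" for w
    using XK w clK frontier_subset_closed by blast
  ultimately show ?thesis unfolding J by blast
qed

section \<open>Holomorphic families of polynomials\<close>

lemma holomorphic_on_poly_family:
  fixes p :: "complex \<Rightarrow> complex poly"
  assumes coef: "\<And>i. (\<lambda>c. coeff (p c) i) holomorphic_on W"
    and deg: "\<And>c. c \<in> W \<Longrightarrow> degree (p c) \<le> d" and f: "f holomorphic_on W"
  shows "(\<lambda>c. poly (p c) (f c)) holomorphic_on W"
proof -
  have "(\<lambda>c. \<Sum>i\<le>d. coeff (p c) i * f c ^ i) holomorphic_on W"
    by (intro holomorphic_intros coef f)
  then show ?thesis
    by (rule holomorphic_transform) (simp add: poly_eq_sum_atMost[OF deg])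
qed

text \<open>The condition \<open>avoid\<close> says that \<open>a\<close> is not a critical value of any iterate, so that all its
  iterated preimages are simple.\<close>

locale polynomial_family =
  fixes p :: "complex \<Rightarrow> complex poly" and W :: "complex set" and d :: nat and a :: complex
  assumes W: "open W" "simply_connected W"
    and coef: "\<And>i. (\<lambda>c. coeff (p c) i) holomorphic_on W"
    and deg: "\<And>c. c \<in> W \<Longrightarrow> degree (p c) = d" and d: "0 < d"
    and avoid: "\<And>c w n. c \<in> W \<Longrightarrow> poly (pderiv (p c)) w = 0 \<Longrightarrow> (poly (p c) ^^ Suc n) w \<noteq> a"
begin

lemma connected_W: "connected W"
  using W simply_connected_imp_connected by blast

lemma pulled_back_family:
  assumes u: "u holomorphic_on W" "\<forall>c\<in>W. (poly (p c) ^^ n) (u c) = a"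
  shows "(\<lambda>c. coeff (p c - [:u c:]) i) holomorphic_on W"
    and "c \<in> W \<Longrightarrow> degree (p c - [:u c:]) = d"
    and "c \<in> W \<Longrightarrow> poly (p c - [:u c:]) z = 0 \<Longrightarrow> poly (pderiv (p c - [:u c:])) z \<noteq> 0"
proof -
  show "(\<lambda>c. coeff (p c - [:u c:]) i) holomorphic_on W"
    unfolding coeff_diff_const by (cases "i = 0") (auto intro!: holomorphic_intros u coef)
  show "degree (p c - [:u c:]) = d" if "c \<in> W"
  proof (rule antisym)
    have "coeff (p c) d \<noteq> 0" using deg[OF that] d by auto
    then show "d \<le> degree (p c - [:u c:])"
      using d by (intro le_degree) (simp only: coeff_diff_const; auto)
  qed (use deg[OF that] in \<open>auto intro: degree_diff_le\<close>)
  show "poly (pderiv (p c - [:u c:])) z \<noteq> 0" if c: "c \<in> W" and z: "poly (p c - [:u c:]) z = 0"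
  proof
    assume "poly (pderiv (p c - [:u c:])) z = 0"
    then have "poly (pderiv (p c)) z = 0" by (simp add: pderiv_diff pderiv_pCons)
    moreover have "(poly (p c) ^^ Suc n) z = a"
      using z bspec[OF u(2) c] by (simp add: funpow_swap1)
    ultimately show False using avoid[OF c] by blast
  qed
qed

lemma holomorphic_preimage_exists:
  assumes "c1 \<in> W" "(poly (p c1) ^^ n) z = a"
  shows "\<exists>f. f holomorphic_on W \<and> f c1 = z \<and> (\<forall>c\<in>W. (poly (p c) ^^ n) (f c) = a)"
  using assms(2)
proof (induction n arbitrary: z)
  case 0
  then show ?case by (intro exI[of _ "\<lambda>_. a"]) simp
next
  case (Suc n)
  then have "(poly (p c1) ^^ n) (poly (p c1) z) = a" by (simp add: funpow_swap1)
  then obtain u where u: "u holomorphic_on W" "u c1 = poly (p c1) z"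
      "\<forall>c\<in>W. (poly (p c) ^^ n) (u c) = a"
    using Suc.IH by blast
  have root: "poly (p c1 - [:u c1:]) z = 0" by (simp add: u(2))
  obtain f where f: "f holomorphic_on W" "f c1 = z" "\<And>c. c \<in> W \<Longrightarrow> poly (p c - [:u c:]) (f c) = 0"
    by (rule holomorphic_root_exists[OF W pulled_back_family(1,2)[OF u(1,3)] d
          pulled_back_family(3)[OF u(1,3)] assms(1) root]) blast+
  have "(poly (p c) ^^ Suc n) (f c) = a" if "c \<in> W" for c
    using f(3)[OF that] bspec[OF u(3) that] by (simp add: funpow_swap1)
  then show ?case using f by blast
qed

lemma holomorphic_preimage_unique:
  assumes "f holomorphic_on W" "\<And>c. c \<in> W \<Longrightarrow> (poly (p c) ^^ n) (f c) = a"
    and "g holomorphic_on W" "\<And>c. c \<in> W \<Longrightarrow> (poly (p c) ^^ n) (g c) = a"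
    and c1: "c1 \<in> W" and "f c1 = g c1" and "c \<in> W"
  shows "f c = g c"
  using assms(1-4,6,7)
proof (induction n arbitrary: f g c)
  case (Suc n)
  define u where "u c = poly (p c) (f c)" for c
  have holu: "u holomorphic_on W"
    unfolding u_def by (rule holomorphic_on_poly_family[OF coef _ Suc.prems(1), of d]) (simp add: deg)
  have levu: "\<forall>c\<in>W. (poly (p c) ^^ n) (u c) = a"
    using Suc.prems(2) by (simp add: u_def funpow_swap1)
  have eq: "u c = poly (p c) (g c)" if "c \<in> W" for c
  proof (rule Suc.IH[OF holu bspec[OF levu] _ _ _ that])
    show "(\<lambda>c. poly (p c) (g c)) holomorphic_on W"
      by (rule holomorphic_on_poly_family[OF coef _ Suc.prems(3), of d]) (simp add: deg)
    show "(poly (p c) ^^ n) (poly (p c) (g c)) = a" if "c \<in> W" for c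
      using Suc.prems(4)[OF that] by (simp add: funpow_swap1)
    show "u c1 = poly (p c1) (g c1)" by (simp add: u_def Suc.prems)
  qed
  show ?case
  proof (rule continuous_root_unique[where p = "\<lambda>c. p c - [:u c:]" and T = W and x = c1
        and f = f and g = g and y = c])
    show "covering_space (SIGMA c:W. {z. poly (p c - [:u c:]) z = 0}) fst W"
      by (rule covering_space_roots_holomorphic[OF pulled_back_family(1,2)[OF holu levu] d
            pulled_back_family(3)[OF holu levu]])
    show "poly (p c - [:u c:]) (f c) = 0" if "c \<in> W" for c by (simp add: u_def)
    show "poly (p c - [:u c:]) (g c) = 0" if "c \<in> W" for c using eq[OF that] by simp
  qed (use Suc.prems c1 connected_W holomorphic_on_imp_continuous_on in auto)
qed simp

end

text \<open>The preimages of an escaping value \<open>a\<close> that no critical orbit hits are simple roots, so they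
  move holomorphically; the motion extends to the closure, which consists of the backward orbit and
  the Julia set.\<close>

theorem J_stable_if_escaping_value_avoided:
  fixes p :: "complex \<Rightarrow> complex poly"
  assumes \<rho>: "0 < \<rho>" and sub: "ball c0 \<rho> \<subseteq> \<Lambda>"
    and coef: "\<And>i. (\<lambda>c. coeff (p c) i) holomorphic_on ball c0 \<rho>"
    and deg: "\<And>c. c \<in> ball c0 \<rho> \<Longrightarrow> degree (p c) = d" and d2: "2 \<le> d"
    and R: "\<And>c. c \<in> ball c0 \<rho> \<Longrightarrow> escape_radius (poly (p c)) R" and a: "R \<le> norm a"
    and avoid: "\<And>c w n. \<lbrakk>c \<in> ball c0 \<rho>; poly (pderiv (p c)) w = 0\<rbrakk> \<Longrightarrow> (poly (p c) ^^ Suc n) w \<noteq> a"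
  shows "J_stable \<Lambda> (\<lambda>c. poly (p c)) c0"
proof -
  let ?W = "ball c0 \<rho>" and ?X = "\<lambda>c. backward_orbit (poly (p c)) a"
  interpret polynomial_family p ?W d a
    by unfold_locales (use coef deg d2 avoid in \<open>auto simp: convex_imp_simply_connected\<close>)
  have c0: "c0 \<in> ?W" using \<rho> by simp
  have level: "n = m" if "c \<in> ?W" "(poly (p c) ^^ n) z = a" "(poly (p c) ^^ m) z = a" for c z n m
    using backward_orbit_level_unique[OF R[OF that(1)] a that(2,3)] .
  have "\<forall>z. \<exists>f n. z \<in> ?X c0 \<longrightarrow> f holomorphic_on ?W \<and> f c0 = z \<and> (\<forall>c\<in>?W. (poly (p c) ^^ n) (f c) = a)"
    using holomorphic_preimage_exists[OF c0] unfolding backward_orbit_def by blast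
  then obtain f L where f: "\<And>z. z \<in> ?X c0 \<Longrightarrow> f z holomorphic_on ?W"
      "\<And>z. z \<in> ?X c0 \<Longrightarrow> f z c0 = z"
      "\<And>z c. z \<in> ?X c0 \<Longrightarrow> c \<in> ?W \<Longrightarrow> (poly (p c) ^^ L z) (f z c) = a"
    by metis
  define \<phi> where "\<phi> c z = f z c" for c z
  have \<phi>X: "\<phi> c z \<in> ?X c" if "c \<in> ?W" "z \<in> ?X c0" for c z
    using f(3)[OF that(2,1)] by (auto simp: \<phi>_def backward_orbit_def)
  \<comment> \<open>The level of a point is determined by the point, so a holomorphic preimage that meets a branch of
     the motion at one parameter coincides with it.\<close>
  have eqI: "g c = \<phi> c z" if "z \<in> ?X c0" "c \<in> ?W" "c1 \<in> ?W" "g holomorphic_on ?W"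
    "\<And>c. c \<in> ?W \<Longrightarrow> (poly (p c) ^^ n) (g c) = a" "g c1 = \<phi> c1 z" for g z c c1 n
  proof -
    have "n = L z" using level[OF that(3) that(5)[OF that(3)]] f(3)[OF that(1,3)] that(6)
      by (simp add: \<phi>_def)
    then show ?thesis
      using holomorphic_preimage_unique[OF that(4,5) f(1)[OF that(1)] _ that(3) _ that(2)]
        f(3)[OF that(1)] that(6) unfolding \<phi>_def by blast
  qed
  have inj: "inj_on (\<phi> c) (?X c0)" if c: "c \<in> ?W" for c
  proof (rule inj_onI)
    fix z w assume zw: "z \<in> ?X c0" "w \<in> ?X c0" "\<phi> c z = \<phi> c w"
    have "f z c0 = \<phi> c0 w"
      by (rule eqI[OF zw(2) c0 c f(1)[OF zw(1)] f(3)[OF zw(1)]]) (use zw(3) in \<open>simp_all add: \<phi>_def\<close>)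
    then show "z = w" using f(2) zw by (simp add: \<phi>_def)
  qed
  have img: "\<phi> c ` ?X c0 = ?X c" if c: "c \<in> ?W" for c
  proof (intro subset_antisym subsetI)
    fix w assume "w \<in> ?X c"
    then obtain n where "(poly (p c) ^^ n) w = a" by (auto simp: backward_orbit_def)
    then obtain g where g: "g holomorphic_on ?W" "g c = w" "\<And>c. c \<in> ?W \<Longrightarrow> (poly (p c) ^^ n) (g c) = a"
      using holomorphic_preimage_exists[OF c] by blast
    have z: "g c0 \<in> ?X c0" using g(3)[OF c0] by (auto simp: backward_orbit_def)
    have "g c = \<phi> c (g c0)"
      by (rule eqI[OF z c c0 g(1,3)]) (use f(2)[OF z] in \<open>simp_all add: \<phi>_def\<close>)
    then show "w \<in> \<phi> c ` ?X c0" using g(2) z by blast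
  qed (use \<phi>X c in blast)
  have equiv: "\<phi> c (poly (p c0) z) = poly (p c) (\<phi> c z)"
    if c: "c \<in> ?W" and z: "z \<in> ?X c0" "z \<noteq> a" for c z
  proof -
    obtain n where n: "L z = Suc n" using f(2)[OF z(1)] f(3)[OF z(1) c0] z(2) by (cases "L z") auto
    have lev: "(poly (p c) ^^ n) (poly (p c) (f z c)) = a" if "c \<in> ?W" for c
      using f(3)[OF z(1) that] by (simp add: n funpow_swap1)
    have pz: "poly (p c0) z \<in> ?X c0" using lev[OF c0] f(2)[OF z(1)] by (auto simp: backward_orbit_def)
    have "(\<lambda>c. poly (p c) (f z c)) c = \<phi> c (poly (p c0) z)"
    proof (rule eqI[OF pz c c0 _ lev])
      show "(\<lambda>c. poly (p c) (f z c)) holomorphic_on ?W"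
        by (rule holomorphic_on_poly_family[OF coef _ f(1)[OF z(1)], of d]) (simp add: deg)
      show "poly (p c0) (f z c0) = \<phi> c0 (poly (p c0) z)"
        using f(2)[OF z(1)] f(2)[OF pz] by (simp add: \<phi>_def)
    qed
    then show ?thesis by (simp add: \<phi>_def)
  qed
  have mot: "holomorphic_motion ?W c0 (?X c0) \<phi>"
    unfolding holomorphic_motion_def using f inj by (auto simp: \<phi>_def)
  have bd: "norm (\<phi> c z) \<le> norm a" if "c \<in> ?W" "z \<in> ?X c0" for c z
    using backward_orbit_norm_le[OF R[OF that(1)] a \<phi>X[OF that]] .
  define \<sigma> where "\<sigma> = \<rho> / 2"
  have \<sigma>: "0 < \<sigma>" "\<sigma> < \<rho>" using \<rho> by (simp_all add: \<sigma>_def)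
  obtain \<Phi> where \<Phi>: "\<And>c z. c \<in> ball c0 \<sigma> \<Longrightarrow> z \<in> ?X c0 \<Longrightarrow> \<Phi> c z = \<phi> c z"
    "holomorphic_motion (ball c0 \<sigma>) c0 (closure (?X c0)) \<Phi>"
    "\<And>c. c \<in> ball c0 \<sigma> \<Longrightarrow> continuous_on (closure (?X c0)) (\<Phi> c)"
    using holomorphic_motion_extension[OF \<sigma> mot bd] by blast
  have subW: "ball c0 \<sigma> \<subseteq> ?W" using \<sigma> by auto
  have J: "julia_set (poly (p c)) = closure (?X c) - ?X c" if "c \<in> ?W" for c
    using julia_set_eq_limit_backward_orbit[OF _ R[OF that] a] deg[OF that] d2 by simp
  have compX: "compact (closure (?X c0))"
  proof -
    have "?X c0 \<subseteq> cball 0 (norm a)" using backward_orbit_norm_le[OF R[OF c0] a] by auto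
    then have "bounded (?X c0)" using bounded_cball bounded_subset by blast
    then show ?thesis using bounded_closure by (auto simp: compact_eq_bounded_closed)
  qed
  have imX: "\<Phi> c ` ?X c0 = ?X c" if "c \<in> ball c0 \<sigma>" for c
    using img[of c] \<Phi>(1)[OF that] that subW by (metis image_cong subsetD)
  have imcl: "\<Phi> c ` closure (?X c0) = closure (?X c)" if c: "c \<in> ball c0 \<sigma>" for c
  proof
    show "\<Phi> c ` closure (?X c0) \<subseteq> closure (?X c)"
      by (rule image_closure_subset[OF \<Phi>(3)[OF c]]) (simp_all add: imX[OF c] closure_subset)
    have "closed (\<Phi> c ` closure (?X c0))"
      using compact_continuous_image[OF \<Phi>(3)[OF c] compX] by (rule compact_imp_closed)
    moreover have "?X c \<subseteq> \<Phi> c ` closure (?X c0)" using imX[OF c] closure_subset by blast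
    ultimately show "closure (?X c) \<subseteq> \<Phi> c ` closure (?X c0)" by (rule closure_minimal[rotated])
  qed
  have inj\<Phi>: "inj_on (\<Phi> c) (closure (?X c0))" if "c \<in> ball c0 \<sigma>" for c
    using \<Phi>(2) that by (simp add: holomorphic_motion_def)
  have imJ: "\<Phi> c ` julia_set (poly (p c0)) = julia_set (poly (p c))" if c: "c \<in> ball c0 \<sigma>" for c
  proof -
    have cW: "c \<in> ?W" using c subW by blast
    have "\<Phi> c ` (closure (?X c0) - ?X c0) = \<Phi> c ` closure (?X c0) - \<Phi> c ` ?X c0"
      by (rule inj_on_image_set_diff[OF inj\<Phi>[OF c] Diff_subset closure_subset])
    then show ?thesis unfolding J[OF c0] J[OF cW] imcl[OF c] imX[OF c] .
  qed
  have equivJ: "\<Phi> c (poly (p c0) z) = poly (p c) (\<Phi> c z)"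
    if c: "c \<in> ball c0 \<sigma>" and z: "z \<in> julia_set (poly (p c0))" for c z
  proof -
    have cW: "c \<in> ?W" using c subW by blast
    have zcl: "z \<in> closure (?X c0)" and zX: "z \<notin> ?X c0" using z by (simp_all add: J[OF c0])
    obtain x where x: "\<And>n. x n \<in> ?X c0" "x \<longlonglongrightarrow> z" using zcl unfolding closure_sequential by blast
    have za: "z \<noteq> a" using zX self_in_backward_orbit by blast
    have ev: "\<forall>\<^sub>F n in sequentially. x n \<noteq> a" by (rule tendsto_imp_eventually_ne[OF x(2) za])
    have px: "poly (p c0) (x n) \<in> ?X c0" if xa: "x n \<noteq> a" for n
    proof -
      have "x n \<in> ?X c0" by (rule x(1))
      then obtain k where k: "(poly (p c0) ^^ k) (x n) = a" by (auto simp: backward_orbit_def)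
      then obtain j where "k = Suc j" using xa by (cases k) auto
      then show ?thesis using k by (auto simp: backward_orbit_def funpow_swap1)
    qed
    have plim: "(\<lambda>n. poly (p c0) (x n)) \<longlonglongrightarrow> poly (p c0) z" by (intro tendsto_intros x)
    have pcl: "\<forall>\<^sub>F n in sequentially. poly (p c0) (x n) \<in> closure (?X c0)"
      using ev by eventually_elim (use px closure_subset in blast)
    have pz: "poly (p c0) z \<in> closure (?X c0)"
      by (rule Lim_in_closed_set[OF closed_closure pcl sequentially_bot plim])
    have "(\<lambda>n. \<Phi> c (poly (p c0) (x n))) \<longlonglongrightarrow> \<Phi> c (poly (p c0) z)"
      by (rule continuous_on_tendsto_compose[OF \<Phi>(3)[OF c] plim pz pcl])
    moreover have "\<forall>\<^sub>F n in sequentially. \<Phi> c (poly (p c0) (x n)) = poly (p c) (\<Phi> c (x n))"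
      using ev
    proof eventually_elim
      case (elim n)
      then show ?case using equiv[OF cW x(1) elim] \<Phi>(1)[OF c] px[OF elim] x(1) by simp
    qed
    ultimately have "(\<lambda>n. poly (p c) (\<Phi> c (x n))) \<longlonglongrightarrow> \<Phi> c (poly (p c0) z)"
      by (rule Lim_transform_eventually)
    moreover have "(\<lambda>n. poly (p c) (\<Phi> c (x n))) \<longlonglongrightarrow> poly (p c) (\<Phi> c z)"
    proof (intro tendsto_intros continuous_on_tendsto_compose[OF \<Phi>(3)[OF c] x(2) zcl])
      show "\<forall>\<^sub>F n in sequentially. x n \<in> closure (?X c0)"
        using x(1) closure_subset by (intro always_eventually) blast
    qed
    ultimately show ?thesis by (rule LIMSEQ_unique)
  qed
  show ?thesis
    unfolding J_stable_def
  proof (intro exI[of _ "ball c0 \<sigma>"] exI[of _ \<Phi>] conjI ballI)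
    show "holomorphic_motion (ball c0 \<sigma>) c0 (julia_set (poly (p c0))) \<Phi>"
      using \<Phi>(2) unfolding holomorphic_motion_def J[OF c0] by (meson DiffD1 Diff_subset inj_on_subset)
  qed (use \<sigma> subW sub imJ equivJ in auto)
qed

section \<open>Stability and the connectedness of Julia sets\<close>

lemma locally_uniform_escape_radius:
  fixes p :: "complex \<Rightarrow> complex poly"
  assumes \<Lambda>: "open \<Lambda>" "c0 \<in> \<Lambda>"
    and coef: "\<And>i. (\<lambda>c. coeff (p c) i) holomorphic_on \<Lambda>"
    and deg: "\<And>c. c \<in> \<Lambda> \<Longrightarrow> degree (p c) = d" and d: "2 \<le> d"
  obtains \<rho> R where "0 < \<rho>" "cball c0 \<rho> \<subseteq> \<Lambda>"
    "\<And>c. c \<in> cball c0 \<rho> \<Longrightarrow> escape_radius (poly (p c)) R"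
proof -
  obtain \<rho> where \<rho>: "0 < \<rho>" "cball c0 \<rho> \<subseteq> \<Lambda>"
    using \<Lambda> open_contains_cball_eq by blast
  define r where "r c = 1 + (2 + (\<Sum>i<d. norm (coeff (p c) i))) / norm (coeff (p c) d)" for c
  have nz: "coeff (p c) d \<noteq> 0" if "c \<in> \<Lambda>" for c
    using deg[OF that] d by auto
  have "continuous_on (cball c0 \<rho>) r"
    unfolding r_def
    by (intro continuous_intros continuous_on_subset[OF holomorphic_on_imp_continuous_on[OF coef] \<rho>(2)])
      (use nz \<rho>(2) in auto)
  moreover have "cball c0 \<rho> \<noteq> {}" using \<rho>(1) by auto
  ultimately obtain c1 where "\<And>c. c \<in> cball c0 \<rho> \<Longrightarrow> r c \<le> r c1"
    using continuous_attains_sup[OF compact_cball] by blast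
  moreover have "escape_radius (poly (p c)) (r c)" if "c \<in> \<Lambda>" for c
    using escape_radius_poly[of "p c"] deg[OF that] d by (simp add: r_def)
  ultimately show ?thesis
    using that[OF \<rho>, of "r c1"] escape_radius_mono \<rho>(2) by blast
qed

text \<open>A holomorphic motion of the compact Julia set over a disc consists of homeomorphisms.\<close>

lemma J_stable_connected_locally_constant:
  fixes p :: "complex \<Rightarrow> complex poly"
  assumes \<Lambda>: "open \<Lambda>" "c0 \<in> \<Lambda>"
    and coef: "\<And>i. (\<lambda>c. coeff (p c) i) holomorphic_on \<Lambda>"
    and deg: "\<And>c. c \<in> \<Lambda> \<Longrightarrow> degree (p c) = d" and d: "2 \<le> d"
    and stable: "J_stable \<Lambda> (\<lambda>c. poly (p c)) c0"
  obtains \<rho> where "0 < \<rho>" "ball c0 \<rho> \<subseteq> \<Lambda>"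
    "\<And>c. c \<in> ball c0 \<rho> \<Longrightarrow>
      connected (julia_set (poly (p c))) \<longleftrightarrow> connected (julia_set (poly (p c0)))"
proof -
  let ?J = "\<lambda>c. julia_set (poly (p c))"
  obtain \<rho>0 R where R: "0 < \<rho>0" "cball c0 \<rho>0 \<subseteq> \<Lambda>"
    "\<And>c. c \<in> cball c0 \<rho>0 \<Longrightarrow> escape_radius (poly (p c)) R"
    by (rule locally_uniform_escape_radius[OF \<Lambda> coef deg d]) blast+
  obtain W \<phi> where W: "open W" "c0 \<in> W" "W \<subseteq> \<Lambda>"
    and mot: "holomorphic_motion W c0 (?J c0) \<phi>"
    and im: "\<And>c. c \<in> W \<Longrightarrow> \<phi> c ` ?J c0 = ?J c"
    using stable unfolding J_stable_def by (elim exE conjE) (rule that, assumption+, blast)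
  obtain \<rho>1 where \<rho>1: "0 < \<rho>1" "ball c0 \<rho>1 \<subseteq> W" using W openE by blast
  define \<rho> where "\<rho> = min \<rho>0 \<rho>1"
  have \<rho>: "0 < \<rho>" "ball c0 \<rho> \<subseteq> W" "ball c0 \<rho> \<subseteq> cball c0 \<rho>0"
    using R(1) \<rho>1 by (auto simp: \<rho>_def)
  have Jcomp: "compact (?J c)" and JR: "?J c \<subseteq> cball 0 R" if "c \<in> ball c0 \<rho>" for c
  proof -
    have esc: "escape_radius (poly (p c)) R" using that R(3) \<rho>(3) by blast
    have J: "?J c = frontier (filled_julia (poly (p c)))"
      by (rule julia_set_eq_frontier[OF holomorphic_on_poly esc])
    have K: "compact (filled_julia (poly (p c)))"
      by (rule compact_filled_julia[OF holomorphic_on_poly esc])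
    then show "compact (?J c)" unfolding J by (rule compact_frontier)
    have "?J c \<subseteq> filled_julia (poly (p c))"
      unfolding J using K by (intro frontier_subset_closed compact_imp_closed)
    moreover have "norm z \<le> R" if "z \<in> filled_julia (poly (p c))" for z
      using that filled_julia_iff[OF esc, of z] by (metis funpow_0 less_imp_le)
    ultimately show "?J c \<subseteq> cball 0 R" by auto
  qed
  have c0: "c0 \<in> ball c0 \<rho>" using \<rho>(1) by simp
  have "holomorphic_motion (ball c0 \<rho>) c0 (?J c0) \<phi>"
    using mot \<rho>(2) unfolding holomorphic_motion_def by (meson holomorphic_on_subset subsetD)
  moreover have "norm (\<phi> c z) \<le> R" if "c \<in> ball c0 \<rho>" "z \<in> ?J c0" for c z
    using JR[OF that(1)] im[of c] that \<rho>(2) by fastforce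
  moreover have half: "0 < \<rho> / 2" "\<rho> / 2 < \<rho>" using \<rho>(1) by auto
  ultimately obtain \<Phi> where \<Phi>: "\<And>c z. c \<in> ball c0 (\<rho> / 2) \<Longrightarrow> z \<in> ?J c0 \<Longrightarrow> \<Phi> c z = \<phi> c z"
    "\<And>c. c \<in> ball c0 (\<rho> / 2) \<Longrightarrow> continuous_on (closure (?J c0)) (\<Phi> c)"
    using holomorphic_motion_extension[of "\<rho> / 2" \<rho> c0 "?J c0" \<phi> R] by metis
  have "connected (?J c) \<longleftrightarrow> connected (?J c0)" if c: "c \<in> ball c0 (\<rho> / 2)" for c
  proof -
    have cW: "c \<in> W" using c \<rho> by auto
    have "continuous_on (?J c0) (\<Phi> c)"
      using \<Phi>(2)[OF c] closure_subset continuous_on_subset by blast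
    then have "continuous_on (?J c0) (\<phi> c)"
      using \<Phi>(1)[OF c] by (simp cong: continuous_on_cong)
    moreover have "inj_on (\<phi> c) (?J c0)" using mot cW by (simp add: holomorphic_motion_def)
    ultimately have "?J c0 homeomorphic ?J c"
      using homeomorphic_compact[OF Jcomp[OF c0]] im[OF cW] by blast
    then show ?thesis using homeomorphic_connectedness by blast
  qed
  moreover have "ball c0 (\<rho> / 2) \<subseteq> \<Lambda>"
    using subset_ball[of "\<rho> / 2" \<rho> c0] half(2) \<rho>(2) W(3) by auto
  ultimately show ?thesis using that half(1) by blast
qed

lemma connected_julia_set_poly_iff:
  fixes p :: "complex poly"
  assumes deg: "2 \<le> degree p" and zero: "0 \<in> filled_julia (poly p)"
  shows "connected (julia_set (poly p)) \<longleftrightarrow>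
    (\<forall>w. poly (pderiv p) w = 0 \<longrightarrow> w \<in> filled_julia (poly p))"
proof -
  obtain R where R: "escape_radius (poly p) R" using escape_radius_poly[OF deg] by blast
  show ?thesis
    unfolding connected_julia_set_iff[OF holomorphic_on_poly R]
    using connected_filled_julia_if_critical_points_in[OF deg]
      critical_points_in_connected_filled_julia[OF deg zero] by blast
qed

section \<open>The cubic family\<close>

definition siegel_cubic_poly :: "real \<Rightarrow> complex \<Rightarrow> complex poly" where
  "siegel_cubic_poly \<theta> c = smult (exp (2 * of_real pi * \<i> * of_real \<theta>))
     [:0, 1, - (1/2 * (1 + 1/c)), 1 / (3 * c):]"

lemma open_punctured_plane: "open punctured_plane"
  by (intro open_Diff open_UNIV closed_singleton)

lemma siegel_cubic_eq_poly: "siegel_cubic \<theta> = (\<lambda>c. poly (siegel_cubic_poly \<theta> c))"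
  by (simp add: fun_eq_iff siegel_cubic_def siegel_cubic_poly_def power2_eq_square algebra_simps)

lemma norm_multiplier: "norm (exp (2 * of_real pi * \<i> * of_real \<theta>)) = 1"
  by (simp add: norm_exp_eq_Re)

lemma degree_siegel_cubic_poly: "c \<noteq> 0 \<Longrightarrow> degree (siegel_cubic_poly \<theta> c) = 3"
  by (simp add: siegel_cubic_poly_def)

lemma siegel_cubic_poly_0: "poly (siegel_cubic_poly \<theta> c) 0 = 0"
  by (simp add: siegel_cubic_poly_def)

lemma norm_pderiv_siegel_cubic_poly_0: "norm (poly (pderiv (siegel_cubic_poly \<theta> c)) 0) = 1"
  by (simp add: siegel_cubic_poly_def pderiv_smult pderiv_pCons norm_multiplier)

lemma critical_point_siegel_cubic_iff:
  assumes "c \<noteq> 0"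
  shows "poly (pderiv (siegel_cubic_poly \<theta> c)) z = 0 \<longleftrightarrow> z = 1 \<or> z = c"
proof -
  have "poly (pderiv (siegel_cubic_poly \<theta> c)) z =
      exp (2 * of_real pi * \<i> * of_real \<theta>) * ((1 - z) * (1 - z / c))"
    using assms by (simp add: siegel_cubic_poly_def pderiv_smult pderiv_pCons field_simps)
  then show ?thesis using assms by auto
qed

lemma holomorphic_coeff_siegel_cubic_poly:
  assumes "0 \<notin> W"
  shows "(\<lambda>c. coeff (siegel_cubic_poly \<theta> c) i) holomorphic_on W"
proof -
  have "coeff (siegel_cubic_poly \<theta> c) i = exp (2 * of_real pi * \<i> * of_real \<theta>) *
      (if i = 1 then 1 else if i = 2 then - (1/2 * (1 + 1/c)) else if i = 3 then 1 / (3 * c) else 0)" for c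
    by (auto simp: siegel_cubic_poly_def coeff_pCons numeral_eq_Suc split: nat.splits)
  then show ?thesis
    by (cases "i = 1"; cases "i = 2"; cases "i = 3") (use assms in \<open>auto intro!: holomorphic_intros\<close>)
qed

lemma connectedness_locus_iff:
  assumes "c \<noteq> 0"
  shows "c \<in> connectedness_locus \<theta> \<longleftrightarrow>
    1 \<in> filled_julia (siegel_cubic \<theta> c) \<and> c \<in> filled_julia (siegel_cubic \<theta> c)"
proof -
  have "0 \<in> filled_julia (poly (siegel_cubic_poly \<theta> c))"
    by (rule filled_julia_fixed_point) (rule siegel_cubic_poly_0)
  then have "connected (julia_set (siegel_cubic \<theta> c)) \<longleftrightarrow>
    (\<forall>w. poly (pderiv (siegel_cubic_poly \<theta> c)) w = 0 \<longrightarrow> w \<in> filled_julia (siegel_cubic \<theta> c))"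
    unfolding siegel_cubic_eq_poly
    by (intro connected_julia_set_poly_iff) (simp_all add: degree_siegel_cubic_poly assms)
  then show ?thesis
    using assms by (auto simp: connectedness_locus_def critical_point_siegel_cubic_iff)
qed

text \<open>The fixed point \<open>0\<close> is indifferent, so at most one of the two critical points escapes.\<close>

lemma critical_point_in_filled_julia:
  assumes "c \<noteq> 0"
  shows "1 \<in> filled_julia (siegel_cubic \<theta> c) \<or> c \<in> filled_julia (siegel_cubic \<theta> c)"
proof -
  have "\<exists>w. poly (pderiv (siegel_cubic_poly \<theta> c)) w = 0 \<and> w \<in> filled_julia (poly (siegel_cubic_poly \<theta> c))"
    by (rule critical_point_in_filled_julia_if_indifferent[of _ 0])
      (simp_all add: degree_siegel_cubic_poly assms siegel_cubic_poly_0 norm_pderiv_siegel_cubic_poly_0)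
  then show ?thesis
    using assms by (auto simp: siegel_cubic_eq_poly critical_point_siegel_cubic_iff)
qed

lemma siegel_cubic_escape_radius:
  assumes "c0 \<noteq> 0"
  obtains \<rho> R where "0 < \<rho>" "0 \<notin> cball c0 \<rho>"
    "\<And>c. c \<in> cball c0 \<rho> \<Longrightarrow> escape_radius (siegel_cubic \<theta> c) R"
proof -
  have c0: "c0 \<in> punctured_plane" using assms by simp
  have coef: "(\<lambda>c. coeff (siegel_cubic_poly \<theta> c) i) holomorphic_on punctured_plane" for i
    by (rule holomorphic_coeff_siegel_cubic_poly) simp
  have deg: "degree (siegel_cubic_poly \<theta> c) = 3" if "c \<in> punctured_plane" for c
    using that by (simp add: degree_siegel_cubic_poly)
  obtain \<rho> R where "0 < \<rho>" "cball c0 \<rho> \<subseteq> punctured_plane"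
    "\<And>c. c \<in> cball c0 \<rho> \<Longrightarrow> escape_radius (poly (siegel_cubic_poly \<theta> c)) R"
    by (rule locally_uniform_escape_radius[OF open_punctured_plane c0 coef deg]) auto
  then show ?thesis using that[of \<rho> R] unfolding siegel_cubic_eq_poly by blast
qed

lemma siegel_cubic_J_stableI:
  assumes \<rho>: "0 < \<rho>" "0 \<notin> ball c0 \<rho>"
    and R: "\<And>c. c \<in> ball c0 \<rho> \<Longrightarrow> escape_radius (siegel_cubic \<theta> c) R" and a: "R \<le> norm a"
    and avoid: "\<And>c n. c \<in> ball c0 \<rho> \<Longrightarrow>
      (siegel_cubic \<theta> c ^^ n) 1 \<noteq> a \<and> (siegel_cubic \<theta> c ^^ n) c \<noteq> a"
  shows "J_stable punctured_plane (siegel_cubic \<theta>) c0"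
  unfolding siegel_cubic_eq_poly
proof (rule J_stable_if_escaping_value_avoided[where d = 3, OF \<rho>(1)])
  have nz: "c \<noteq> 0" if "c \<in> ball c0 \<rho>" for c using \<rho>(2) that by auto
  show "ball c0 \<rho> \<subseteq> punctured_plane" using nz by blast
  show "(\<lambda>c. coeff (siegel_cubic_poly \<theta> c) i) holomorphic_on ball c0 \<rho>" for i
    by (rule holomorphic_coeff_siegel_cubic_poly[OF \<rho>(2)])
  show "degree (siegel_cubic_poly \<theta> c) = 3" if "c \<in> ball c0 \<rho>" for c
    using nz[OF that] by (rule degree_siegel_cubic_poly)
  show "escape_radius (poly (siegel_cubic_poly \<theta> c)) R" if "c \<in> ball c0 \<rho>" for c
    using R[OF that] by (simp add: siegel_cubic_eq_poly)
  show "(poly (siegel_cubic_poly \<theta> c) ^^ Suc n) w \<noteq> a"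
    if "c \<in> ball c0 \<rho>" "poly (pderiv (siegel_cubic_poly \<theta> c)) w = 0" for c w n
    using that(2) avoid[OF that(1), of "Suc n"]
    unfolding critical_point_siegel_cubic_iff[OF nz[OF that(1)]] siegel_cubic_eq_poly by blast
qed (use a in simp_all)

text \<open>Here both critical orbits stay inside the disc of radius \<open>R\<close>, so the value \<open>R\<close> itself is
  avoided.\<close>

lemma J_stable_if_interior:
  assumes T: "open T" "c0 \<in> T" "T \<subseteq> connectedness_locus \<theta>"
  shows "J_stable punctured_plane (siegel_cubic \<theta>) c0"
proof -
  have "c0 \<noteq> 0" using T by (auto simp: connectedness_locus_def)
  then obtain \<rho>0 R where R: "0 < \<rho>0" "0 \<notin> cball c0 \<rho>0"
    "\<And>c. c \<in> cball c0 \<rho>0 \<Longrightarrow> escape_radius (siegel_cubic \<theta> c) R"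
    using siegel_cubic_escape_radius by blast
  obtain \<rho>1 where \<rho>1: "0 < \<rho>1" "ball c0 \<rho>1 \<subseteq> T" using T openE by blast
  define \<rho> where "\<rho> = min \<rho>0 \<rho>1"
  have \<rho>: "0 < \<rho>" "ball c0 \<rho> \<subseteq> T" "ball c0 \<rho> \<subseteq> cball c0 \<rho>0"
    using R(1) \<rho>1 by (auto simp: \<rho>_def)
  have "R > 0" using R(1) R(3)[of c0] by (simp add: escape_radius_def)
  show ?thesis
  proof (rule siegel_cubic_J_stableI[where R = R and a = "of_real R", OF \<rho>(1)])
    fix c n assume c: "c \<in> ball c0 \<rho>"
    then have esc: "escape_radius (siegel_cubic \<theta> c) R" using R(3) \<rho>(3) by blast
    have cM: "c \<in> connectedness_locus \<theta>" using c \<rho>(2) T(3) by blast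
    then have "c \<noteq> 0" by (simp add: connectedness_locus_def)
    then have "norm ((siegel_cubic \<theta> c ^^ n) 1) < R" "norm ((siegel_cubic \<theta> c ^^ n) c) < R"
      using cM filled_julia_iff[OF esc] by (simp_all add: connectedness_locus_iff)
    then show "(siegel_cubic \<theta> c ^^ n) 1 \<noteq> of_real R \<and> (siegel_cubic \<theta> c ^^ n) c \<noteq> of_real R"
      using \<open>R > 0\<close> by auto
  next
    show "0 \<notin> ball c0 \<rho>" using R(2) \<rho>(3) by blast
    show "escape_radius (siegel_cubic \<theta> c) R" if "c \<in> ball c0 \<rho>" for c
      using that R(3) \<rho>(3) by blast
  qed (use \<open>R > 0\<close> in simp)
qed

lemma holomorphic_on_siegel_cubic_orbit:
  assumes "0 \<notin> W" "\<omega> holomorphic_on W"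
  shows "(\<lambda>c. (siegel_cubic \<theta> c ^^ n) (\<omega> c)) holomorphic_on W"
proof (induction n)
  case (Suc n)
  have "(\<lambda>c. poly (siegel_cubic_poly \<theta> c) ((siegel_cubic \<theta> c ^^ n) (\<omega> c))) holomorphic_on W"
  proof (rule holomorphic_on_poly_family[where p = "siegel_cubic_poly \<theta>" and d = 3, OF _ _ Suc])
    show "(\<lambda>c. coeff (siegel_cubic_poly \<theta> c) i) holomorphic_on W" for i
      by (rule holomorphic_coeff_siegel_cubic_poly[OF assms(1)])
    show "degree (siegel_cubic_poly \<theta> c) \<le> 3" if "c \<in> W" for c
    proof -
      have "c \<noteq> 0" using that assms(1) by blast
      then show ?thesis by (simp add: degree_siegel_cubic_poly)
    qed
  qed
  then show ?case by (simp add: siegel_cubic_eq_poly)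
qed (use assms in simp)

text \<open>One critical point \<open>\<omega>\<close> escapes, and then the other one has a bounded orbit for all nearby
  parameters. Let \<open>a\<close> lie off the orbit of \<open>\<omega>\<close>, with modulus above the escape radius. The
  bounded critical orbit never gets that far. The orbit of \<open>\<omega>\<close> has only finitely many points of modulus
  at most \<open>\<bar>a\<bar>\<close>, and these stay away from \<open>a\<close> under perturbation of \<open>c\<close>.\<close>

lemma J_stable_if_critical_point_escapes:
  assumes c0: "c0 \<noteq> 0" and hol: "\<omega> holomorphic_on UNIV"
    and crit: "\<And>c. {\<omega> c, \<omega>' c} = {1, c}"
    and esc: "\<omega> c0 \<notin> filled_julia (siegel_cubic \<theta> c0)"
  shows "J_stable punctured_plane (siegel_cubic \<theta>) c0"
proof -
  obtain \<rho>0 R where R: "0 < \<rho>0" "0 \<notin> cball c0 \<rho>0"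
    "\<And>c. c \<in> cball c0 \<rho>0 \<Longrightarrow> escape_radius (siegel_cubic \<theta> c) R"
    using siegel_cubic_escape_radius[OF c0] by blast
  define orb where "orb n c = (siegel_cubic \<theta> c ^^ n) (\<omega> c)" for n c
  have c0b: "c0 \<in> ball c0 \<rho>0" "c0 \<in> cball c0 \<rho>0" using R(1) by auto
  have Rpos: "0 < R" using R(3)[OF c0b(2)] by (simp add: escape_radius_def)
  have "uncountable {R<..<R + 1}" by (simp add: uncountable_open_interval)
  moreover have "countable (range (\<lambda>n. norm (orb n c0)))" by simp
  ultimately have "\<not> {R<..<R + 1} \<subseteq> range (\<lambda>n. norm (orb n c0))"
    using countable_subset by blast
  \<comment> \<open>Only countably many radii are met by the orbit of \<open>\<omega>\<close> at \<open>c\<^sub>0\<close>.\<close>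
  then obtain t where "t \<in> {R<..<R + 1}" "t \<notin> range (\<lambda>n. norm (orb n c0))" by blast
  then have t: "R < t" "\<And>n. norm (orb n c0) \<noteq> t" by auto
  define a :: complex where "a = of_real t"
  have na: "norm a = t" using t Rpos by (simp add: a_def)
  obtain N where N: "t + 1 \<le> norm (orb N c0)"
    using not_filled_juliaE[OF R(3)[OF c0b(2)] esc, of "t + 1"] unfolding orb_def by metis
  have lim: "(orb n \<longlongrightarrow> orb n c0) (nhds c0)" for n
  proof -
    have "orb n holomorphic_on ball c0 \<rho>0"
      unfolding orb_def using R(2) hol holomorphic_on_subset
      by (intro holomorphic_on_siegel_cubic_orbit) auto
    then have "continuous_on (ball c0 \<rho>0) (orb n)" by (rule holomorphic_on_imp_continuous_on)
    then have "isCont (orb n) c0" using c0b(1) by (simp add: continuous_on_eq_continuous_at)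
    then show ?thesis by (simp add: continuous_at tendsto_at_iff_tendsto_nhds)
  qed
  have "\<forall>\<^sub>F c in nhds c0. t < norm (orb N c)"
    using N by (intro order_tendstoD(1)[OF tendsto_norm[OF lim]]) auto
  moreover have "\<forall>\<^sub>F c in nhds c0. \<forall>n\<in>{..<N}. orb n c \<noteq> a"
  proof (rule eventually_ball_finite[OF finite_lessThan], intro ballI)
    fix n
    have "orb n c0 \<noteq> a" using t(2)[of n] na by auto
    then show "\<forall>\<^sub>F c in nhds c0. orb n c \<noteq> a" by (rule tendsto_imp_eventually_ne[OF lim])
  qed
  ultimately have "\<forall>\<^sub>F c in nhds c0. t < norm (orb N c) \<and> (\<forall>n\<in>{..<N}. orb n c \<noteq> a)"
    by (rule eventually_conj)
  then obtain e where e: "0 < e"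
      "\<And>c. dist c c0 < e \<Longrightarrow> t < norm (orb N c) \<and> (\<forall>n\<in>{..<N}. orb n c \<noteq> a)"
    unfolding eventually_nhds_metric by blast
  define \<rho> where "\<rho> = min \<rho>0 e"
  have \<rho>: "0 < \<rho>" "ball c0 \<rho> \<subseteq> cball c0 \<rho>0" using R(1) e(1) by (auto simp: \<rho>_def)
  show ?thesis
  proof (rule siegel_cubic_J_stableI[where R = R and a = a, OF \<rho>(1)])
    fix c n assume c: "c \<in> ball c0 \<rho>"
    then have escr: "escape_radius (siegel_cubic \<theta> c) R" using R(3) \<rho>(2) by blast
    have cnz: "c \<noteq> 0" using c \<rho>(2) R(2) by blast
    have ce: "t < norm (orb N c)" "\<And>n. n < N \<Longrightarrow> orb n c \<noteq> a"
      using e(2)[of c] c by (auto simp: \<rho>_def dist_commute)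
    have 1: "(siegel_cubic \<theta> c ^^ n) (\<omega> c) \<noteq> a"
    proof (cases "n < N")
      case True
      then show ?thesis using ce(2) by (simp add: orb_def)
    next
      case False
      then have "norm (orb N c) \<le> norm (orb n c)"
        unfolding orb_def using ce(1) t(1)
        by (intro escape_growth_from_le[OF escr]) (auto simp: orb_def)
      then have "orb n c \<noteq> a" using ce(1) na by auto
      then show ?thesis by (simp add: orb_def)
    qed
    have "\<not> norm ((siegel_cubic \<theta> c ^^ N) (\<omega> c)) < R" using ce(1) t(1) by (simp add: orb_def)
    then have "\<omega> c \<notin> filled_julia (siegel_cubic \<theta> c)" using filled_julia_iff[OF escr] by blast
    then have "\<omega>' c \<in> filled_julia (siegel_cubic \<theta> c)"
      using critical_point_in_filled_julia[OF cnz] crit[of c] by (metis insertE insertI1 insertI2 singletonD)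
    then have "norm ((siegel_cubic \<theta> c ^^ n) (\<omega>' c)) < R" using filled_julia_iff[OF escr] by blast
    then have 2: "(siegel_cubic \<theta> c ^^ n) (\<omega>' c) \<noteq> a" using na t(1) by auto
    have "1 \<in> {\<omega> c, \<omega>' c}" "c \<in> {\<omega> c, \<omega>' c}" by (simp_all add: crit)
    then show "(siegel_cubic \<theta> c ^^ n) 1 \<noteq> a \<and> (siegel_cubic \<theta> c ^^ n) c \<noteq> a"
      using 1 2 by auto
  next
    show "0 \<notin> ball c0 \<rho>" using R(2) \<rho>(2) by blast
    show "escape_radius (siegel_cubic \<theta> c) R" if "c \<in> ball c0 \<rho>" for c
      using that R(3) \<rho>(2) by blast
  qed (use na t in simp)
qed

lemma J_stable_if_exterior:
  assumes "c0 \<noteq> 0" "c0 \<notin> connectedness_locus \<theta>"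
  shows "J_stable punctured_plane (siegel_cubic \<theta>) c0"
proof (cases "1 \<in> filled_julia (siegel_cubic \<theta> c0)")
  case True
  then have "c0 \<notin> filled_julia (siegel_cubic \<theta> c0)" using assms by (simp add: connectedness_locus_iff)
  then show ?thesis
    using J_stable_if_critical_point_escapes[OF assms(1), of "\<lambda>c. c" "\<lambda>c. 1"]
    by (simp add: insert_commute)
next
  case False
  then show ?thesis
    using J_stable_if_critical_point_escapes[OF assms(1), of "\<lambda>c. 1" "\<lambda>c. c"] by simp
qed

lemma connectedness_locus_locally_constant:
  assumes c0: "c0 \<noteq> 0" and stable: "J_stable punctured_plane (siegel_cubic \<theta>) c0"
  obtains \<rho> where "0 < \<rho>" "ball c0 \<rho> \<subseteq> punctured_plane"
    "\<And>c. c \<in> ball c0 \<rho> \<Longrightarrow> c \<in> connectedness_locus \<theta> \<longleftrightarrow> c0 \<in> connectedness_locus \<theta>"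
proof -
  have c0P: "c0 \<in> punctured_plane" using c0 by simp
  have coef: "(\<lambda>c. coeff (siegel_cubic_poly \<theta> c) i) holomorphic_on punctured_plane" for i
    by (rule holomorphic_coeff_siegel_cubic_poly) simp
  have deg: "degree (siegel_cubic_poly \<theta> c) = 3" if "c \<in> punctured_plane" for c
    using that by (simp add: degree_siegel_cubic_poly)
  have stable': "J_stable punctured_plane (\<lambda>c. poly (siegel_cubic_poly \<theta> c)) c0"
    using stable unfolding siegel_cubic_eq_poly .
  obtain \<rho> where \<rho>: "0 < \<rho>" "ball c0 \<rho> \<subseteq> punctured_plane"
    "\<And>c. c \<in> ball c0 \<rho> \<Longrightarrow>
      connected (julia_set (poly (siegel_cubic_poly \<theta> c))) \<longleftrightarrow>
      connected (julia_set (poly (siegel_cubic_poly \<theta> c0)))"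
    by (rule J_stable_connected_locally_constant[OF open_punctured_plane c0P coef deg _ stable'])
      (assumption, simp, blast)
  show ?thesis
  proof (rule that[OF \<rho>(1,2)])
    fix c assume c: "c \<in> ball c0 \<rho>"
    then have "c \<noteq> 0" using \<rho>(2) by blast
    then show "c \<in> connectedness_locus \<theta> \<longleftrightarrow> c0 \<in> connectedness_locus \<theta>"
      using \<rho>(3)[OF c] c0 by (simp add: connectedness_locus_def siegel_cubic_eq_poly)
  qed
qed

theorem theorem3p1:
  fixes \<theta> :: real
  assumes "0 < \<theta>" and "\<theta> < 1" and "brjuno \<theta>"
  shows "punctured_plane - (top_of_set punctured_plane) frontier_of (connectedness_locus \<theta>) =
         {c \<in> punctured_plane. J_stable punctured_plane (siegel_cubic \<theta>) c}"
proof -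
  let ?P = "top_of_set punctured_plane" and ?M = "connectedness_locus \<theta>"
  note op = open_punctured_plane
  have "c \<notin> ?P frontier_of ?M \<longleftrightarrow> J_stable punctured_plane (siegel_cubic \<theta>) c"
    if c: "c \<in> punctured_plane" for c
  proof
    assume "c \<notin> ?P frontier_of ?M"
    then consider "c \<in> ?P interior_of ?M" | "c \<notin> ?P closure_of ?M"
      unfolding frontier_of_def by blast
    then show "J_stable punctured_plane (siegel_cubic \<theta>) c"
    proof cases
      case 1
      then obtain T where "openin ?P T" "c \<in> T" "T \<subseteq> ?M" unfolding interior_of_def by blast
      then show ?thesis using J_stable_if_interior op openin_open_eq by blast
    next
      case 2
      have "?M \<subseteq> ?P closure_of ?M"
        by (rule closure_of_subset) (auto simp: connectedness_locus_def)
      then show ?thesis using J_stable_if_exterior c 2 by blast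
    qed
  next
    assume "J_stable punctured_plane (siegel_cubic \<theta>) c"
    then obtain \<rho> where \<rho>: "0 < \<rho>" "ball c \<rho> \<subseteq> punctured_plane"
      "\<And>c'. c' \<in> ball c \<rho> \<Longrightarrow> c' \<in> ?M \<longleftrightarrow> c \<in> ?M"
      using connectedness_locus_locally_constant[of c \<theta>] c by blast
    have T: "openin ?P (ball c \<rho>)" "c \<in> ball c \<rho>"
      using \<rho>(1,2) op by (auto simp: openin_open_eq)
    show "c \<notin> ?P frontier_of ?M"
    proof (cases "c \<in> ?M")
      case True
      then have "c \<in> ?P interior_of ?M" unfolding interior_of_def using T \<rho>(3) by blast
      then show ?thesis by (simp add: frontier_of_def)
    next
      case False
      then have "c \<notin> ?P closure_of ?M" unfolding in_closure_of using T \<rho>(3) by blast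
      then show ?thesis by (simp add: frontier_of_def)
    qed
  qed
  then show ?thesis by blast
qed

end
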